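(* Let $N\in\mathbb N$, let $U$ be a finite-dimensional complex Banach space, let $L$ be a Laurent operator in the Wiener algebra, $b\in\ell^\infty(\mathbb Z^N,L(U))$ and $A=L+M_b$. If $b$ is almost periodic then, for all $p\in\{0\}\cup[1,\infty]$ and all $\tilde b\in\mathrm{Lim}(b)$, $$\mathrm{spec}^p_{\rm ess}(A)=\mathrm{spec}^p(A)=\mathrm{spec}^p(L+M_{\tilde b})=\bigcup_{c\in\mathrm{Lim}(b)}\mathrm{spec}^\infty_{\rm point}(L+M_c).$$
   Context: $Y^p=\ell^p(\mathbb Z^N,U)$ for $1\le p\le\infty$, $Y^0=c_0(\mathbb Z^N,U)$, with the usual norms. For $b\in\ell^\infty(\mathbb Z^N,L(U))$, $M_bx(m)=b(m)x(m)$. A Laurent operator in the Wiener algebra is $Lx(i)=\sum_{j\in\mathbb Z^N}\lambda_{i-j}x(j)$ with $\lambda_k\in L(U)$ and $\sum_{k\in\mathbb Z^N}\|\lambda_k\|<\infty$. $b\in\ell^\infty(\mathbb Z^N,L(U))$ is almost periodic if the set of translates $\{b(\cdot-k):k\in\mathbb Z^N\}$ is relatively compact in the norm of $\ell^\infty(\mathbb Z^N,L(U))$. $\mathrm{Lim}(b)$ is the set of limit functions of $b$: all $b_h\in\ell^\infty(\mathbb Z^N,L(U))$ for which there is a sequence $h:\mathbb N\to\mathbb Z^N$ with $|h(n)|\to\infty$ and $b_h(m)=\lim_{n\to\infty}b(m+h(n))$ for every $m\in\mathbb Z^N$. $\mathrm{spec}^p$, $\mathrm{spec}^p_{\rm ess}$,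 $\mathrm{spec}^p_{\rm point}$ denote spectrum, essential spectrum (set of $\lambda$ with $\lambda I-A$ not Fredholm) and point spectrum (set of eigenvalues) of an operator considered on $Y^p$. *)

theory Defs
  imports "HOL-Analysis.Analysis" "HOL-Library.Function_Algebras"
begin

section \<open>Complex normed spaces\<close>

text \<open>The real structure inherited from \<open>real_normed_vector\<close> is the restriction of scalars of the
  complex one. A complex Banach space is a type of sort \<open>{complex_normed_vector, banach}\<close>.\<close>

class complex_normed_vector = real_normed_vector +
  fixes scaleC :: "complex \<Rightarrow> 'a \<Rightarrow> 'a"  (infixr \<open>*\<^sub>C\<close> 75)
  assumes scaleC_add_right: "a *\<^sub>C (x + y) = a *\<^sub>C x + a *\<^sub>C y"
    and scaleC_add_left: "(a + b) *\<^sub>C x = a *\<^sub>C x + b *\<^sub>C x"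
    and scaleC_scaleC: "a *\<^sub>C (b *\<^sub>C x) = (a * b) *\<^sub>C x"
    and scaleC_one: "1 *\<^sub>C x = x"
    and scaleR_scaleC: "scaleR r x = complex_of_real r *\<^sub>C x"
    and norm_scaleC: "norm (a *\<^sub>C x) = cmod a * norm x"

instantiation complex :: complex_normed_vector
begin
definition scaleC_complex :: "complex \<Rightarrow> complex \<Rightarrow> complex"
  where "scaleC_complex a x = a * x"
instance
  by standard (auto simp: scaleC_complex_def algebra_simps norm_mult scaleR_conv_of_real)
end

definition cscale :: "complex \<Rightarrow> ('i \<Rightarrow> 'u::complex_normed_vector) \<Rightarrow> 'i \<Rightarrow> 'u"
  where "cscale a x = (\<lambda>i. a *\<^sub>C x i)"

lemma vector_space_scaleC:
  "vector_space (scaleC :: complex \<Rightarrow> 'u \<Rightarrow> 'u::complex_normed_vector)"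
  by standard (auto simp: scaleC_add_right scaleC_add_left scaleC_scaleC scaleC_one)

lemma vector_space_cscale:
  "vector_space (cscale :: complex \<Rightarrow> ('i \<Rightarrow> 'u) \<Rightarrow> 'i \<Rightarrow> 'u::complex_normed_vector)"
  by standard
    (auto simp: cscale_def fun_eq_iff scaleC_add_right scaleC_add_left scaleC_scaleC scaleC_one)

text \<open>To be applied to a linear subspace \<open>V\<close> of the vector space with scalar
  multiplication \<open>smul\<close>.\<close>

definition finite_dimensional ::
    "(complex \<Rightarrow> 'v \<Rightarrow> 'v) \<Rightarrow> 'v::ab_group_add set \<Rightarrow> bool"
  where "finite_dimensional smul V \<longleftrightarrow> (\<exists>B. finite B \<and> V = module.span smul B)"

text \<open>\<open>L(U)\<close>: the complex-linear operators among the bounded real-linear ones, with the operator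
  norm of \<open>'u \<Rightarrow>\<^sub>L 'u\<close>.\<close>

definition LU :: "('u::complex_normed_vector \<Rightarrow>\<^sub>L 'u) set"
  where "LU = {T. \<forall>a x. blinfun_apply T (a *\<^sub>C x) = a *\<^sub>C blinfun_apply T x}"


section \<open>The sequence spaces\<close>

definition zabs :: "int ^ 'n \<Rightarrow> int"
  where "zabs m = Max (range (\<lambda>i. \<bar>m $ i\<bar>))"

text \<open>The exponents \<open>0\<close> and \<open>\<infinity>\<close> stand for \<open>c\<^sub>0\<close> and \<open>\<ell>\<^sup>\<infinity>\<close>; otherwise \<open>1 \<le> p < \<infinity>\<close> is intended.
  In the case \<open>0\<close> the filter expresses the limit as \<open>zabs m\<close> tends to infinity.\<close>

definition Yspace :: "ennreal \<Rightarrow> (int ^ 'n \<Rightarrow> 'u::complex_normed_vector) set"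
  where "Yspace p =
    (if p = 0 then {x. (x \<longlongrightarrow> 0) (filtercomap zabs at_top)}
     else if p = \<infinity> then {x. bounded (range x)}
     else {x. (\<lambda>m. norm (x m) powr enn2real p) summable_on UNIV})"

definition Ynorm :: "ennreal \<Rightarrow> (int ^ 'n \<Rightarrow> 'u::complex_normed_vector) \<Rightarrow> real"
  where "Ynorm p x =
    (if p = 0 \<or> p = \<infinity> then (SUP m. norm (x m))
     else (\<Sum>\<^sub>\<infinity>m. norm (x m) powr enn2real p) powr (1 / enn2real p))"

definition linf_LU :: "(int ^ 'n \<Rightarrow> 'u::complex_normed_vector \<Rightarrow>\<^sub>L 'u) set"
  where "linf_LU = {b. bounded (range b) \<and> range b \<subseteq> LU}"

text \<open>\<open>Metric_space\<close> requires non-negativity off the carrier too, where the supremum may be that of an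
  unbounded set; hence the guard.\<close>

definition linf_dist :: "(int ^ 'n \<Rightarrow> 'u::complex_normed_vector \<Rightarrow>\<^sub>L 'u) \<Rightarrow>
    (int ^ 'n \<Rightarrow> 'u \<Rightarrow>\<^sub>L 'u) \<Rightarrow> real"
  where "linf_dist b c =
    (if b \<in> linf_LU \<and> c \<in> linf_LU then (SUP m. norm (b m - c m)) else 0)"

lemma Metric_space_linf:
  "Metric_space (linf_LU :: (int ^ 'n \<Rightarrow> 'u::complex_normed_vector \<Rightarrow>\<^sub>L 'u) set) linf_dist"
proof -
  have le: "norm (b m - c m) \<le> linf_dist b c"
    if bc: "b \<in> linf_LU" "c \<in> linf_LU" for b c :: "int ^ 'n \<Rightarrow> 'u \<Rightarrow>\<^sub>L 'u" and m
  proof -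
    from bc obtain B C where BC: "\<And>m. norm (b m) \<le> B" "\<And>m. norm (c m) \<le> C"
      by (auto simp: linf_LU_def bounded_iff)
    have "norm (b m - c m) \<le> B + C" for m
      using norm_triangle_ineq4[of "b m" "c m"] BC(1)[of m] BC(2)[of m] by linarith
    then have "bdd_above (range (\<lambda>m. norm (b m - c m)))"
      by (auto simp: bdd_above_def)
    from cSUP_upper[OF _ this, of m] bc show ?thesis
      by (simp add: linf_dist_def)
  qed
  have nonneg: "0 \<le> linf_dist b c" for b c :: "int ^ 'n \<Rightarrow> 'u \<Rightarrow>\<^sub>L 'u"
  proof (cases "b \<in> linf_LU \<and> c \<in> linf_LU")
    case True
    then show ?thesis using le[of b c 0] norm_ge_zero[of "b 0 - c 0"] by linarith
  qed (auto simp: linf_dist_def)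
  show ?thesis
  proof
    show "0 \<le> linf_dist b c" for b c :: "int ^ 'n \<Rightarrow> 'u \<Rightarrow>\<^sub>L 'u" by (rule nonneg)
    show "linf_dist b c = linf_dist c b" for b c :: "int ^ 'n \<Rightarrow> 'u \<Rightarrow>\<^sub>L 'u"
      unfolding linf_dist_def by (subst norm_minus_commute) auto
    show "linf_dist b c = 0 \<longleftrightarrow> b = c" if bc: "b \<in> linf_LU" "c \<in> linf_LU"
      for b c :: "int ^ 'n \<Rightarrow> 'u \<Rightarrow>\<^sub>L 'u"
    proof
      assume *: "linf_dist b c = 0"
      have "b m = c m" for m using le[OF bc, of m] * by simp
      then show "b = c" by (simp add: fun_eq_iff)
    qed (simp add: linf_dist_def)
    show "linf_dist b d \<le> linf_dist b c + linf_dist c d"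
      if "b \<in> linf_LU" "c \<in> linf_LU" "d \<in> linf_LU" for b c d :: "int ^ 'n \<Rightarrow> 'u \<Rightarrow>\<^sub>L 'u"
    proof -
      have "norm (b m - d m) \<le> linf_dist b c + linf_dist c d" for m
        using norm_diff_triangle_ineq[of "b m" "c m" "c m" "d m"]
          le[OF that(1,2), of m] le[OF that(2,3), of m] by simp
      then have "(SUP m. norm (b m - d m)) \<le> linf_dist b c + linf_dist c d"
        by (intro cSUP_least) auto
      then show ?thesis using that by (simp add: linf_dist_def)
    qed
  qed
qed


section \<open>Almost periodic functions and limit functions\<close>

definition almost_periodic :: "(int ^ 'n \<Rightarrow> 'u::complex_normed_vector \<Rightarrow>\<^sub>L 'u) \<Rightarrow> bool"
  where "almost_periodic b \<longleftrightarrow>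
    compactin (Metric_space.mtopology linf_LU linf_dist)
      (Metric_space.mtopology linf_LU linf_dist closure_of {\<lambda>m. b (m - k) | k. True})"

definition Lim_set :: "(int ^ 'n \<Rightarrow> 'u::complex_normed_vector \<Rightarrow>\<^sub>L 'u) \<Rightarrow> (int ^ 'n \<Rightarrow> 'u \<Rightarrow>\<^sub>L 'u) set"
  where "Lim_set b = {c \<in> linf_LU. \<exists>h :: nat \<Rightarrow> int ^ 'n.
    filterlim (\<lambda>n. zabs (h n)) at_top sequentially \<and>
    (\<forall>m. (\<lambda>n. b (m + h n)) \<longlonglongrightarrow> c m)}"


section \<open>Operators\<close>

text \<open>Operators act on all functions on \<open>\<int>\<^sup>N\<close>; the space \<open>Yspace p\<close> on which they are considered is
  an argument of the notions below.\<close>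

definition mult_op ::
    "(int ^ 'n \<Rightarrow> 'u::complex_normed_vector \<Rightarrow>\<^sub>L 'u) \<Rightarrow> (int ^ 'n \<Rightarrow> 'u) \<Rightarrow> int ^ 'n \<Rightarrow> 'u"
  where "mult_op b x = (\<lambda>m. blinfun_apply (b m) (x m))"

definition wiener_symbol :: "(int ^ 'n \<Rightarrow> 'u::complex_normed_vector \<Rightarrow>\<^sub>L 'u) \<Rightarrow> bool"
  where "wiener_symbol l \<longleftrightarrow> range l \<subseteq> LU \<and> (\<lambda>k. norm (l k)) summable_on UNIV"

definition laurent_op ::
    "(int ^ 'n \<Rightarrow> 'u::complex_normed_vector \<Rightarrow>\<^sub>L 'u) \<Rightarrow> (int ^ 'n \<Rightarrow> 'u) \<Rightarrow> int ^ 'n \<Rightarrow> 'u"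
  where "laurent_op l x = (\<lambda>i. \<Sum>\<^sub>\<infinity>j. blinfun_apply (l (i - j)) (x j))"

definition bounded_op_on ::
    "ennreal \<Rightarrow> ((int ^ 'n \<Rightarrow> 'u::complex_normed_vector) \<Rightarrow> int ^ 'n \<Rightarrow> 'u) \<Rightarrow> bool"
  where "bounded_op_on p T \<longleftrightarrow>
    T ` Yspace p \<subseteq> Yspace p \<and>
    (\<forall>x\<in>Yspace p. \<forall>y\<in>Yspace p. T (x + y) = T x + T y) \<and>
    (\<forall>a. \<forall>x\<in>Yspace p. T (cscale a x) = cscale a (T x)) \<and>
    (\<exists>C. \<forall>x\<in>Yspace p. Ynorm p (T x) \<le> C * Ynorm p x)"

definition invertible_on ::
    "ennreal \<Rightarrow> ((int ^ 'n \<Rightarrow> 'u::complex_normed_vector) \<Rightarrow> int ^ 'n \<Rightarrow> 'u) \<Rightarrow> bool"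
  where "invertible_on p T \<longleftrightarrow> bounded_op_on p T \<and>
    (\<exists>S. bounded_op_on p S \<and> (\<forall>x\<in>Yspace p. S (T x) = x \<and> T (S x) = x))"

text \<open>The last conjunct says that \<open>Yspace p / T (Yspace p)\<close> is finite-dimensional: it is spanned by
  the classes of the elements of \<open>B\<close>. Closedness of the range is a consequence.\<close>

definition fredholm_on ::
    "ennreal \<Rightarrow> ((int ^ 'n \<Rightarrow> 'u::complex_normed_vector) \<Rightarrow> int ^ 'n \<Rightarrow> 'u) \<Rightarrow> bool"
  where "fredholm_on p T \<longleftrightarrow> bounded_op_on p T \<and>
    finite_dimensional cscale {x \<in> Yspace p. T x = 0} \<and>
    (\<exists>B. finite B \<and> B \<subseteq> Yspace p \<and>
      (\<forall>y\<in>Yspace p. \<exists>x\<in>Yspace p. y - T x \<in> module.span cscale B))"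

definition spec ::
    "ennreal \<Rightarrow> ((int ^ 'n \<Rightarrow> 'u::complex_normed_vector) \<Rightarrow> int ^ 'n \<Rightarrow> 'u) \<Rightarrow> complex set"
  where "spec p A = {z. \<not> invertible_on p (\<lambda>x. cscale z x - A x)}"

definition spec_ess ::
    "ennreal \<Rightarrow> ((int ^ 'n \<Rightarrow> 'u::complex_normed_vector) \<Rightarrow> int ^ 'n \<Rightarrow> 'u) \<Rightarrow> complex set"
  where "spec_ess p A = {z. \<not> fredholm_on p (\<lambda>x. cscale z x - A x)}"

definition spec_point ::
    "ennreal \<Rightarrow> ((int ^ 'n \<Rightarrow> 'u::complex_normed_vector) \<Rightarrow> int ^ 'n \<Rightarrow> 'u) \<Rightarrow> complex set"
  where "spec_point p A = {z. \<exists>x\<in>Yspace p. x \<noteq> 0 \<and> A x = cscale z x}"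

end

theory Submission
  imports Defs
begin

text \<open>Write \<open>W\<^sub>c\<close> for the operator \<open>wiener_op l c\<close>, the sum of a Laurent operator in the Wiener algebra
  and the multiplication by \<open>c\<close>. The operator \<open>z I - A\<close> has this form for every \<open>z\<close>, with an almost
  periodic \<open>c\<close>. The theorem therefore follows from one equivalence, \<open>almost_periodic_fredholm_iff\<close>:
  for almost periodic \<open>b\<close> and every exponent \<open>p\<close>, the operator \<open>W\<^sub>b\<close> is Fredholm on \<open>Y\<^sup>p\<close> if and only if
  it is invertible on \<open>Y\<^sup>p\<close>, and if and only if \<open>W\<^sub>c\<close> is injective on \<open>\<ell>\<^sup>\<infinity>\<close> for every \<open>c\<close> in the hull
  of \<open>b\<close>, that is, for every uniform limit \<open>c\<close> of translates of \<open>b\<close>. The last condition does not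
  involve \<open>p\<close>, and it is the same for all members of the hull, because being in the hull is an
  equivalence relation; and the hull is \<open>Lim_set b\<close>, because almost periods of \<open>b\<close> allow the
  translations to be pushed to infinity.

  Three facts carry the equivalence.

  Stability (\<open>wiener_stability\<close>): a lower bound for \<open>W\<^sub>b\<close> on one of the spaces \<open>Y\<^sup>p\<close> gives one on each of
  them, and a bounded \<open>x\<close> with \<open>W\<^sub>b x\<close> in \<open>Y\<^sup>q\<close> must itself lie in \<open>Y\<^sup>q\<close>. The reason is that \<open>W\<^sub>b\<close>
  almost commutes with slowly varying cutoffs. The lower bound can thus be used on cubes of a fixed
  size, where the exponent does not matter, and the errors form a convolution with a kernel of small
  \<open>\<ell>\<^sup>1\<close> norm, which is absorbed by iteration. Hence everything about injectivity, surjectivity and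
  bounded inverses can be settled on \<open>\<ell>\<^sup>\<infinity>\<close>.

  Injectivity on the hull implies invertibility (\<open>injective_imp_invertible\<close>). A bounded below
  \<open>W\<^sub>b\<close> is obtained by compactness: a sequence of almost null vectors, translated so that they are
  large at the origin, would converge to a null vector of some \<open>W\<^sub>c\<close>. Surjectivity is a comparison of
  dimensions. If a finitely supported \<open>u\<close> is not in the range, then it has positive distance from it,
  and so have its translates by almost periods. These translates occur with positive density, and
  far apart ones are linearly independent modulo the range. After truncation to a band operator, the
  images of the sequences supported in a cube of side \<open>n\<close>, together with about \<open>n\<^sup>N\<close> times a
  constant such translates, would all fit into a cube that is larger by a constant only. This is
  impossible, since the boundary layer has a dimension of order \<open>n\<close> to the power \<open>N - 1\<close>.

  Fredholmness implies a lower bound (\<open>fredholm_imp_bounded_below\<close>). By the open mapping theorem an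
  almost null vector is close to the kernel. If there were almost null vectors of finite support and
  norm 1, then far apart translates of one of them by almost periods would be arbitrarily many
  vectors with disjoint supports, all close to the kernel, whose dimension is finite.\<close>

section \<open>Cubes in the lattice\<close>

lemma zabs_le_iff: "zabs m \<le> r \<longleftrightarrow> (\<forall>i. \<bar>m $ i\<bar> \<le> r)"
  unfolding zabs_def by (subst Max_le_iff) auto

lemma abs_component_le_zabs: "\<bar>m $ i\<bar> \<le> zabs m"
  using zabs_le_iff by blast

lemma zabs_nonneg [simp]: "0 \<le> zabs m"
  using abs_component_le_zabs[of m undefined] abs_ge_zero order_trans by blast

lemma zabs_0 [simp]: "zabs 0 = 0"
  by (rule antisym) (auto simp: zabs_le_iff)

lemma zabs_minus [simp]: "zabs (- m) = zabs m"
  by (simp add: zabs_def)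

lemma zabs_minus_commute: "zabs (a - b) = zabs (b - a)"
  by (metis minus_diff_eq zabs_minus)

lemma zabs_triangle: "zabs (a + b) \<le> zabs a + zabs b"
  unfolding zabs_le_iff
proof
  fix i
  show "\<bar>(a + b) $ i\<bar> \<le> zabs a + zabs b"
    using abs_component_le_zabs[of a i] abs_component_le_zabs[of b i] by simp
qed

lemma zabs_diff_triangle: "zabs (a - c) \<le> zabs (a - b) + zabs (b - c)"
  using zabs_triangle[of "a - b" "b - c"] by simp

definition cube :: "int ^ 'n \<Rightarrow> int \<Rightarrow> (int ^ 'n) set"
  where "cube m r = {i. zabs (i - m) \<le> r}"

lemma cube_eq_image:
  "cube 0 r = (\<lambda>f. \<chi> i. f i) ` (PiE UNIV (\<lambda>_. {-r..r}))"
proof -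
  have "m \<in> (\<lambda>f. \<chi> i. f i) ` (PiE UNIV (\<lambda>_. {-r..r}))" if "zabs m \<le> r" for m :: "int ^ 'n"
    using that by (intro image_eqI[where x = "\<lambda>i. m $ i"]) (auto simp: zabs_le_iff abs_le_iff minus_le_iff)
  then show ?thesis
    by (auto simp: cube_def zabs_le_iff abs_le_iff minus_le_iff)
qed

lemma card_cube_0:
  assumes "0 \<le> r" shows "card (cube (0 :: int ^ 'n) r) = nat (2 * r + 1) ^ CARD('n)"
proof -
  have "inj_on (\<lambda>f. (\<chi> i. f i) :: int ^ 'n) (PiE UNIV (\<lambda>_. {-r..r}))"
    by (auto simp: inj_on_def fun_eq_iff vec_eq_iff)
  then have "card (cube (0 :: int ^ 'n) r) = card (PiE (UNIV :: 'n set) (\<lambda>_. {-r..r}))"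
    unfolding cube_eq_image by (rule card_image)
  also have "\<dots> = nat (2 * r + 1) ^ CARD('n)"
    using assms by (simp add: card_PiE algebra_simps)
  finally show ?thesis .
qed

lemma finite_cube [simp]: "finite (cube m r)"
proof -
  have "finite (cube 0 r)"
    unfolding cube_eq_image by (intro finite_imageI finite_PiE) auto
  moreover have "cube m r \<subseteq> (\<lambda>i. i + m) ` cube 0 r"
    by (auto simp: cube_def intro!: image_eqI[where x = "_ - m"])
  ultimately show ?thesis using finite_surj by blast
qed

lemma mem_cube_self [simp]: "0 \<le> r \<Longrightarrow> m \<in> cube m r"
  by (simp add: cube_def)

lemma eventually_zabs_iff:
  "eventually P (filtercomap zabs at_top) \<longleftrightarrow> (\<exists>r. \<forall>m. r \<le> zabs m \<longrightarrow> P m)"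
  by (auto simp: eventually_filtercomap eventually_at_top_linorder)

section \<open>Scalar sequence spaces\<close>

definition admissible :: "ennreal \<Rightarrow> bool"
  where "admissible p \<longleftrightarrow> p = 0 \<or> 1 \<le> p"

text \<open>Membership in \<open>Yspace p\<close> and the norm depend only on the pointwise norms of a sequence. The estimates
  are therefore made for nonnegative functions, and this is the scalar version of the two notions.\<close>
definition in_lp :: "ennreal \<Rightarrow> (int ^ 'n \<Rightarrow> real) \<Rightarrow> bool"
  where "in_lp p f \<longleftrightarrow>
    (if p = 0 then (f \<longlongrightarrow> 0) (filtercomap zabs at_top)
     else if p = \<infinity> then bounded (range f)
     else (\<lambda>m. f m powr enn2real p) summable_on UNIV)"

definition lp_norm :: "ennreal \<Rightarrow> (int ^ 'n \<Rightarrow> real) \<Rightarrow> real"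
  where "lp_norm p f =
    (if p = 0 \<or> p = \<infinity> then (SUP m. f m)
     else (\<Sum>\<^sub>\<infinity>m. f m powr enn2real p) powr (1 / enn2real p))"

lemma Yspace_iff: "x \<in> Yspace p \<longleftrightarrow> in_lp p (\<lambda>m. norm (x m))"
  by (auto simp: Yspace_def in_lp_def tendsto_norm_zero_iff bounded_iff)

lemma Ynorm_eq: "Ynorm p x = lp_norm p (\<lambda>m. norm (x m))"
  by (simp add: Ynorm_def lp_norm_def)

lemma finite_exponent:
  assumes "admissible p" "p \<noteq> 0" "p \<noteq> \<infinity>"
  shows "1 \<le> enn2real p"
  using assms enn2real_mono[of 1 p] by (auto simp: admissible_def less_top)

lemma le_lp_norm_finite_exponent:
  assumes p: "admissible p" "p \<noteq> 0" "p \<noteq> \<infinity>" and f: "in_lp p f" and nn: "\<And>m. 0 \<le> f m"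
  shows "f m \<le> lp_norm p f"
proof -
  define q where "q = enn2real p"
  have q: "1 \<le> q" using finite_exponent p by (simp add: q_def)
  have s: "(\<lambda>m. f m powr q) summable_on UNIV" using f p by (simp add: in_lp_def q_def)
  have "f m powr q \<le> (\<Sum>\<^sub>\<infinity>m. f m powr q)"
    using finite_sum_le_infsum[OF s, of "{m}"] by simp
  then have "(f m powr q) powr (1 / q) \<le> (\<Sum>\<^sub>\<infinity>m. f m powr q) powr (1 / q)"
    using q by (intro powr_mono2) auto
  then show ?thesis using p q nn[of m] by (simp add: powr_powr lp_norm_def q_def)
qed

lemma in_lp_imp_bounded:
  assumes p: "admissible p" and f: "in_lp p f" and nn: "\<And>m. 0 \<le> f m"
  shows "bounded (range f)"
proof -
  consider "p = 0" | "p = \<infinity>" | "p \<noteq> 0" "p \<noteq> \<infinity>" by blast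
  then show ?thesis
  proof cases
    case 1
    then have "(f \<longlongrightarrow> 0) (filtercomap zabs at_top)" using f by (simp add: in_lp_def)
    then have "eventually (\<lambda>m. dist (f m) 0 < 1) (filtercomap zabs at_top)"
      by (rule tendstoD) simp
    then obtain r where r: "\<And>m. r \<le> zabs m \<Longrightarrow> \<bar>f m\<bar> < 1"
      unfolding eventually_zabs_iff by (auto simp: dist_norm)
    have "range f \<subseteq> f ` cube 0 r \<union> cball 0 1"
    proof
      fix y assume "y \<in> range f"
      then obtain m where y: "y = f m" by blast
      show "y \<in> f ` cube 0 r \<union> cball 0 1"
      proof (cases "r \<le> zabs m")
        case True
        then show ?thesis using r[of m] y by simp
      next
        case False
        then show ?thesis using y by (auto simp: cube_def)
      qed
    qed
    moreover have "bounded (f ` cube 0 r \<union> cball 0 1)"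
      by (simp add: finite_imp_bounded)
    ultimately show ?thesis using bounded_subset by blast
  next
    case 2
    then show ?thesis using f by (simp add: in_lp_def)
  next
    case 3
    then show ?thesis
      using le_lp_norm_finite_exponent[OF p 3 f nn] nn by (auto simp: bounded_iff)
  qed
qed

lemma le_lp_norm:
  assumes p: "admissible p" and f: "in_lp p f" and nn: "\<And>m. 0 \<le> f m"
  shows "f m \<le> lp_norm p f"
proof (cases "p = 0 \<or> p = \<infinity>")
  case True
  have "bdd_above (range f)"
    using in_lp_imp_bounded[OF assms] by (rule bounded_imp_bdd_above)
  then show ?thesis using True by (auto simp: lp_norm_def intro: cSUP_upper)
next
  case False
  then show ?thesis using le_lp_norm_finite_exponent[OF p _ _ f nn] by blast
qed

lemma lp_norm_nonneg:
  assumes "admissible p" "in_lp p f" "\<And>m. 0 \<le> f m"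
  shows "0 \<le> lp_norm p f"
  using le_lp_norm[OF assms, of 0] assms(3)[of 0] by linarith

lemma lp_norm_sup_le:
  assumes "p = 0 \<or> p = \<infinity>" "\<And>m. f m \<le> C"
  shows "lp_norm p f \<le> C"
  using assms by (auto simp: lp_norm_def intro!: cSUP_least)

lemma lp_norm_powr:
  assumes "p \<noteq> 0" "p \<noteq> \<infinity>" "admissible p"
  shows "lp_norm p f powr enn2real p = (\<Sum>\<^sub>\<infinity>m. f m powr enn2real p)"
  using assms finite_exponent[of p] by (simp add: lp_norm_def powr_powr infsum_nonneg)

lemma lp_normI:
  assumes p: "p \<noteq> 0" "p \<noteq> \<infinity>" "admissible p" and C: "0 \<le> C"
    and le: "\<And>M. finite M \<Longrightarrow> (\<Sum>m\<in>M. f m powr enn2real p) \<le> C powr enn2real p"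
  shows "in_lp p f \<and> lp_norm p f \<le> C"
proof -
  define q where "q = enn2real p"
  have q: "1 \<le> q" using finite_exponent p by (simp add: q_def)
  have s: "(\<lambda>m. f m powr q) summable_on UNIV"
    using le by (intro nonneg_bdd_above_summable_on) (auto simp: bdd_above_def q_def)
  have "(\<Sum>\<^sub>\<infinity>m. f m powr q) \<le> C powr q"
    using s le by (intro infsum_le_finite_sums) (auto simp: q_def)
  then have "(\<Sum>\<^sub>\<infinity>m. f m powr q) powr (1 / q) \<le> (C powr q) powr (1 / q)"
    using q by (intro powr_mono2 infsum_nonneg) auto
  then show ?thesis using s p q C by (simp add: in_lp_def lp_norm_def q_def powr_powr)
qed

text \<open>Jensen's inequality for the power \<open>q\<close>, with weights proportional to \<open>c\<close>. The comparison with \<open>B\<close>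
  says that \<open>a\<close> vanishes where the weight does.\<close>
lemma powr_sum_le:
  fixes a c :: "'k \<Rightarrow> real"
  assumes F: "finite F" and q: "1 \<le> q"
    and a: "\<And>k. k \<in> F \<Longrightarrow> 0 \<le> a k" and c: "\<And>k. k \<in> F \<Longrightarrow> 0 \<le> c k"
    and ac: "\<And>k. k \<in> F \<Longrightarrow> a k \<le> c k * B"
  shows "(\<Sum>k\<in>F. a k) powr q \<le> (\<Sum>k\<in>F. c k) powr (q - 1) * (\<Sum>k\<in>F. c k powr (1 - q) * a k powr q)"
proof -
  define G where "G = {k \<in> F. 0 < a k}"
  have G: "finite G" "G \<subseteq> F" using F by (auto simp: G_def)
  have cpos: "0 < c k" if "k \<in> G" for k
    using that ac[of k] c[of k] by (auto simp: G_def less_le)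
  have eqG: "(\<Sum>k\<in>F. a k) = (\<Sum>k\<in>G. a k)"
    using F G a by (intro sum.mono_neutral_right) (auto simp: G_def less_le)
  show ?thesis
  proof (cases "G = {}")
    case True
    then show ?thesis using eqG by (auto intro!: mult_nonneg_nonneg sum_nonneg)
  next
    case False
    define s where "s = (\<Sum>k\<in>G. c k)"
    have s: "0 < s" unfolding s_def using G False cpos by (intro sum_pos) auto
    have "(\<Sum>k\<in>G. (c k / s) *\<^sub>R (a k / c k)) powr q \<le> (\<Sum>k\<in>G. (c k / s) * (a k / c k) powr q)"
    proof (rule convex_on_sum[OF G(1) False powr_convex[OF q]])
      show "(\<Sum>k\<in>G. c k / s) = 1" using s by (simp add: s_def flip: sum_divide_distrib)
    qed (use cpos s in \<open>auto simp: G_def less_imp_le\<close>)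
    also have "(\<Sum>k\<in>G. (c k / s) *\<^sub>R (a k / c k)) = (\<Sum>k\<in>G. a k) / s"
      unfolding sum_divide_distrib by (rule sum.cong) (use cpos in fastforce)+
    finally have 1: "((\<Sum>k\<in>G. a k) / s) powr q \<le> (\<Sum>k\<in>G. (c k / s) * (a k / c k) powr q)" .
    have "(\<Sum>k\<in>G. a k) powr q = s powr q * ((\<Sum>k\<in>G. a k) / s) powr q"
      using s G by (simp add: powr_divide sum_nonneg a subset_iff)
    also have "\<dots> \<le> s powr q * (\<Sum>k\<in>G. (c k / s) * (a k / c k) powr q)"
      using 1 by (intro mult_left_mono) auto
    also have "\<dots> = s powr (q - 1) * (\<Sum>k\<in>G. c k powr (1 - q) * a k powr q)"
      unfolding sum_distrib_left
    proof (rule sum.cong)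
      fix k assume k: "k \<in> G"
      then have "0 < a k" by (simp add: G_def)
      then show "s powr q * (c k / s * (a k / c k) powr q) = s powr (q - 1) * (c k powr (1 - q) * a k powr q)"
        using s cpos[OF k] by (simp add: powr_divide powr_diff)
    qed simp
    also have "\<dots> \<le> (\<Sum>k\<in>F. c k) powr (q - 1) * (\<Sum>k\<in>F. c k powr (1 - q) * a k powr q)"
      using G F q s c unfolding s_def
      by (intro mult_mono powr_mono2 sum_mono2 sum_nonneg) (auto simp: subset_iff)
    finally show ?thesis using eqG by simp
  qed
qed

lemma infsum_split_finite:
  fixes f :: "'k \<Rightarrow> real"
  assumes "finite F" "F \<subseteq> I" "f summable_on I"
  shows "infsum f I = infsum f (I - F) + sum f F"
proof -
  have "infsum f ((I - F) \<union> F) = infsum f (I - F) + infsum f F"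
    using assms by (intro infsum_Un_disjoint) (auto intro: summable_on_subset)
  then show ?thesis using assms by (simp add: Un_absorb2)
qed

text \<open>The triangle inequality for arbitrary families and all exponents at once. For finite exponents it
  suffices to bound sums over finitely many points and finitely many \<open>k\<close>; there Jensen's inequality with
  weights \<open>lp_norm p (f k)\<close> lets each \<open>f k\<close> contribute exactly its norm. For exponent 0, all but finitely
  many \<open>f k\<close> are uniformly small. Young's inequality for convolutions and the completeness of the spaces
  are instances.\<close>
lemma lp_minkowski:
  assumes p: "admissible p"
    and f: "\<And>k. k \<in> I \<Longrightarrow> in_lp p (f k)" and nn: "\<And>k m. k \<in> I \<Longrightarrow> 0 \<le> f k m"
    and s: "(\<lambda>k. lp_norm p (f k)) summable_on I"
    and g: "\<And>m. 0 \<le> g m" "\<And>m. g m \<le> (\<Sum>\<^sub>\<infinity>k\<in>I. f k m)"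
  shows "in_lp p g \<and> lp_norm p g \<le> (\<Sum>\<^sub>\<infinity>k\<in>I. lp_norm p (f k))"
proof -
  define C where "C = (\<Sum>\<^sub>\<infinity>k\<in>I. lp_norm p (f k))"
  have le: "f k m \<le> lp_norm p (f k)" if "k \<in> I" for k m
    using le_lp_norm[OF p f nn] that by blast
  have nn': "0 \<le> lp_norm p (f k)" if "k \<in> I" for k
    using lp_norm_nonneg[OF p f nn] that by blast
  have fs: "(\<lambda>k. f k m) summable_on I" for m
    by (rule summable_on_comparison_test[OF s]) (use le nn in auto)
  have C0: "0 \<le> C" unfolding C_def using nn' by (intro infsum_nonneg)
  have gC: "g m \<le> C" for m
    unfolding C_def using g(2)[of m] infsum_mono[OF fs[of m] s le] by simp
  consider "p = 0" | "p = \<infinity>" | "p \<noteq> 0" "p \<noteq> \<infinity>" by blast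
  then have "in_lp p g \<and> lp_norm p g \<le> C"
  proof cases
    case 1
    have "(g \<longlongrightarrow> 0) (filtercomap zabs at_top)"
    proof (rule tendstoI)
      fix e :: real assume e: "0 < e"
      obtain F where F: "finite F" "F \<subseteq> I"
        and FC: "dist (sum (\<lambda>k. lp_norm p (f k)) F) C \<le> e / 2"
        using infsum_finite_approximation[OF s, of "e / 2"] e unfolding C_def by auto
      have tail: "(\<Sum>\<^sub>\<infinity>k\<in>I - F. lp_norm p (f k)) \<le> e / 2"
      proof -
        have "C = (\<Sum>\<^sub>\<infinity>k\<in>I - F. lp_norm p (f k)) + sum (\<lambda>k. lp_norm p (f k)) F"
          unfolding C_def using F s
          by (intro infsum_split_finite)
        then show ?thesis using FC by (simp add: dist_norm)
      qed
      have "((\<lambda>m. \<Sum>k\<in>F. f k m) \<longlongrightarrow> 0) (filtercomap zabs at_top)"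
        using f F 1 by (intro tendsto_null_sum) (auto simp: in_lp_def)
      then have ev: "\<forall>\<^sub>F m in filtercomap zabs at_top. dist (\<Sum>k\<in>F. f k m) 0 < e / 2"
        by (rule tendstoD) (use e in simp)
      show "\<forall>\<^sub>F m in filtercomap zabs at_top. dist (g m) 0 < e"
        using ev
      proof eventually_elim
        case (elim m)
        have "(\<Sum>\<^sub>\<infinity>k\<in>I. f k m) = (\<Sum>\<^sub>\<infinity>k\<in>I - F. f k m) + (\<Sum>k\<in>F. f k m)"
          using F fs[of m]
          by (intro infsum_split_finite)
        moreover have "(\<Sum>\<^sub>\<infinity>k\<in>I - F. f k m) \<le> (\<Sum>\<^sub>\<infinity>k\<in>I - F. lp_norm p (f k))"
          using fs s le by (intro infsum_mono) (auto intro: summable_on_subset)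
        ultimately show ?case using elim tail g[of m] by (simp add: dist_norm)
      qed
    qed
    then show ?thesis using 1 gC lp_norm_sup_le by (auto simp: in_lp_def)
  next
    case 2
    have "bounded (range g)" using gC g(1) by (auto simp: bounded_iff intro!: exI[of _ C])
    then show ?thesis using 2 gC lp_norm_sup_le by (auto simp: in_lp_def)
  next
    case 3
    define q where "q = enn2real p"
    have q: "1 \<le> q" using finite_exponent p 3 by (simp add: q_def)
    have fsum: "(\<Sum>m\<in>M. f k m powr q) \<le> lp_norm p (f k) powr q" if "finite M" "k \<in> I" for k M
      using lp_norm_powr[of p "f k"] 3 p f[OF that(2)] that
      by (auto simp: q_def in_lp_def intro!: finite_sum_le_infsum)
    have fin: "(\<Sum>m\<in>M. (\<Sum>k\<in>F. f k m) powr q) \<le> C powr q"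
      if M: "finite M" and F: "finite F" "F \<subseteq> I" for M F
    proof -
      let ?c = "\<lambda>k. lp_norm p (f k)"
      have FI: "k \<in> I" if "k \<in> F" for k using F that by blast
      have sC: "sum ?c F \<le> C" unfolding C_def
        using s F nn' by (intro finite_sum_le_infsum) auto
      have s0: "0 \<le> sum ?c F" using nn' F by (intro sum_nonneg) auto
      have "(\<Sum>m\<in>M. (\<Sum>k\<in>F. f k m) powr q)
          \<le> (\<Sum>m\<in>M. sum ?c F powr (q - 1) * (\<Sum>k\<in>F. ?c k powr (1 - q) * f k m powr q))"
        using le[OF FI] nn[OF FI] nn'[OF FI] q F by (intro sum_mono powr_sum_le[where B = 1]) auto
      also have "\<dots> = sum ?c F powr (q - 1) * (\<Sum>k\<in>F. ?c k powr (1 - q) * (\<Sum>m\<in>M. f k m powr q))"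
        by (simp add: sum_distrib_left sum.swap[of _ F M])
      also have "\<dots> \<le> sum ?c F powr (q - 1) * (\<Sum>k\<in>F. ?c k powr (1 - q) * ?c k powr q)"
        using fsum[OF M FI] by (intro mult_left_mono sum_mono) auto
      also have "(\<Sum>k\<in>F. ?c k powr (1 - q) * ?c k powr q) = sum ?c F"
        using nn'[OF FI] by (intro sum.cong) (auto simp flip: powr_add)
      also have "sum ?c F powr (q - 1) * sum ?c F = sum ?c F powr q"
        using s0 q by (cases "sum ?c F = 0") (auto simp: powr_diff)
      also have "\<dots> \<le> C powr q" using sC s0 q by (intro powr_mono2) auto
      finally show ?thesis .
    qed
    have "(\<Sum>m\<in>M. g m powr q) \<le> C powr q" if M: "finite M" for M
    proof -
      have "((\<lambda>F. \<Sum>m\<in>M. (\<Sum>k\<in>F. f k m) powr q) \<longlongrightarrow> (\<Sum>m\<in>M. (\<Sum>\<^sub>\<infinity>k\<in>I. f k m) powr q))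
          (finite_subsets_at_top I)"
        using fs q nn by (intro tendsto_intros tendsto_powr' infsum_tendsto)
          (auto intro!: eventually_finite_subsets_at_top_weakI sum_nonneg)
      then have "(\<Sum>m\<in>M. (\<Sum>\<^sub>\<infinity>k\<in>I. f k m) powr q) \<le> C powr q"
        by (rule tendsto_upperbound)
          (auto intro!: eventually_finite_subsets_at_top_weakI fin M)
      moreover have "(\<Sum>m\<in>M. g m powr q) \<le> (\<Sum>m\<in>M. (\<Sum>\<^sub>\<infinity>k\<in>I. f k m) powr q)"
        using g q by (intro sum_mono powr_mono2) auto
      ultimately show ?thesis by simp
    qed
    then show ?thesis using lp_normI[of p C g] 3 p C0 by (simp add: q_def)
  qed
  then show ?thesis by (simp add: C_def)
qed

declare infinity_ennreal_def [simp del]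

lemma ennreal_infinity_neq_0 [simp]: "(\<infinity> :: ennreal) \<noteq> 0" "0 \<noteq> (\<infinity> :: ennreal)"
  by (simp_all add: infinity_ennreal_def)

lemma lp_mono:
  assumes "admissible p" "in_lp p f" "\<And>m. 0 \<le> g m" "\<And>m. g m \<le> f m"
  shows "in_lp p g" "lp_norm p g \<le> lp_norm p f"
  using lp_minkowski[of p "{()}" "\<lambda>_. f" g] assms by (auto intro: order_trans)

lemma lp_sum:
  assumes "admissible p" "finite I" "\<And>k. k \<in> I \<Longrightarrow> in_lp p (f k)" "\<And>k m. k \<in> I \<Longrightarrow> 0 \<le> f k m"
    "\<And>m. 0 \<le> g m" "\<And>m. g m \<le> (\<Sum>k\<in>I. f k m)"
  shows "in_lp p g" "lp_norm p g \<le> (\<Sum>k\<in>I. lp_norm p (f k))"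
  using lp_minkowski[of p I f g] assms by (auto intro: order_trans)

lemma lp_add:
  assumes "admissible p" "in_lp p f" "in_lp p h" "\<And>m. 0 \<le> f m" "\<And>m. 0 \<le> h m"
    "\<And>m. 0 \<le> g m" "\<And>m. g m \<le> f m + h m"
  shows "in_lp p g" "lp_norm p g \<le> lp_norm p f + lp_norm p h"
proof -
  have "in_lp p g \<and> lp_norm p g \<le> (\<Sum>b\<in>UNIV. lp_norm p (if b then f else h))"
    using lp_sum[of p UNIV "\<lambda>b. if b then f else h" g] assms by (simp add: UNIV_bool add.commute)
  then show "in_lp p g" "lp_norm p g \<le> lp_norm p f + lp_norm p h"
    by (auto simp: UNIV_bool)
qed

text \<open>The reverse inequality in \<open>lp_scale\<close> comes from the same bound for the inverse factor, and in
  \<open>lp_shift\<close> from the opposite translation.\<close>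
lemma lp_scale_le:
  assumes p: "admissible p" and f: "in_lp p f" and nn: "\<And>m. 0 \<le> f m" and a: "0 \<le> a"
  shows "in_lp p (\<lambda>m. a * f m) \<and> lp_norm p (\<lambda>m. a * f m) \<le> a * lp_norm p f"
proof (cases "p = 0 \<or> p = \<infinity>")
  case True
  have "in_lp p (\<lambda>m. a * f m)"
  proof (cases "p = 0")
    case True
    then show ?thesis using f by (simp add: in_lp_def tendsto_mult_right_zero)
  next
    case False
    then have "bounded ((\<lambda>y. a *\<^sub>R y) ` range f)"
      using f \<open>p = 0 \<or> p = \<infinity>\<close> by (intro bounded_scaling) (simp add: in_lp_def)
    then show ?thesis using False \<open>p = 0 \<or> p = \<infinity>\<close> by (simp add: in_lp_def image_image)
  qed
  moreover have "lp_norm p (\<lambda>m. a * f m) \<le> a * lp_norm p f"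
    using True le_lp_norm[OF p f nn] a by (intro lp_norm_sup_le mult_left_mono) auto
  ultimately show ?thesis by blast
next
  case False
  show ?thesis
  proof (rule lp_normI)
    fix M :: "(int ^ 'a) set" assume M: "finite M"
    have "(\<Sum>m\<in>M. f m powr enn2real p) \<le> lp_norm p f powr enn2real p"
      using lp_norm_powr[of p f] False p f M
      by (auto simp: in_lp_def intro!: finite_sum_le_infsum)
    then show "(\<Sum>m\<in>M. (a * f m) powr enn2real p) \<le> (a * lp_norm p f) powr enn2real p"
      using a nn lp_norm_nonneg[OF p f nn]
      by (simp add: powr_mult mult_left_mono flip: sum_distrib_left)
  qed (use False p a lp_norm_nonneg[OF p f nn] in auto)
qed

lemma lp_scale:
  assumes p: "admissible p" and f: "in_lp p f" and nn: "\<And>m. 0 \<le> f m" and a: "0 \<le> a"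
  shows "in_lp p (\<lambda>m. a * f m)" "lp_norm p (\<lambda>m. a * f m) = a * lp_norm p f"
proof -
  show 1: "in_lp p (\<lambda>m. a * f m)" using lp_scale_le[OF assms] by blast
  show "lp_norm p (\<lambda>m. a * f m) = a * lp_norm p f"
  proof (cases "a = 0")
    case True
    then have "lp_norm p (\<lambda>m. a * f m) \<le> 0" using lp_scale_le[OF assms] by simp
    moreover have "0 \<le> lp_norm p (\<lambda>m. a * f m)"
      using lp_norm_nonneg[OF p 1] nn a by simp
    ultimately show ?thesis using True by simp
  next
    case False
    then have "lp_norm p (\<lambda>m. inverse a * (a * f m)) \<le> inverse a * lp_norm p (\<lambda>m. a * f m)"
      using lp_scale_le[OF p 1, of "inverse a"] nn a by simp
    then have "a * lp_norm p f \<le> lp_norm p (\<lambda>m. a * f m)"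
      using False a by (simp add: field_simps)
    then show ?thesis using lp_scale_le[OF assms] by simp
  qed
qed

lemma lp_shift_le:
  fixes f :: "int ^ 'n \<Rightarrow> real"
  assumes p: "admissible p" and f: "in_lp p f" and nn: "\<And>m. 0 \<le> f m"
  shows "in_lp p (\<lambda>m. f (m + k)) \<and> lp_norm p (\<lambda>m. f (m + k)) \<le> lp_norm p f"
proof -
  consider "p = 0" | "p = \<infinity>" | "p \<noteq> 0" "p \<noteq> \<infinity>" by blast
  then show ?thesis
  proof cases
    case 1
    have "((\<lambda>m. f (m + k)) \<longlongrightarrow> 0) (filtercomap zabs at_top)"
    proof (rule tendstoI)
      fix e :: real assume "0 < e"
      then have "\<forall>\<^sub>F m in filtercomap zabs at_top. dist (f m) 0 < e"
        using f 1 tendstoD by (fastforce simp: in_lp_def)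
      then obtain r where r: "\<And>m. r \<le> zabs m \<Longrightarrow> dist (f m) 0 < e"
        by (auto simp: eventually_zabs_iff)
      have "r \<le> zabs (m + k)" if "r + zabs k \<le> zabs m" for m
        using that zabs_triangle[of "m + k" "- k"] by simp
      then show "\<forall>\<^sub>F m in filtercomap zabs at_top. dist (f (m + k)) 0 < e"
        unfolding eventually_zabs_iff using r by blast
    qed
    moreover have "lp_norm p (\<lambda>m. f (m + k)) \<le> lp_norm p f"
      using 1 le_lp_norm[OF p f nn] by (intro lp_norm_sup_le) auto
    ultimately show ?thesis using 1 by (simp add: in_lp_def)
  next
    case 2
    moreover have "lp_norm p (\<lambda>m. f (m + k)) \<le> lp_norm p f"
      using 2 le_lp_norm[OF p f nn] by (intro lp_norm_sup_le) auto
    moreover have "bounded (range (\<lambda>m. f (m + k)))"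
      by (rule bounded_subset[of "range f"]) (use f 2 in \<open>auto simp: in_lp_def\<close>)
    ultimately show ?thesis by (simp add: in_lp_def)
  next
    case 3
    show ?thesis
    proof (rule lp_normI)
      fix M :: "(int ^ 'n) set" assume M: "finite M"
      have "(\<Sum>m\<in>M. f (m + k) powr enn2real p) = (\<Sum>m\<in>(\<lambda>m. m + k) ` M. f m powr enn2real p)"
        by (subst sum.reindex) auto
      also have "\<dots> \<le> lp_norm p f powr enn2real p"
        using lp_norm_powr[of p f] 3 p f M
        by (auto simp: in_lp_def intro!: finite_sum_le_infsum)
      finally show "(\<Sum>m\<in>M. f (m + k) powr enn2real p) \<le> lp_norm p f powr enn2real p" .
    qed (use 3 p lp_norm_nonneg[OF p f nn] in auto)
  qed
qed

lemma lp_shift: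
  assumes p: "admissible p" and f: "in_lp p f" and nn: "\<And>m. 0 \<le> f m"
  shows "in_lp p (\<lambda>m. f (m + k))" "lp_norm p (\<lambda>m. f (m + k)) = lp_norm p f"
  using lp_shift_le[OF assms, of k] lp_shift_le[of p "\<lambda>m. f (m + k)" "- k"] p nn by auto

lemma lp_single:
  fixes m :: "int ^ 'n"
  assumes p: "admissible p" and a: "0 \<le> a"
  shows "in_lp p (\<lambda>i. if i = m then a else 0)" "lp_norm p (\<lambda>i. if i = m then a else 0) = a"
proof -
  let ?f = "\<lambda>i. if i = m then a else 0"
  consider "p = 0" | "p = \<infinity>" | "p \<noteq> 0" "p \<noteq> \<infinity>" by blast
  then have "in_lp p ?f \<and> lp_norm p ?f \<le> a"
  proof cases
    case 1
    have "\<forall>i. zabs m + 1 \<le> zabs i \<longrightarrow> ?f i = 0" by auto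
    then have "\<forall>\<^sub>F i in filtercomap zabs at_top. ?f i = 0"
      unfolding eventually_zabs_iff by blast
    then have "(?f \<longlongrightarrow> 0) (filtercomap zabs at_top)" by (rule tendsto_eventually)
    then show ?thesis using 1 a lp_norm_sup_le[of p ?f a] by (auto simp: in_lp_def)
  next
    case 2
    then show ?thesis using a lp_norm_sup_le[of p ?f a]
      by (auto simp: in_lp_def bounded_iff)
  next
    case 3
    show ?thesis
    proof (rule lp_normI)
      fix M :: "(int ^ 'n) set" assume M: "finite M"
      have "(\<Sum>i\<in>M. ?f i powr enn2real p) = (\<Sum>i\<in>M. if i = m then a powr enn2real p else 0)"
        by (intro sum.cong) auto
      also have "\<dots> \<le> a powr enn2real p" using M by (simp add: sum.delta)
      finally show "(\<Sum>i\<in>M. ?f i powr enn2real p) \<le> a powr enn2real p" .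
    qed (use 3 p a in auto)
  qed
  then show "in_lp p ?f" "lp_norm p ?f = a"
    using le_lp_norm[of p ?f m] p a by auto
qed

lemma lp_finite_support:
  assumes p: "admissible p" and M: "finite M" and nn: "\<And>m. 0 \<le> f m"
    and supp: "\<And>m. m \<notin> M \<Longrightarrow> f m = 0"
  shows "in_lp p f" "lp_norm p f \<le> sum f M"
proof -
  have *: "f m \<le> (\<Sum>k\<in>M. if m = k then f k else 0)" for m
    using M supp nn by (simp add: sum.delta')
  have 1: "lp_norm p f \<le> (\<Sum>k\<in>M. lp_norm p (\<lambda>i. if i = k then f k else 0))"
    and 2: "in_lp p f"
    using lp_sum[OF p M lp_single(1)[OF p nn] _ nn *] nn by auto
  have "(\<Sum>k\<in>M. lp_norm p (\<lambda>i. if i = k then f k else 0)) = sum f M"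
    by (intro sum.cong lp_single(2)[OF p nn] refl)
  then show "in_lp p f" "lp_norm p f \<le> sum f M" using 1 2 by simp_all
qed

text \<open>Dominated convergence: off a suitable finite set the terms are small uniformly in \<open>n\<close>.\<close>
lemma infsum_dominated_null:
  fixes s :: "'k \<Rightarrow> real" and f :: "nat \<Rightarrow> 'k \<Rightarrow> real"
  assumes s: "s summable_on UNIV" "\<And>k. 0 \<le> s k"
    and f: "\<And>n k. 0 \<le> f n k" "\<And>n k. f n k \<le> C" and lim: "\<And>k. (\<lambda>n. f n k) \<longlonglongrightarrow> 0"
  shows "(\<lambda>n. \<Sum>\<^sub>\<infinity>k. s k * f n k) \<longlonglongrightarrow> 0"
proof (rule tendstoI)
  fix e :: real assume e: "0 < e"
  have C: "0 \<le> C" using f(1)[of 0 undefined] f(2)[of 0 undefined] by linarith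
  define d where "d = e / (2 * (C + 1))"
  have d: "0 < d" "d * C < e / 2" using e C by (auto simp: d_def field_simps)
  obtain F where F: "finite F" and Fd: "dist (sum s F) (infsum s UNIV) \<le> d"
    using infsum_finite_approximation[OF s(1) d(1)] by auto
  have tail: "infsum s (UNIV - F) \<le> d"
    using infsum_split_finite[OF F _ s(1)] Fd by (simp add: dist_norm)
  have sf: "(\<lambda>k. s k * f n k) summable_on A" for n A
  proof (rule summable_on_comparison_test[of "\<lambda>k. s k * C"])
    show "(\<lambda>k. s k * C) summable_on A"
      using s(1) by (intro summable_on_cmult_left) (auto intro: summable_on_subset)
  qed (use f s in \<open>auto intro!: mult_left_mono\<close>)
  have "(\<lambda>n. \<Sum>k\<in>F. s k * f n k) \<longlonglongrightarrow> 0"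
    using lim by (intro tendsto_null_sum tendsto_mult_right_zero)
  then have "\<forall>\<^sub>F n in sequentially. dist (\<Sum>k\<in>F. s k * f n k) 0 < e / 2"
    by (rule tendstoD) (use e in simp)
  then show "\<forall>\<^sub>F n in sequentially. dist (\<Sum>\<^sub>\<infinity>k. s k * f n k) 0 < e"
  proof eventually_elim
    case (elim n)
    have "(\<Sum>\<^sub>\<infinity>k\<in>UNIV - F. s k * f n k) \<le> (\<Sum>\<^sub>\<infinity>k\<in>UNIV - F. s k * C)"
      using s f by (intro infsum_mono sf mult_left_mono summable_on_cmult_left)
        (auto intro: summable_on_subset)
    also have "\<dots> = infsum s (UNIV - F) * C"
      by (simp add: infsum_cmult_left')
    also have "\<dots> \<le> d * C" using tail C by (intro mult_right_mono)
    finally have "(\<Sum>\<^sub>\<infinity>k\<in>UNIV - F. s k * f n k) < e / 2" using d by simp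
    moreover have "(\<Sum>\<^sub>\<infinity>k. s k * f n k) = (\<Sum>\<^sub>\<infinity>k\<in>UNIV - F. s k * f n k) + (\<Sum>k\<in>F. s k * f n k)"
      using infsum_split_finite[OF F _ sf] by simp
    moreover have "0 \<le> (\<Sum>\<^sub>\<infinity>k. s k * f n k)" using s f by (intro infsum_nonneg) auto
    ultimately show ?case using elim by (simp add: dist_norm)
  qed
qed

section \<open>Vector sequences\<close>

interpretation sc: vector_space "scaleC :: complex \<Rightarrow> 'u \<Rightarrow> 'u::complex_normed_vector"
  by (rule vector_space_scaleC)

lemma bounded_bilinear_scaleC:
  "bounded_bilinear (scaleC :: complex \<Rightarrow> 'u \<Rightarrow> 'u::complex_normed_vector)"
  by (rule bounded_bilinear.intro)
    (auto simp: scaleC_add_left scaleC_add_right scaleR_scaleC scaleC_scaleC norm_scaleC mult.commute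
      scaleC_complex_def intro!: exI[of _ 1])

interpretation cs: vector_space "cscale :: complex \<Rightarrow> ('i \<Rightarrow> 'u) \<Rightarrow> 'i \<Rightarrow> 'u::complex_normed_vector"
  by (rule vector_space_cscale)

lemma norm_le_Ynorm:
  "admissible p \<Longrightarrow> x \<in> Yspace p \<Longrightarrow> norm (x m) \<le> Ynorm p x"
  using le_lp_norm[of p "\<lambda>m. norm (x m)"] by (simp add: Yspace_iff Ynorm_eq)

lemma Ynorm_nonneg: "admissible p \<Longrightarrow> x \<in> Yspace p \<Longrightarrow> 0 \<le> Ynorm p x"
  using lp_norm_nonneg[of p "\<lambda>m. norm (x m)"] by (simp add: Yspace_iff Ynorm_eq)

lemma Yspace_solid:
  assumes "admissible p" "x \<in> Yspace p" "\<And>m. norm (y m) \<le> norm (x m)"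
  shows "y \<in> Yspace p" "Ynorm p y \<le> Ynorm p x"
  using lp_mono[of p "\<lambda>m. norm (x m)" "\<lambda>m. norm (y m)"] assms by (auto simp: Yspace_iff Ynorm_eq)

lemma Yspace_add:
  assumes "admissible p" "x \<in> Yspace p" "y \<in> Yspace p"
  shows "x + y \<in> Yspace p" "Ynorm p (x + y) \<le> Ynorm p x + Ynorm p y"
  using lp_add[of p "\<lambda>m. norm (x m)" "\<lambda>m. norm (y m)" "\<lambda>m. norm ((x + y) m)"] assms
  by (auto simp: Yspace_iff Ynorm_eq norm_triangle_ineq)

lemma Yspace_cscale:
  assumes "admissible p" "x \<in> Yspace p"
  shows "cscale a x \<in> Yspace p" "Ynorm p (cscale a x) = cmod a * Ynorm p x"
  using lp_scale[of p "\<lambda>m. norm (x m)" "cmod a"] assms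
  by (auto simp: Yspace_iff Ynorm_eq cscale_def norm_scaleC)

lemma Ynorm_uminus: "Ynorm p (- x) = Ynorm p x" by (simp add: Ynorm_eq)

lemma Yspace_uminus: "x \<in> Yspace p \<Longrightarrow> - x \<in> Yspace p" by (simp add: Yspace_iff)

lemma Yspace_diff:
  assumes "admissible p" "x \<in> Yspace p" "y \<in> Yspace p"
  shows "x - y \<in> Yspace p" "Ynorm p (x - y) \<le> Ynorm p x + Ynorm p y"
  using Yspace_add[of p x "- y"] assms by (auto simp: Ynorm_uminus Yspace_uminus)

lemma Ynorm_minus_commute: "Ynorm p (x - y) = Ynorm p (y - x)"
  using Ynorm_uminus[of p "x - y"] by simp

lemma Yspace_finite_support:
  assumes "admissible p" "finite M" "\<And>m. m \<notin> M \<Longrightarrow> x m = 0"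
  shows "x \<in> Yspace p" "Ynorm p x \<le> (\<Sum>m\<in>M. norm (x m))"
  using lp_finite_support[of p M "\<lambda>m. norm (x m)"] assms by (auto simp: Yspace_iff Ynorm_eq)

lemma Yspace_0: "admissible p \<Longrightarrow> 0 \<in> Yspace p"
  using Yspace_finite_support[of p "{}" 0] by simp

lemma Ynorm_0:
  assumes p: "admissible p" shows "Ynorm p 0 = 0"
proof (rule antisym)
  show "Ynorm p 0 \<le> 0" using Yspace_finite_support(2)[OF p, of "{}" 0] by simp
qed (rule Ynorm_nonneg[OF p Yspace_0[OF p]])

lemma Ynorm_eq_0:
  assumes "admissible p" "x \<in> Yspace p" "Ynorm p x \<le> 0"
  shows "x = 0"
proof
  fix m
  have "norm (x m) \<le> 0" using norm_le_Ynorm[OF assms(1,2), of m] assms(3) by linarith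
  then show "x m = 0 m" by simp
qed

lemma Yspace_sum:
  assumes p: "admissible p" and F: "finite F" and x: "\<And>k. k \<in> F \<Longrightarrow> x k \<in> Yspace p"
  shows "(\<Sum>k\<in>F. x k) \<in> Yspace p \<and> Ynorm p (\<Sum>k\<in>F. x k) \<le> (\<Sum>k\<in>F. Ynorm p (x k))"
  using F x
proof (induction rule: finite_induct)
  case empty
  show ?case
    unfolding sum.empty by (intro conjI Yspace_0[OF p] eq_refl[OF Ynorm_0[OF p]])
next
  case (insert k F)
  then have *: "sum x F \<in> Yspace p" "Ynorm p (sum x F) \<le> (\<Sum>k\<in>F. Ynorm p (x k))" "x k \<in> Yspace p"
    by auto
  show ?case
    unfolding sum.insert[OF insert(1,2)]
    by (intro conjI Yspace_add(1)[OF p *(3,1)]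
        order_trans[OF Yspace_add(2)[OF p *(3,1)] add_left_mono[OF *(2)]])
qed

lemma admissible_infinity [simp]: "admissible \<infinity>"
  by (simp add: admissible_def infinity_ennreal_def)

lemma Yspace_subset_infinity:
  assumes "admissible p" "x \<in> Yspace p"
  shows "x \<in> Yspace \<infinity>"
  using in_lp_imp_bounded[of p "\<lambda>m. norm (x m)"] assms by (simp add: Yspace_iff in_lp_def)

lemma Yspace_infinityI:
  assumes "\<And>m. norm (x m) \<le> C"
  shows "x \<in> Yspace \<infinity>" "Ynorm \<infinity> x \<le> C"
  using assms lp_norm_sup_le[of \<infinity> "\<lambda>m. norm (x m)" C]
  by (auto simp: Yspace_def Ynorm_eq bounded_iff)

definition shift :: "int ^ 'n \<Rightarrow> (int ^ 'n \<Rightarrow> 'a) \<Rightarrow> int ^ 'n \<Rightarrow> 'a"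
  where "shift k x = (\<lambda>m. x (m + k))"

lemma Yspace_shift:
  assumes "admissible p" "x \<in> Yspace p"
  shows "shift k x \<in> Yspace p" "Ynorm p (shift k x) = Ynorm p x"
  using lp_shift[of p "\<lambda>m. norm (x m)" k] assms by (auto simp: Yspace_iff Ynorm_eq shift_def)

section \<open>Operators\<close>

abbreviation wiener_op ::
    "(int ^ 'n \<Rightarrow> 'u::complex_normed_vector \<Rightarrow>\<^sub>L 'u) \<Rightarrow> (int ^ 'n \<Rightarrow> 'u \<Rightarrow>\<^sub>L 'u) \<Rightarrow>
      (int ^ 'n \<Rightarrow> 'u) \<Rightarrow> int ^ 'n \<Rightarrow> 'u"
  where "wiener_op l c x \<equiv> laurent_op l x + mult_op c x"

definition wnorm :: "(int ^ 'n \<Rightarrow> 'u::complex_normed_vector \<Rightarrow>\<^sub>L 'u) \<Rightarrow> real"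
  where "wnorm l = (\<Sum>\<^sub>\<infinity>k. norm (l k))"

lemma norm_summable_weight:
  fixes l :: "int ^ 'n \<Rightarrow> 'u::complex_normed_vector \<Rightarrow>\<^sub>L 'u"
  assumes l: "wiener_symbol l" and f: "\<And>k. 0 \<le> f k" "\<And>k. f k \<le> C"
  shows "(\<lambda>k. norm (l k) * f k) summable_on UNIV"
proof (rule summable_on_comparison_test[of "\<lambda>k. norm (l k) * C"])
  show "(\<lambda>k. norm (l k) * C) summable_on UNIV"
    using l by (intro summable_on_cmult_left) (auto simp: wiener_symbol_def)
qed (use f in \<open>auto intro!: mult_left_mono\<close>)

text \<open>Summation along the diagonals of the matrix displays the operator as a sum of translates of \<open>x\<close>
  with coefficients \<open>l k\<close>.\<close>
lemma laurent_op_reindex: "laurent_op l x i = (\<Sum>\<^sub>\<infinity>k. blinfun_apply (l k) (x (i - k)))"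
  unfolding laurent_op_def
  by (rule infsum_reindex_bij_witness[of _ "\<lambda>k. i - k" "\<lambda>j. i - j"]) auto

context
  fixes l :: "int ^ 'n \<Rightarrow> 'u::{complex_normed_vector, banach} \<Rightarrow>\<^sub>L 'u"
  assumes l: "wiener_symbol l"
begin

lemma wnorm_nonneg: "0 \<le> wnorm l" unfolding wnorm_def by (intro infsum_nonneg) auto

lemma laurent_abs_summable:
  assumes x: "x \<in> Yspace \<infinity>"
  shows "(\<lambda>k. norm (blinfun_apply (l k) (x (i - k)))) summable_on UNIV"
proof (rule summable_on_comparison_test)
  show "(\<lambda>k. norm (l k) * norm (x (i - k))) summable_on UNIV"
    using norm_le_Ynorm[OF _ x] by (intro norm_summable_weight[OF l, of _ "Ynorm \<infinity> x"]) auto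
qed (use norm_blinfun in auto)

lemma laurent_summable:
  assumes x: "x \<in> Yspace \<infinity>"
  shows "(\<lambda>k. blinfun_apply (l k) (x (i - k))) summable_on UNIV"
  using laurent_abs_summable[OF assms] by (rule abs_summable_summable)

lemma norm_laurent_le:
  assumes x: "x \<in> Yspace \<infinity>"
  shows "norm (laurent_op l x i) \<le> (\<Sum>\<^sub>\<infinity>k. norm (l k) * norm (x (i - k)))"
proof -
  have "norm (laurent_op l x i) \<le> (\<Sum>\<^sub>\<infinity>k. norm (blinfun_apply (l k) (x (i - k))))"
    unfolding laurent_op_reindex using laurent_abs_summable[OF x] by (rule norm_infsum_bound)
  also have "\<dots> \<le> (\<Sum>\<^sub>\<infinity>k. norm (l k) * norm (x (i - k)))"
    using norm_le_Ynorm[OF _ x]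
    by (intro infsum_mono laurent_abs_summable[OF x] norm_summable_weight[OF l, of _ "Ynorm \<infinity> x"]
        norm_blinfun) auto
  finally show ?thesis .
qed

lemma laurent_Yspace:
  assumes p: "admissible p" and x: "x \<in> Yspace p"
  shows "laurent_op l x \<in> Yspace p" "Ynorm p (laurent_op l x) \<le> wnorm l * Ynorm p x"
proof -
  let ?f = "\<lambda>k m. norm (l k) * norm (x (m - k))"
  have f: "in_lp p (?f k)" "lp_norm p (?f k) = norm (l k) * Ynorm p x" for k
    using lp_scale[of p "\<lambda>m. norm (x (m - k))" "norm (l k)"]
      lp_shift[of p "\<lambda>m. norm (x m)" "- k"] p x
    by (auto simp: Yspace_iff Ynorm_eq)
  have s: "(\<lambda>k. norm (l k) * Ynorm p x) summable_on UNIV"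
    using Ynorm_nonneg[OF p x] by (intro norm_summable_weight[OF l]) auto
  have "in_lp p (\<lambda>m. norm (laurent_op l x m)) \<and>
      lp_norm p (\<lambda>m. norm (laurent_op l x m)) \<le> (\<Sum>\<^sub>\<infinity>k. lp_norm p (?f k))"
    using norm_laurent_le[OF Yspace_subset_infinity[OF p x]] s
    by (intro lp_minkowski[OF p]) (auto simp: f)
  moreover have "(\<Sum>\<^sub>\<infinity>k. lp_norm p (?f k)) = wnorm l * Ynorm p x"
    by (simp add: f wnorm_def infsum_cmult_left')
  ultimately show "laurent_op l x \<in> Yspace p" "Ynorm p (laurent_op l x) \<le> wnorm l * Ynorm p x"
    by (auto simp: Yspace_iff Ynorm_eq)
qed

lemma laurent_add:
  assumes "x \<in> Yspace \<infinity>" "y \<in> Yspace \<infinity>"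
  shows "laurent_op l (x + y) = laurent_op l x + laurent_op l y"
  unfolding laurent_op_reindex fun_eq_iff plus_fun_apply
  using laurent_summable assms by (simp add: blinfun.add_right infsum_add)

lemma laurent_cscale:
  assumes x: "x \<in> Yspace \<infinity>"
  shows "laurent_op l (cscale a x) = cscale a (laurent_op l x)"
proof
  fix i
  have bl: "bounded_linear (\<lambda>v :: 'u. a *\<^sub>C v)"
    by (rule bounded_bilinear.bounded_linear_right[OF bounded_bilinear_scaleC])
  have "\<forall>k. l k \<in> LU" using l by (auto simp: wiener_symbol_def)
  then have "laurent_op l (cscale a x) i = (\<Sum>\<^sub>\<infinity>k. a *\<^sub>C blinfun_apply (l k) (x (i - k)))"
    unfolding laurent_op_reindex by (simp add: LU_def cscale_def)
  also have "\<dots> = a *\<^sub>C laurent_op l x i"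
    unfolding laurent_op_reindex
    using infsumI[OF has_sum_bounded_linear[OF bl has_sum_infsum[OF laurent_summable[OF x, of i]]]]
    by simp
  finally show "laurent_op l (cscale a x) i = cscale a (laurent_op l x) i"
    by (simp add: cscale_def)
qed

end

lemma linf_LU_bound:
  assumes "c \<in> linf_LU" obtains K where "0 \<le> K" "\<And>m. norm (c m) \<le> K"
proof -
  obtain K where "\<And>m. norm (c m) \<le> K" using assms by (auto simp: linf_LU_def bounded_iff)
  then show ?thesis using that[of K] norm_ge_zero order_trans by blast
qed

lemma mult_Yspace:
  assumes p: "admissible p" and x: "x \<in> Yspace p" and c: "\<And>m. norm (c m) \<le> K"
  shows "mult_op c x \<in> Yspace p" "Ynorm p (mult_op c x) \<le> K * Ynorm p x"
proof -
  have K: "0 \<le> K" using c[of 0] norm_ge_zero order_trans by blast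
  have le: "norm (mult_op c x m) \<le> K * norm (x m)" for m
    unfolding mult_op_def using norm_blinfun[of "c m" "x m"] c[of m]
    by (meson mult_right_mono norm_ge_zero order_trans)
  show "mult_op c x \<in> Yspace p" "Ynorm p (mult_op c x) \<le> K * Ynorm p x"
    using lp_scale[of p "\<lambda>m. norm (x m)" K]
      lp_mono[of p "\<lambda>m. K * norm (x m)" "\<lambda>m. norm (mult_op c x m)"] p x K le
    by (auto simp: Yspace_iff Ynorm_eq)
qed

lemma mult_op_add: "mult_op c (x + y) = mult_op c x + mult_op c y"
  by (auto simp: mult_op_def fun_eq_iff blinfun.add_right)

lemma mult_op_cscale:
  assumes "c \<in> linf_LU" shows "mult_op c (cscale a x) = cscale a (mult_op c x)"
proof -
  have "c m \<in> LU" for m using assms by (auto simp: linf_LU_def)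
  then show ?thesis by (auto simp: mult_op_def cscale_def LU_def)
qed

text \<open>A translation of the argument amounts to a translation of the coefficient. This makes an almost
  period of the coefficient an approximate symmetry of the operator.\<close>
lemma wiener_op_shift: "wiener_op l (shift k c) (shift k x) = shift k (wiener_op l c x)"
  by (simp add: fun_eq_iff laurent_op_reindex shift_def mult_op_def algebra_simps)

context
  fixes l :: "int ^ 'n \<Rightarrow> 'u::{complex_normed_vector, banach} \<Rightarrow>\<^sub>L 'u"
    and c :: "int ^ 'n \<Rightarrow> 'u \<Rightarrow>\<^sub>L 'u"
  assumes l: "wiener_symbol l" and c: "c \<in> linf_LU"
begin

lemma wiener_op_bounded:
  assumes p: "admissible p"
  obtains K where "0 \<le> K" "\<And>x. x \<in> Yspace p \<Longrightarrow> wiener_op l c x \<in> Yspace p"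
    "\<And>x. x \<in> Yspace p \<Longrightarrow> Ynorm p (wiener_op l c x) \<le> K * Ynorm p x"
proof -
  obtain K where K: "0 \<le> K" "\<And>m. norm (c m) \<le> K" using linf_LU_bound[OF c] by blast
  have "wiener_op l c x \<in> Yspace p \<and> Ynorm p (wiener_op l c x) \<le> (wnorm l + K) * Ynorm p x"
    if x: "x \<in> Yspace p" for x
    using Yspace_add[OF p laurent_Yspace(1)[OF l p x] mult_Yspace(1)[of p x c K, OF p x K(2)]]
      laurent_Yspace(2)[OF l p x] mult_Yspace(2)[of p x c K, OF p x K(2)]
    by (simp add: algebra_simps)
  then show ?thesis using that[of "wnorm l + K"] K wnorm_nonneg[OF l] by simp
qed

lemma wiener_op_Yspace: "admissible p \<Longrightarrow> x \<in> Yspace p \<Longrightarrow> wiener_op l c x \<in> Yspace p"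
  using wiener_op_bounded by metis

lemma wiener_op_add:
  assumes "x \<in> Yspace \<infinity>" "y \<in> Yspace \<infinity>"
  shows "wiener_op l c (x + y) = wiener_op l c x + wiener_op l c y"
  using assms by (simp add: laurent_add[OF l] mult_op_add)

lemma wiener_op_cscale:
  assumes "x \<in> Yspace \<infinity>"
  shows "wiener_op l c (cscale a x) = cscale a (wiener_op l c x)"
  using assms by (simp add: laurent_cscale[OF l] mult_op_cscale[OF c] cs.scale_right_distrib)

lemma wiener_op_0: "wiener_op l c 0 = 0"
proof -
  have "wiener_op l c (0 + 0) = wiener_op l c 0 + wiener_op l c 0"
    by (intro wiener_op_add Yspace_0) auto
  then show ?thesis by (simp only: add_0 add_cancel_right_right)
qed

lemma wiener_op_diff:
  assumes "x \<in> Yspace \<infinity>" "y \<in> Yspace \<infinity>"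
  shows "wiener_op l c (x - y) = wiener_op l c x - wiener_op l c y"
proof -
  have "wiener_op l c (x - y + y) = wiener_op l c (x - y) + wiener_op l c y"
    using assms by (intro wiener_op_add Yspace_diff) auto
  then show ?thesis by (metis add_diff_cancel_right' diff_add_cancel)
qed

lemma wiener_op_sum:
  assumes "finite F" "\<And>k. k \<in> F \<Longrightarrow> x k \<in> Yspace \<infinity>"
  shows "wiener_op l c (\<Sum>k\<in>F. x k) = (\<Sum>k\<in>F. wiener_op l c (x k))"
  using assms
proof (induction rule: finite_induct)
  case empty
  show ?case unfolding sum.empty by (rule wiener_op_0)
next
  case (insert k F)
  have "wiener_op l c (x k + sum x F) = wiener_op l c (x k) + wiener_op l c (sum x F)"
    using insert Yspace_sum[of \<infinity> F x] by (intro wiener_op_add) auto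
  also have "wiener_op l c (sum x F) = (\<Sum>k\<in>F. wiener_op l c (x k))"
    using insert by blast
  finally show ?case unfolding sum.insert[OF insert(1,2)] .
qed

lemma bounded_op_on_wiener_op:
  assumes p: "admissible p" shows "bounded_op_on p (wiener_op l c)"
proof -
  obtain K where K: "\<And>x. x \<in> Yspace p \<Longrightarrow> wiener_op l c x \<in> Yspace p"
    "\<And>x. x \<in> Yspace p \<Longrightarrow> Ynorm p (wiener_op l c x) \<le> K * Ynorm p x"
    using wiener_op_bounded[OF p] by metis
  then show ?thesis
    unfolding bounded_op_on_def
    by (auto simp: wiener_op_add wiener_op_cscale Yspace_subset_infinity[OF p])
qed

lemma wiener_op_perturb:
  assumes p: "admissible p" and x: "x \<in> Yspace p" and d: "\<And>m. norm (c m - d m) \<le> e"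
  shows "Ynorm p (wiener_op l c x - wiener_op l d x) \<le> e * Ynorm p x"
proof -
  have "wiener_op l c x - wiener_op l d x = mult_op (\<lambda>m. c m - d m) x"
    by (auto simp: mult_op_def fun_eq_iff blinfun.diff_left)
  then show ?thesis using mult_Yspace(2)[OF p x d] by simp
qed

end

lemma wiener_op_laurent_diff:
  fixes l l' :: "int ^ 'n \<Rightarrow> 'u::{complex_normed_vector, banach} \<Rightarrow>\<^sub>L 'u"
  assumes l: "wiener_symbol l" "wiener_symbol l'" and x: "x \<in> Yspace \<infinity>"
  shows "wiener_op l c x - wiener_op l' c x = laurent_op (\<lambda>k. l k - l' k) x"
proof -
  have "laurent_op (\<lambda>k. l k - l' k) x i = laurent_op l x i - laurent_op l' x i" for i
    unfolding laurent_op_reindex blinfun.diff_left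
    using infsumI[OF has_sum_add[OF has_sum_infsum[OF laurent_summable[OF l(1) x, of i]]
          has_sum_bounded_linear[OF bounded_linear_minus[OF bounded_linear_ident] has_sum_infsum[OF laurent_summable[OF l(2) x, of i]]]]]
    by simp
  then have "laurent_op (\<lambda>k. l k - l' k) x = laurent_op l x - laurent_op l' x"
    by (simp add: fun_eq_iff)
  then show ?thesis by simp
qed

section \<open>Localisation and stability\<close>

definition restrict_to :: "'i set \<Rightarrow> ('i \<Rightarrow> 'u) \<Rightarrow> 'i \<Rightarrow> 'u::zero"
  where "restrict_to M x = (\<lambda>i. if i \<in> M then x i else 0)"

text \<open>Equal to 1 on the cube of radius \<open>r\<close> about \<open>m\<close>, equal to 0 off the cube of radius \<open>2 r\<close>, and with
  Lipschitz constant \<open>1 / r\<close>.\<close>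
definition cutoff :: "nat \<Rightarrow> int ^ 'n \<Rightarrow> int ^ 'n \<Rightarrow> real"
  where "cutoff r m i = max 0 (min 1 (2 - real_of_int (zabs (i - m)) / real r))"

definition cut :: "nat \<Rightarrow> int ^ 'n \<Rightarrow> (int ^ 'n \<Rightarrow> 'u::complex_normed_vector) \<Rightarrow> int ^ 'n \<Rightarrow> 'u"
  where "cut r m x = (\<lambda>i. complex_of_real (cutoff r m i) *\<^sub>C x i)"

definition weight :: "nat \<Rightarrow> int ^ 'n \<Rightarrow> real"
  where "weight r k = min 1 (real_of_int (zabs k) / real r)"

text \<open>On the diagonal \<open>k\<close> of the matrix, the commutator with a cutoff of scale \<open>r\<close> multiplies \<open>l k\<close> by an
  increment of the cutoff over the vector \<open>k\<close>, which is at most \<open>weight r k\<close>.\<close>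
definition commutator_bound :: "(int ^ 'n \<Rightarrow> 'u::complex_normed_vector \<Rightarrow>\<^sub>L 'u) \<Rightarrow> nat \<Rightarrow> real"
  where "commutator_bound l r = (\<Sum>\<^sub>\<infinity>k. norm (l k) * weight r k)"

lemma cutoff_bounds: "0 \<le> cutoff r m i" "cutoff r m i \<le> 1"
  by (auto simp: cutoff_def)

lemma weight_bounds: "0 \<le> weight r k" "weight r k \<le> 1"
  by (auto simp: weight_def)

lemma cutoff_eq_1: "0 < r \<Longrightarrow> i \<in> cube m (int r) \<Longrightarrow> cutoff r m i = 1"
  by (auto simp: cutoff_def cube_def field_simps min_def max_def)

lemma cutoff_eq_0:
  assumes "0 < r" "i \<notin> cube m (2 * int r)" shows "cutoff r m i = 0"
proof -
  have "2 * real r < real_of_int (zabs (i - m))"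
    using assms(2) by (simp add: cube_def)
  then have "2 - real_of_int (zabs (i - m)) / real r \<le> 0"
    using assms(1) by (simp add: field_simps)
  then show ?thesis by (simp add: cutoff_def)
qed

lemma cutoff_lipschitz:
  assumes "0 < r" shows "\<bar>cutoff r m i - cutoff r m j\<bar> \<le> weight r (i - j)"
proof -
  let ?a = "real_of_int (zabs (i - m)) / real r" and ?b = "real_of_int (zabs (j - m)) / real r"
  have "\<bar>zabs (i - m) - zabs (j - m)\<bar> \<le> zabs (i - j)"
    using zabs_diff_triangle[of i m j] zabs_diff_triangle[of j m i] zabs_minus_commute[of i j]
    by linarith
  then have "\<bar>real_of_int (zabs (i - m)) - real_of_int (zabs (j - m))\<bar> \<le> real_of_int (zabs (i - j))"
    by linarith
  then have "\<bar>?a - ?b\<bar> \<le> real_of_int (zabs (i - j)) / real r"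
    using assms by (simp add: divide_right_mono abs_divide flip: diff_divide_distrib)
  then have "\<bar>cutoff r m i - cutoff r m j\<bar> \<le> real_of_int (zabs (i - j)) / real r"
    unfolding cutoff_def by linarith
  moreover have "\<bar>cutoff r m i - cutoff r m j\<bar> \<le> 1"
    using cutoff_bounds[of r m i] cutoff_bounds[of r m j] by linarith
  ultimately show ?thesis by (simp add: weight_def)
qed

lemma commutator_bound_nonneg: "0 \<le> commutator_bound l r"
  unfolding commutator_bound_def by (intro infsum_nonneg) (simp add: weight_bounds)

lemma commutator_bound_tendsto_0:
  assumes l: "wiener_symbol l"
  shows "commutator_bound l \<longlonglongrightarrow> 0"
  unfolding commutator_bound_def
proof (rule infsum_dominated_null[where C = 1])
  show "(\<lambda>k. norm (l k)) summable_on UNIV" using l by (simp add: wiener_symbol_def)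
  fix k
  have "(\<lambda>r. real_of_int (zabs k) / real r) \<longlonglongrightarrow> 0"
    by (rule lim_const_over_n)
  then have "(\<lambda>r. min 1 (real_of_int (zabs k) / real r)) \<longlonglongrightarrow> min 1 0"
    by (intro tendsto_min tendsto_const)
  then show "(\<lambda>r. weight r k) \<longlonglongrightarrow> 0" by (simp add: weight_def)
qed (auto simp: weight_bounds)

lemma commutator_bound_small:
  assumes l: "wiener_symbol l" and e: "0 < e"
  obtains r where "0 < r" "r0 \<le> r" "commutator_bound l r < e"
proof -
  have "\<forall>\<^sub>F r in sequentially. dist (commutator_bound l r) 0 < e"
    using commutator_bound_tendsto_0[OF l] e by (rule tendstoD)
  then have "\<forall>\<^sub>F r in sequentially. dist (commutator_bound l r) 0 < e \<and> max 1 r0 \<le> r"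
    using eventually_ge_at_top by (rule eventually_conj)
  then obtain r where "dist (commutator_bound l r) 0 < e" "max 1 r0 \<le> r"
    unfolding eventually_sequentially by blast
  then show ?thesis using that[of r] by (simp add: dist_norm)
qed

lemma cut_in_Yspace:
  assumes "admissible p" "x \<in> Yspace p"
  shows "cut r m x \<in> Yspace p" "Ynorm p (cut r m x) \<le> Ynorm p x"
  using Yspace_solid[OF assms, of "cut r m x"] cutoff_bounds[of r m]
  by (auto simp: cut_def norm_scaleC mult_left_le_one_le)

text \<open>In the row \<open>i\<close> the commutator is the Laurent operator applied to the sequence with entries
  \<open>(cutoff r m j - cutoff r m i) x j\<close>; the multiplication operator drops out.\<close>
lemma norm_commutator_le:
  fixes x :: "int ^ 'n \<Rightarrow> 'u::{complex_normed_vector, banach}"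
  assumes l: "wiener_symbol l" and c: "c \<in> linf_LU" and x: "x \<in> Yspace \<infinity>"
  shows "norm ((wiener_op l c (cut r m x) - cut r m (wiener_op l c x)) i)
    \<le> (\<Sum>\<^sub>\<infinity>k. norm (l k) * (\<bar>cutoff r m (i - k) - cutoff r m i\<bar> * norm (x (i - k))))"
proof -
  define a where "a = complex_of_real (cutoff r m i)"
  define y where "y = cut r m x - cscale a x"
  have cx: "cut r m x \<in> Yspace \<infinity>" and ax: "cscale a x \<in> Yspace \<infinity>"
    using cut_in_Yspace[OF _ x] Yspace_cscale[OF _ x] by auto
  then have y: "y \<in> Yspace \<infinity>" unfolding y_def by (intro Yspace_diff) auto
  have "laurent_op l (cut r m x) = laurent_op l (y + cscale a x)" by (simp add: y_def)
  also have "\<dots> = laurent_op l y + cscale a (laurent_op l x)"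
    using laurent_add[OF l y ax] laurent_cscale[OF l x] by simp
  finally have "laurent_op l (cut r m x) i - a *\<^sub>C laurent_op l x i = laurent_op l y i"
    by (simp add: cscale_def)
  moreover have "mult_op c (cut r m x) i = a *\<^sub>C mult_op c x i"
  proof -
    have "c i \<in> LU" using c by (auto simp: linf_LU_def)
    then show ?thesis by (simp add: mult_op_def cut_def a_def LU_def)
  qed
  ultimately have "(wiener_op l c (cut r m x) - cut r m (wiener_op l c x)) i = laurent_op l y i"
    by (simp add: cut_def scaleC_add_right a_def)
  then have "norm ((wiener_op l c (cut r m x) - cut r m (wiener_op l c x)) i)
      \<le> (\<Sum>\<^sub>\<infinity>k. norm (l k) * norm (y (i - k)))"
    using norm_laurent_le[OF l y] by simp
  moreover have "y j = complex_of_real (cutoff r m j - cutoff r m i) *\<^sub>C x j" for j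
    unfolding y_def a_def cut_def cscale_def fun_diff_def of_real_diff
    by (metis add_diff_cancel_right' diff_add_cancel scaleC_add_left)
  ultimately show ?thesis by (simp only: norm_scaleC norm_of_real)
qed

lemma commutator_sup_le:
  fixes x :: "int ^ 'n \<Rightarrow> 'u::{complex_normed_vector, banach}"
  assumes l: "wiener_symbol l" and c: "c \<in> linf_LU" and x: "x \<in> Yspace \<infinity>" and r: "0 < r"
  shows "norm ((wiener_op l c (cut r m x) - cut r m (wiener_op l c x)) i)
    \<le> commutator_bound l r * Ynorm \<infinity> x"
proof -
  have "norm (l k) * (\<bar>cutoff r m (i - k) - cutoff r m i\<bar> * norm (x (i - k)))
      \<le> norm (l k) * (weight r k * Ynorm \<infinity> x)" for k
    using cutoff_lipschitz[OF r, of m "i - k" i] norm_le_Ynorm[OF _ x, of "i - k"]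
    by (intro mult_left_mono mult_mono) (auto simp: weight_def)
  moreover have "(\<lambda>k. norm (l k) * (\<bar>cutoff r m (i - k) - cutoff r m i\<bar> * norm (x (i - k)))) summable_on UNIV"
  proof (rule norm_summable_weight[OF l, of _ "Ynorm \<infinity> x"])
    fix k
    show "\<bar>cutoff r m (i - k) - cutoff r m i\<bar> * norm (x (i - k)) \<le> Ynorm \<infinity> x"
    proof -
      have "\<bar>cutoff r m (i - k) - cutoff r m i\<bar> \<le> 1"
        using cutoff_bounds[of r m "i - k"] cutoff_bounds[of r m i] by linarith
      then show ?thesis
        using norm_le_Ynorm[OF _ x, of "i - k"]
          mult_left_le_one_le[of "norm (x (i - k))" "\<bar>cutoff r m (i - k) - cutoff r m i\<bar>"]
        by simp
    qed
  qed simp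
  moreover have "(\<lambda>k. norm (l k) * (weight r k * Ynorm \<infinity> x)) summable_on UNIV"
    using Ynorm_nonneg[OF _ x]
    by (intro norm_summable_weight[OF l, of _ "Ynorm \<infinity> x"])
      (auto simp: weight_bounds mult_left_le_one_le)
  ultimately have "(\<Sum>\<^sub>\<infinity>k. norm (l k) * (\<bar>cutoff r m (i - k) - cutoff r m i\<bar> * norm (x (i - k))))
      \<le> (\<Sum>\<^sub>\<infinity>k. norm (l k) * (weight r k * Ynorm \<infinity> x))"
    by (intro infsum_mono)
  also have "\<dots> = commutator_bound l r * Ynorm \<infinity> x"
    by (simp add: commutator_bound_def infsum_cmult_left' flip: mult.assoc)
  finally show ?thesis using norm_commutator_le[OF l c x, of r m i] by simp
qed

lemma in_lp_infinity:
  assumes "admissible p" "in_lp p f" "\<And>m. 0 \<le> f m" shows "in_lp \<infinity> f"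
  using in_lp_imp_bounded[OF assms] by (simp add: in_lp_def)

text \<open>Iteration of \<open>b \<le> g + K b\<close> gives \<open>b \<le> g + K g + K\<^sup>2 g + \<dots>\<close>. The remainder tends to 0 in the
  supremum norm because \<open>b\<close> is bounded, while the series converges in the norm with exponent \<open>q\<close>. So
  \<open>b\<close> inherits from \<open>g\<close> the membership in a smaller space.\<close>
lemma iterate_domination:
  fixes K :: "(int ^ 'n \<Rightarrow> real) \<Rightarrow> int ^ 'n \<Rightarrow> real"
  assumes q: "admissible q" and g: "in_lp q g" "\<And>m. 0 \<le> g m"
    and b: "in_lp \<infinity> b" "\<And>m. 0 \<le> b m" and le: "\<And>m. b m \<le> g m + K b m"
    and pos: "\<And>f m. in_lp \<infinity> f \<Longrightarrow> (\<And>m. 0 \<le> f m) \<Longrightarrow> 0 \<le> K f m"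
    and sub: "\<And>f h k m. in_lp \<infinity> f \<Longrightarrow> in_lp \<infinity> h \<Longrightarrow> in_lp \<infinity> k \<Longrightarrow>
      (\<And>m. 0 \<le> f m) \<Longrightarrow> (\<And>m. 0 \<le> h m) \<Longrightarrow> (\<And>m. 0 \<le> k m) \<Longrightarrow> (\<And>m. k m \<le> f m + h m) \<Longrightarrow>
      K k m \<le> K f m + K h m"
    and contr: "\<And>p f. admissible p \<Longrightarrow> in_lp p f \<Longrightarrow> (\<And>m. 0 \<le> f m) \<Longrightarrow>
      in_lp p (K f) \<and> lp_norm p (K f) \<le> lp_norm p f / 2"
  shows "in_lp q b \<and> lp_norm q b \<le> 2 * lp_norm q g"
proof -
  have iter: "in_lp p ((K ^^ n) f) \<and> (\<forall>m. 0 \<le> (K ^^ n) f m) \<and>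
      lp_norm p ((K ^^ n) f) \<le> lp_norm p f * (1 / 2) ^ n"
    if p: "admissible p" and f: "in_lp p f" "\<And>m. 0 \<le> f m" for p f n
  proof (induction n)
    case 0
    then show ?case using f by simp
  next
    case (Suc n)
    have "in_lp \<infinity> ((K ^^ n) f)"
      using in_lp_infinity[OF p] Suc by blast
    then have "0 \<le> K ((K ^^ n) f) m" for m using pos Suc by blast
    moreover have "in_lp p (K ((K ^^ n) f)) \<and> lp_norm p (K ((K ^^ n) f)) \<le> lp_norm p ((K ^^ n) f) / 2"
      using contr[OF p] Suc by blast
    ultimately show ?case using Suc by auto
  qed
  have ginf: "in_lp \<infinity> g" by (rule in_lp_infinity[OF q g])
  have step: "(K ^^ n) b m \<le> (K ^^ n) g m + (K ^^ Suc n) b m" for n m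
  proof (induction n arbitrary: m)
    case 0
    then show ?case using le by simp
  next
    case (Suc n)
    have "K ((K ^^ n) b) m \<le> K ((K ^^ n) g) m + K ((K ^^ Suc n) b) m"
      using iter[of \<infinity> b n] iter[of \<infinity> g n] iter[of \<infinity> b "Suc n"] b g(2) ginf Suc
      by (intro sub) auto
    then show ?case by simp
  qed
  have partial: "b m \<le> (\<Sum>n<M. (K ^^ n) g m) + (K ^^ M) b m" for M m
  proof (induction M)
    case (Suc M)
    then show ?case using step[of M m] by simp
  qed simp
  have gnorm: "0 \<le> lp_norm q g" using lp_norm_nonneg[OF q g] .
  have geo: "(\<lambda>n. lp_norm q g * (1 / 2) ^ n) summable_on UNIV"
    and geo_sum: "(\<Sum>\<^sub>\<infinity>n. lp_norm q g * (1 / 2) ^ n) = 2 * lp_norm q g"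
  proof -
    have "(\<lambda>n. lp_norm q g * (1 / 2) ^ n) sums (lp_norm q g * 2)"
      using geometric_sums[of "1 / 2 :: real"] by (intro sums_mult) simp
    then have "((\<lambda>n. lp_norm q g * (1 / 2) ^ n) has_sum (lp_norm q g * 2)) UNIV"
      using gnorm by (intro sums_nonneg_imp_has_sum) auto
    then show "(\<lambda>n. lp_norm q g * (1 / 2) ^ n) summable_on UNIV"
      "(\<Sum>\<^sub>\<infinity>n. lp_norm q g * (1 / 2) ^ n) = 2 * lp_norm q g"
      by (auto simp: has_sum_imp_summable infsumI)
  qed
  have "0 \<le> lp_norm q ((K ^^ n) g)" for n
    using iter[OF q g, of n] by (intro lp_norm_nonneg[OF q]) auto
  then have ns: "(\<lambda>n. lp_norm q ((K ^^ n) g)) summable_on UNIV"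
    using iter[OF q g] by (intro summable_on_comparison_test[OF geo]) auto
  have ps: "(\<lambda>n. (K ^^ n) g m) summable_on UNIV" for m
  proof (rule summable_on_comparison_test[OF ns])
    fix n
    show "(K ^^ n) g m \<le> lp_norm q ((K ^^ n) g)"
      using iter[OF q g, of n] by (intro le_lp_norm[OF q]) auto
  qed (use iter[OF q g] in auto)
  have "b m \<le> (\<Sum>\<^sub>\<infinity>n. (K ^^ n) g m)" for m
  proof -
    have "b m \<le> (\<Sum>\<^sub>\<infinity>n. (K ^^ n) g m) + lp_norm \<infinity> b * (1 / 2) ^ M" for M
    proof -
      have "(\<Sum>n<M. (K ^^ n) g m) \<le> (\<Sum>\<^sub>\<infinity>n. (K ^^ n) g m)"
        using iter[OF q g] by (intro finite_sum_le_infsum ps) auto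
      moreover have "(K ^^ M) b m \<le> lp_norm \<infinity> b * (1 / 2) ^ M"
        using iter[of \<infinity> b M] b le_lp_norm[of \<infinity> "(K ^^ M) b" m] by auto
      ultimately show ?thesis using partial[of m M] by simp
    qed
    moreover have "(\<lambda>M. (\<Sum>\<^sub>\<infinity>n. (K ^^ n) g m) + lp_norm \<infinity> b * (1 / 2) ^ M)
        \<longlonglongrightarrow> (\<Sum>\<^sub>\<infinity>n. (K ^^ n) g m) + lp_norm \<infinity> b * 0"
      by (intro tendsto_intros LIMSEQ_realpow_zero) auto
    ultimately show ?thesis by (intro LIMSEQ_le_const[of _ _ "b m"]) auto
  qed
  then have "in_lp q b \<and> lp_norm q b \<le> (\<Sum>\<^sub>\<infinity>n. lp_norm q ((K ^^ n) g))"
    using iter[OF q g] ns b(2) by (intro lp_minkowski[OF q]) auto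
  moreover have "(\<Sum>\<^sub>\<infinity>n. lp_norm q ((K ^^ n) g)) \<le> (\<Sum>\<^sub>\<infinity>n. lp_norm q g * (1 / 2) ^ n)"
    using iter[OF q g] by (intro infsum_mono ns geo) auto
  ultimately show ?thesis using geo_sum by simp
qed

text \<open>The displacements of cubes of radius \<open>r\<close> that together cover the cube of radius \<open>2 r\<close>. It matters
  that their number is bounded independently of \<open>r\<close>.\<close>
definition spread :: "nat \<Rightarrow> (int ^ 'n) set"
  where "spread r = (\<lambda>v. \<chi> i. int r * v $ i) ` cube 0 1"

lemma finite_spread [simp]: "finite (spread r)" by (simp add: spread_def)

lemma card_spread_le: "card (spread r :: (int ^ 'n) set) \<le> card (cube (0 :: int ^ 'n) 1)"
  unfolding spread_def by (rule card_image_le) simp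

lemma cube_double_cover:
  assumes "i \<in> cube m (2 * int r)"
  obtains e where "e \<in> spread r" "i \<in> cube (m + e) (int r)"
proof -
  define v where "v = (\<chi> a. if (i - m) $ a > int r then 1 else if (i - m) $ a < - int r then -1 else (0 :: int))"
  have v: "v \<in> cube 0 1" by (auto simp: v_def cube_def zabs_le_iff)
  have "zabs (i - (m + (\<chi> a. int r * v $ a))) \<le> int r"
    unfolding zabs_le_iff
  proof
    fix a
    have "\<bar>(i - m) $ a\<bar> \<le> 2 * int r" using assms by (simp add: cube_def zabs_le_iff)
    then show "\<bar>(i - (m + (\<chi> a. int r * v $ a))) $ a\<bar> \<le> int r"
      by (auto simp: v_def)
  qed
  then show ?thesis using v by (intro that) (auto simp: spread_def cube_def)
qed

lemma restrict_to_Yspace: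
  assumes "admissible p" "finite M"
  shows "restrict_to M x \<in> Yspace p" "Ynorm p (restrict_to M x) \<le> (\<Sum>m\<in>M. norm (x m))"
proof -
  have "Ynorm p (restrict_to M x) \<le> (\<Sum>m\<in>M. norm (restrict_to M x m))" "restrict_to M x \<in> Yspace p"
    using Yspace_finite_support[OF assms, of "restrict_to M x"] by (auto simp: restrict_to_def)
  then show "restrict_to M x \<in> Yspace p" "Ynorm p (restrict_to M x) \<le> (\<Sum>m\<in>M. norm (x m))"
    by (auto simp: restrict_to_def)
qed

lemma sum_cube_shift: "(\<Sum>i\<in>cube m s. f i) = (\<Sum>d\<in>cube 0 s. f (m + d))"
proof -
  have "cube m s = (\<lambda>d. m + d) ` cube 0 s"
    by (auto simp: cube_def intro!: image_eqI[where x = "_ - m"])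
  then show ?thesis by (simp add: sum.reindex)
qed

definition local_norm :: "ennreal \<Rightarrow> int \<Rightarrow> (int ^ 'n \<Rightarrow> 'u::complex_normed_vector) \<Rightarrow> int ^ 'n \<Rightarrow> real"
  where "local_norm p s x m = Ynorm p (restrict_to (cube m s) x)"

context
  fixes p :: ennreal
  assumes p: "admissible p"
begin

lemma local_norm_nonneg: "0 \<le> local_norm p s x m"
  unfolding local_norm_def by (intro Ynorm_nonneg[OF p] restrict_to_Yspace[OF p]) simp

lemma norm_le_local_norm: "0 \<le> s \<Longrightarrow> norm (x m) \<le> local_norm p s x m"
  using norm_le_Ynorm[OF p restrict_to_Yspace(1)[OF p, of "cube m s" x], of m]
  by (simp add: local_norm_def restrict_to_def)

lemma local_norm_le_sum: "local_norm p s x m \<le> (\<Sum>d\<in>cube 0 s. norm (x (m + d)))"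
  using restrict_to_Yspace(2)[OF p finite_cube, of m s x]
  unfolding local_norm_def sum_cube_shift[of "\<lambda>i. norm (x i)" m s] .

lemma local_norm_bounded:
  assumes x: "x \<in> Yspace \<infinity>"
  shows "local_norm p s x m \<le> card (cube (0 :: int ^ 'n) s) * Ynorm \<infinity> (x :: int ^ 'n \<Rightarrow> 'u::complex_normed_vector)"
proof -
  have "(\<Sum>d\<in>cube 0 s. norm (x (m + d))) \<le> (\<Sum>d\<in>cube (0 :: int ^ 'n) s. Ynorm \<infinity> x)"
    using norm_le_Ynorm[OF _ x] by (intro sum_mono) auto
  then show ?thesis using local_norm_le_sum[of s x m] by simp
qed

lemma local_norm_double:
  "local_norm p (2 * int r) x m \<le> (\<Sum>e\<in>spread r. local_norm p (int r) x (m + e))"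
proof -
  have "lp_norm p (\<lambda>i. norm (restrict_to (cube m (2 * int r)) x i))
      \<le> (\<Sum>e\<in>spread r. lp_norm p (\<lambda>i. norm (restrict_to (cube (m + e) (int r)) x i)))"
  proof (rule lp_sum[OF p])
    fix i
    show "norm (restrict_to (cube m (2 * int r)) x i)
        \<le> (\<Sum>e\<in>spread r. norm (restrict_to (cube (m + e) (int r)) x i))"
    proof (cases "i \<in> cube m (2 * int r)")
      case True
      then obtain e where e: "e \<in> spread r" "i \<in> cube (m + e) (int r)"
        using cube_double_cover by blast
      then show ?thesis
        using True member_le_sum[OF e(1), of "\<lambda>e. norm (restrict_to (cube (m + e) (int r)) x i)"]
        by (simp add: restrict_to_def)
    qed (simp add: restrict_to_def sum_nonneg)
    show "in_lp p (\<lambda>i. norm (restrict_to (cube (m + e) (int r)) x i))" for e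
      using restrict_to_Yspace(1)[OF p finite_cube, of "m + e" "int r" x] by (simp add: Yspace_iff)
  qed auto
  then show ?thesis by (simp add: local_norm_def Ynorm_eq)
qed

end

text \<open>An entry of the commutator with row \<open>i\<close> and column \<open>i - k\<close> vanishes unless \<open>i\<close> or \<open>i - k\<close> lies in the
  cube about \<open>m\<close> that contains the support of the cutoff. In the first case the column \<open>i - k\<close> lies in the
  cube about \<open>m - k\<close>; hence the two local norms.\<close>
lemma commutator_local_norm_le:
  fixes x :: "int ^ 'n \<Rightarrow> 'u::{complex_normed_vector, banach}"
  assumes p: "admissible p" and l: "wiener_symbol l" and c: "c \<in> linf_LU"
    and x: "x \<in> Yspace \<infinity>" and r: "0 < r"
  shows "Ynorm p (wiener_op l c (cut r m x) - cut r m (wiener_op l c x))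
    \<le> (\<Sum>\<^sub>\<infinity>k. norm (l k) * (weight r k *
        (local_norm p (2 * int r) x m + local_norm p (2 * int r) x (m - k))))"
proof -
  let ?Q = "cube m (2 * int r)" and ?N = "local_norm p (2 * int r) x"
  define B where "B = card (cube (0 :: int ^ 'n) (2 * int r)) * Ynorm \<infinity> x"
  have NB: "?N j \<le> B" for j unfolding B_def by (rule local_norm_bounded[OF p x])
  have N0: "0 \<le> ?N j" for j by (rule local_norm_nonneg[OF p])
  define f1 where "f1 = (\<lambda>k i. norm (restrict_to (cube (m - k) (2 * int r)) x (i - k)))"
  define f2 where "f2 = (\<lambda>k i. norm (restrict_to ?Q x (i - k)))"
  have f1: "in_lp p (f1 k)" "lp_norm p (f1 k) = ?N (m - k)" for k
    using Yspace_shift[OF p restrict_to_Yspace(1)[OF p, of "cube (m - k) (2 * int r)" x], of "- k"]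
    by (auto simp: f1_def Yspace_iff Ynorm_eq shift_def local_norm_def)
  have f2: "in_lp p (f2 k)" "lp_norm p (f2 k) = ?N m" for k
    using Yspace_shift[OF p restrict_to_Yspace(1)[OF p, of "cube m (2 * int r)" x], of "- k"]
    by (auto simp: f2_def Yspace_iff Ynorm_eq shift_def local_norm_def)
  define h where "h = (\<lambda>k i. norm (l k) * weight r k * (f1 k i + f2 k i))"
  have f12: "in_lp p (\<lambda>i. f1 k i + f2 k i)" "lp_norm p (\<lambda>i. f1 k i + f2 k i) \<le> ?N m + ?N (m - k)" for k
  proof -
    have 0: "0 \<le> f1 k i" "0 \<le> f2 k i" for i by (simp_all add: f1_def f2_def)
    show "in_lp p (\<lambda>i. f1 k i + f2 k i)"
      by (rule lp_add(1)[OF p f1(1)[of k] f2(1)[of k]]) (simp_all add: 0)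
    have "lp_norm p (\<lambda>i. f1 k i + f2 k i) \<le> lp_norm p (f1 k) + lp_norm p (f2 k)"
      by (rule lp_add(2)[OF p f1(1)[of k] f2(1)[of k]]) (simp_all add: 0)
    then show "lp_norm p (\<lambda>i. f1 k i + f2 k i) \<le> ?N m + ?N (m - k)" by (simp add: f1 f2)
  qed
  have h: "in_lp p (h k)" "lp_norm p (h k) \<le> norm (l k) * (weight r k * (?N m + ?N (m - k)))" for k
  proof -
    show "in_lp p (h k)" unfolding h_def
      by (rule lp_scale(1)[OF p f12(1)]) (auto simp: weight_bounds f1_def f2_def)
    have "lp_norm p (h k) = norm (l k) * weight r k * lp_norm p (\<lambda>i. f1 k i + f2 k i)" unfolding h_def
      by (rule lp_scale(2)[OF p f12(1)]) (auto simp: weight_bounds f1_def f2_def)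
    also have "\<dots> \<le> norm (l k) * weight r k * (?N m + ?N (m - k))"
      using f12(2) by (intro mult_left_mono) (auto simp: weight_bounds)
    finally show "lp_norm p (h k) \<le> norm (l k) * (weight r k * (?N m + ?N (m - k)))"
      by (simp add: mult.assoc)
  qed
  have h0: "0 \<le> h k i" for k i by (simp add: h_def f1_def f2_def weight_bounds)
  have big: "(\<lambda>k. norm (l k) * (weight r k * (?N m + ?N (m - k)))) summable_on UNIV"
  proof (rule norm_summable_weight[OF l])
    fix k
    have "weight r k * (?N m + ?N (m - k)) \<le> 1 * (B + B)"
      using weight_bounds NB N0 by (intro mult_mono add_mono) auto
    then show "weight r k * (?N m + ?N (m - k)) \<le> B + B" by simp
  qed (intro mult_nonneg_nonneg add_nonneg_nonneg N0 weight_bounds)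
  have ns: "(\<lambda>k. lp_norm p (h k)) summable_on UNIV"
    using h lp_norm_nonneg[OF p h(1) h0] by (intro summable_on_comparison_test[OF big]) auto
  have hs: "(\<lambda>k. h k i) summable_on UNIV" for i
    using le_lp_norm[OF p h(1) h0] h0 by (intro summable_on_comparison_test[OF ns]) auto
  have pt: "norm ((wiener_op l c (cut r m x) - cut r m (wiener_op l c x)) i) \<le> (\<Sum>\<^sub>\<infinity>k. h k i)" for i
  proof -
    have le: "norm (l k) * (\<bar>cutoff r m (i - k) - cutoff r m i\<bar> * norm (x (i - k))) \<le> h k i" for k
    proof -
      have "\<bar>cutoff r m (i - k) - cutoff r m i\<bar> * norm (x (i - k)) \<le> weight r k * (f1 k i + f2 k i)"
      proof (cases "i \<in> ?Q \<or> i - k \<in> ?Q")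
        case True
        then have "norm (x (i - k)) \<le> f1 k i + f2 k i"
          by (auto simp: f1_def f2_def restrict_to_def cube_def)
        then show ?thesis
          using cutoff_lipschitz[OF r, of m "i - k" i]
          by (intro mult_mono) (auto simp: weight_def)
      next
        case False
        then show ?thesis
          by (simp add: f1_def f2_def cutoff_eq_0[OF r] weight_bounds)
      qed
      then show ?thesis by (simp add: h_def mult.assoc mult_left_mono)
    qed
    have "(\<Sum>\<^sub>\<infinity>k. norm (l k) * (\<bar>cutoff r m (i - k) - cutoff r m i\<bar> * norm (x (i - k)))) \<le> (\<Sum>\<^sub>\<infinity>k. h k i)"
      by (intro infsum_mono summable_on_comparison_test[OF hs[of i]] hs le) simp
    then show ?thesis using norm_commutator_le[OF l c x, of r m i] by simp
  qed
  have "Ynorm p (wiener_op l c (cut r m x) - cut r m (wiener_op l c x)) \<le> (\<Sum>\<^sub>\<infinity>k. lp_norm p (h k))"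
    unfolding Ynorm_eq using lp_minkowski[OF p h(1) h0 ns _ pt] by simp
  also have "\<dots> \<le> (\<Sum>\<^sub>\<infinity>k. norm (l k) * (weight r k * (?N m + ?N (m - k))))"
    by (intro infsum_mono ns big h)
  finally show ?thesis .
qed

text \<open>The lower bound is applied to the pieces \<open>cut r m x\<close>. Up to the commutator, it bounds the local
  norm of \<open>x\<close> near \<open>m\<close> by that of its image. As a function of \<open>m\<close>, the commutator is dominated by a
  convolution of the local norms of \<open>x\<close> with a kernel whose sum is a fixed multiple of
  \<open>commutator_bound l r\<close>. For large \<open>r\<close> this is a contraction on every \<open>\<ell>\<^sup>q\<close>, and
  \<open>iterate_domination\<close> applies. The exponent \<open>p\<close> survives only inside cubes of the fixed radius \<open>2 r\<close>, where
  the local norm is bounded by a finite sum of pointwise norms.\<close>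
theorem wiener_stability:
  fixes l c :: "int ^ 'n \<Rightarrow> 'u::{complex_normed_vector, banach} \<Rightarrow>\<^sub>L 'u"
  assumes l: "wiener_symbol l" and c: "c \<in> linf_LU" and p: "admissible p" and q: "admissible q"
    and nu: "0 < nu"
    and below: "\<And>x. finite {m. x m \<noteq> 0} \<Longrightarrow> nu * Ynorm p x \<le> Ynorm p (wiener_op l c x)"
  obtains C where "0 \<le> C"
    "\<And>x. x \<in> Yspace \<infinity> \<Longrightarrow> wiener_op l c x \<in> Yspace q \<Longrightarrow>
      x \<in> Yspace q \<and> Ynorm q x \<le> C * Ynorm q (wiener_op l c x)"
proof -
  define E where "E = real (card (cube (0 :: int ^ 'n) 1))"
  have E: "0 \<le> E" by (simp add: E_def)
  \<comment> \<open>at this scale the kernel of the convolution, whose sum is at most \<open>2 E / nu\<close> times \<open>commutator_bound l r\<close>, has sum at most \<open>1 / 2\<close>\<close>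
  obtain r where r: "0 < r" and cb: "commutator_bound l r < nu / (4 * (E + 1))"
    using commutator_bound_small[OF l, of "nu / (4 * (E + 1))" 0] nu E by auto
  define S where "S = (spread r :: (int ^ 'n) set)"
  have S: "finite S" "real (card S) \<le> E"
    using card_spread_le by (auto simp: S_def E_def)
  define \<alpha> where "\<alpha> = (\<lambda>k. norm (l k) * weight r k)"
  have \<alpha>0: "0 \<le> \<alpha> k" for k by (simp add: \<alpha>_def weight_bounds)
  have \<alpha>s: "\<alpha> summable_on UNIV" unfolding \<alpha>_def
    by (rule norm_summable_weight[OF l weight_bounds])
  have \<alpha>C: "infsum \<alpha> UNIV = commutator_bound l r" by (simp add: \<alpha>_def commutator_bound_def)
  \<comment> \<open>the convolution operator \<open>K\<close>, split along the diagonals \<open>k\<close>; the displacements in \<open>S\<close> reduce cubes of radius \<open>2 r\<close> to cubes of radius \<open>r\<close>\<close>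
  define G where "G = (\<lambda>k f m. \<Sum>e\<in>S. f (m + e) + f (m - k + e) :: real)"
  define K where "K = (\<lambda>f m. \<Sum>\<^sub>\<infinity>k. inverse nu * \<alpha> k * G k f m)"
  have G0: "0 \<le> G k f m" if "\<And>m. 0 \<le> f m" for k f m
    unfolding G_def using that by (intro sum_nonneg add_nonneg_nonneg)
  have Glp: "in_lp s (G k f) \<and> lp_norm s (G k f) \<le> 2 * E * lp_norm s f"
    if s: "admissible s" and f: "in_lp s f" "\<And>m. 0 \<le> f m" for s f k
  proof -
    let ?f = "\<lambda>e m. f (m + e) + f (m - k + e)"
    have e: "in_lp s (?f e) \<and> lp_norm s (?f e) \<le> 2 * lp_norm s f" for e
    proof -
      have "in_lp s (\<lambda>m. f (m + e))" "lp_norm s (\<lambda>m. f (m + e)) = lp_norm s f"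
        "in_lp s (\<lambda>m. f (m + (e - k)))" "lp_norm s (\<lambda>m. f (m + (e - k))) = lp_norm s f"
        using lp_shift[OF s f] by auto
      moreover have "m + (e - k) = m - k + e" for m by simp
      ultimately show ?thesis
        using lp_add[OF s, of "\<lambda>m. f (m + e)" "\<lambda>m. f (m - k + e)" "?f e"] f(2) by auto
    qed
    have "in_lp s (G k f)" "lp_norm s (G k f) \<le> (\<Sum>e\<in>S. lp_norm s (?f e))"
      using lp_sum[OF s S(1), of ?f "G k f"] e f(2) by (auto simp: G_def sum_nonneg)
    moreover have "(\<Sum>e\<in>S. lp_norm s (?f e)) \<le> (\<Sum>e\<in>S. 2 * lp_norm s f)"
      using e by (intro sum_mono) auto
    moreover have "(\<Sum>e\<in>S. 2 * lp_norm s f) \<le> 2 * E * lp_norm s f"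
      using S(2) lp_norm_nonneg[OF s f] by (simp add: mult_right_mono)
    ultimately show ?thesis by linarith
  qed
  have Ks: "(\<lambda>k. inverse nu * \<alpha> k * G k f m) summable_on UNIV"
    if f: "in_lp \<infinity> f" "\<And>m. 0 \<le> f m" for f m
  proof (rule summable_on_comparison_test)
    show "(\<lambda>k. inverse nu * \<alpha> k * (2 * E * lp_norm \<infinity> f)) summable_on UNIV"
      by (intro summable_on_cmult_left summable_on_cmult_right \<alpha>s)
    show "inverse nu * \<alpha> k * G k f m \<le> inverse nu * \<alpha> k * (2 * E * lp_norm \<infinity> f)" for k
      using Glp[OF _ f, of k] le_lp_norm[of \<infinity> "G k f" m] G0[of f, OF f(2)] nu \<alpha>0[of k]
      by (intro mult_left_mono) auto
    show "0 \<le> inverse nu * \<alpha> k * G k f m" for k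
      using G0[of f, OF f(2)] nu \<alpha>0[of k] by auto
  qed
  have Kpos: "0 \<le> K f m" if f: "\<And>m. 0 \<le> f m" for f m
    unfolding K_def using G0[of f, OF f] nu \<alpha>0 by (intro infsum_nonneg) auto
  have Klp: "in_lp s (K f) \<and> lp_norm s (K f) \<le> lp_norm s f / 2"
    if s: "admissible s" and f: "in_lp s f" "\<And>m. 0 \<le> f m" for s f
  proof -
    have fi: "in_lp \<infinity> f" by (rule in_lp_infinity[OF s f])
    let ?h = "\<lambda>k m. inverse nu * \<alpha> k * G k f m"
    have h: "in_lp s (?h k)" "lp_norm s (?h k) \<le> \<alpha> k * (inverse nu * (2 * E * lp_norm s f))" for k
    proof -
      show "in_lp s (?h k)"
        using lp_scale(1)[OF s, of "G k f" "inverse nu * \<alpha> k"] Glp[OF s f] G0[of f, OF f(2)] nu \<alpha>0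
        by auto
      have "lp_norm s (?h k) = inverse nu * \<alpha> k * lp_norm s (G k f)"
        using lp_scale(2)[OF s, of "G k f" "inverse nu * \<alpha> k"] Glp[OF s f] G0[of f, OF f(2)] nu \<alpha>0
        by auto
      also have "\<dots> \<le> inverse nu * \<alpha> k * (2 * E * lp_norm s f)"
        using Glp[OF s f, of k] nu \<alpha>0 by (intro mult_left_mono) auto
      finally show "lp_norm s (?h k) \<le> \<alpha> k * (inverse nu * (2 * E * lp_norm s f))"
        by (simp add: ac_simps)
    qed
    have h0: "0 \<le> ?h k m" for k m using G0[of f, OF f(2)] nu \<alpha>0[of k] by auto
    have big: "(\<lambda>k. \<alpha> k * (inverse nu * (2 * E * lp_norm s f))) summable_on UNIV"
      by (intro summable_on_cmult_left \<alpha>s)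
    have ns: "(\<lambda>k. lp_norm s (?h k)) summable_on UNIV"
      using h lp_norm_nonneg[OF s h(1) h0] by (intro summable_on_comparison_test[OF big]) auto
    have "in_lp s (K f) \<and> lp_norm s (K f) \<le> (\<Sum>\<^sub>\<infinity>k. lp_norm s (?h k))"
      using Kpos[of f, OF f(2)] by (intro lp_minkowski[OF s h(1) h0 ns]) (auto simp: K_def)
    moreover have "(\<Sum>\<^sub>\<infinity>k. lp_norm s (?h k)) \<le> (\<Sum>\<^sub>\<infinity>k. \<alpha> k * (inverse nu * (2 * E * lp_norm s f)))"
      by (intro infsum_mono ns big h)
    moreover have "\<dots> = commutator_bound l r * (inverse nu * (2 * E * lp_norm s f))"
      by (simp add: infsum_cmult_left' \<alpha>C)
    moreover have "\<dots> \<le> lp_norm s f / 2"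
    proof -
      have "commutator_bound l r * (4 * (E + 1)) < nu"
        using cb E by (simp add: field_simps)
      then have "commutator_bound l r * (4 * E) \<le> nu"
        using commutator_bound_nonneg[of l r] by (simp add: algebra_simps)
      then have "commutator_bound l r * (inverse nu * (2 * E)) \<le> 1 / 2"
        using nu by (simp add: field_simps)
      then have "commutator_bound l r * (inverse nu * (2 * E)) * lp_norm s f \<le> 1 / 2 * lp_norm s f"
        using lp_norm_nonneg[OF s f] by (rule mult_right_mono)
      then show ?thesis by (simp add: ac_simps)
    qed
    ultimately show ?thesis by linarith
  qed
  have Ksub: "K k m \<le> K f m + K h m"
    if "in_lp \<infinity> f" "in_lp \<infinity> h" "in_lp \<infinity> k" "\<And>m. 0 \<le> f m" "\<And>m. 0 \<le> h m" "\<And>m. 0 \<le> k m"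
      "\<And>m. k m \<le> f m + h m" for f h k m
  proof -
    have "G j k m \<le> G j f m + G j h m" for j
      unfolding G_def sum.distrib[symmetric]
    proof (rule sum_mono)
      fix e
      show "k (m + e) + k (m - j + e)
          \<le> f (m + e) + f (m - j + e) + (h (m + e) + h (m - j + e))"
        using that(7)[of "m + e"] that(7)[of "m - j + e"] by linarith
    qed
    then have *: "inverse nu * \<alpha> j * G j k m \<le> inverse nu * \<alpha> j * G j f m + inverse nu * \<alpha> j * G j h m" for j
      using nu \<alpha>0[of j] by (simp add: mult_left_mono flip: distrib_left)
    have "K k m \<le> (\<Sum>\<^sub>\<infinity>j. inverse nu * \<alpha> j * G j f m + inverse nu * \<alpha> j * G j h m)"
      unfolding K_def using that by (intro infsum_mono Ks summable_on_add *) auto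
    also have "\<dots> = K f m + K h m"
      unfolding K_def using that by (intro infsum_add Ks) auto
    finally show ?thesis .
  qed
  define D where "D = real (card (cube (0 :: int ^ 'n) (2 * int r)))"
  show ?thesis
  proof (rule that[of "2 * inverse nu * D"])
    show "0 \<le> 2 * inverse nu * D" using nu by (simp add: D_def)
    fix x :: "int ^ 'n \<Rightarrow> 'u"
    assume x: "x \<in> Yspace \<infinity>" and Wx: "wiener_op l c x \<in> Yspace q"
    let ?W = "wiener_op l c"
    define b where "b = local_norm p (int r) x"
    define g where "g = (\<lambda>m. inverse nu * (\<Sum>d\<in>cube 0 (2 * int r). norm (?W x (m + d))))"
    have b0: "0 \<le> b m" for m unfolding b_def by (rule local_norm_nonneg[OF p])
    have binf: "in_lp \<infinity> b"
    proof -
      have "\<bar>b m\<bar> \<le> card (cube (0 :: int ^ 'n) (int r)) * Ynorm \<infinity> x" for m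
        using b0[of m] local_norm_bounded[OF p x, of "int r" m] by (simp add: b_def)
      then show ?thesis by (auto simp: in_lp_def bounded_iff)
    qed
    have g: "in_lp q g" "lp_norm q g \<le> inverse nu * (D * Ynorm q (?W x))"
    proof -
      let ?g = "\<lambda>m. \<Sum>d\<in>cube 0 (2 * int r). norm (?W x (m + d))"
      have d: "in_lp q (\<lambda>m. norm (?W x (m + d)))" "lp_norm q (\<lambda>m. norm (?W x (m + d))) = Ynorm q (?W x)" for d
        using lp_shift[OF q, of "\<lambda>m. norm (?W x m)" d] Wx by (auto simp: Yspace_iff Ynorm_eq)
      have *: "in_lp q ?g" "lp_norm q ?g \<le> D * Ynorm q (?W x)"
        using lp_sum[OF q, of "cube 0 (2 * int r)" "\<lambda>d m. norm (?W x (m + d))" ?g] d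
        by (auto simp: D_def sum_nonneg)
      then show "in_lp q g" "lp_norm q g \<le> inverse nu * (D * Ynorm q (?W x))"
        using lp_scale[OF q *(1), of "inverse nu"] nu
        by (auto simp: g_def sum_nonneg)
    qed
    have g0: "0 \<le> g m" for m using nu by (simp add: g_def sum_nonneg)
    have key: "b m \<le> g m + K b m" for m
    proof -
      have Wxi: "?W x \<in> Yspace \<infinity>" using wiener_op_Yspace[OF l c _ x] by simp
      have fs: "finite {i. cut r m y i \<noteq> 0}" for y :: "int ^ 'n \<Rightarrow> 'u"
      proof (rule finite_subset[of _ "cube m (2 * int r)"])
        show "{i. cut r m y i \<noteq> 0} \<subseteq> cube m (2 * int r)"
          by (rule subsetI, rule ccontr) (simp add: cut_def cutoff_eq_0[OF r])
      qed simp
      have cutp: "cut r m y \<in> Yspace p" for y :: "int ^ 'n \<Rightarrow> 'u"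
        using Yspace_finite_support(1)[OF p fs] by blast
      have "nu * b m \<le> nu * Ynorm p (cut r m x)"
      proof (rule mult_left_mono)
        show "b m \<le> Ynorm p (cut r m x)" unfolding b_def local_norm_def
          by (intro Yspace_solid(2)[OF p cutp])
            (auto simp: restrict_to_def cut_def scaleC_one cutoff_eq_1[OF r])
      qed (use nu in simp)
      also have "\<dots> \<le> Ynorm p (?W (cut r m x))" by (rule below[OF fs])
      also have "?W (cut r m x) = cut r m (?W x) + (?W (cut r m x) - cut r m (?W x))" by simp
      also have "Ynorm p \<dots> \<le> Ynorm p (cut r m (?W x)) + Ynorm p (?W (cut r m x) - cut r m (?W x))"
        by (intro Yspace_add(2)[OF p] Yspace_diff(1)[OF p] cutp wiener_op_Yspace[OF l c p])
      also have "Ynorm p (cut r m (?W x)) \<le> Ynorm p (restrict_to (cube m (2 * int r)) (?W x))"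
      proof (rule Yspace_solid(2)[OF p restrict_to_Yspace(1)[OF p]])
        fix i
        show "norm (cut r m (?W x) i) \<le> norm (restrict_to (cube m (2 * int r)) (?W x) i)"
          using cutoff_bounds[of r m i] cutoff_eq_0[OF r, of i m]
          by (auto simp: cut_def restrict_to_def norm_scaleC mult_left_le_one_le)
      qed simp
      also have "\<dots> \<le> nu * g m"
        using local_norm_le_sum[OF p, of "2 * int r" "?W x" m] nu
        by (simp add: local_norm_def g_def flip: mult.assoc)
      also have "Ynorm p (?W (cut r m x) - cut r m (?W x))
        \<le> (\<Sum>\<^sub>\<infinity>k. norm (l k) * (weight r k *
            (local_norm p (2 * int r) x m + local_norm p (2 * int r) x (m - k))))"
        by (rule commutator_local_norm_le[OF p l c x r])
      also have "\<dots> \<le> (\<Sum>\<^sub>\<infinity>k. nu * (inverse nu * \<alpha> k * G k b m))"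
      proof (rule infsum_mono)
        let ?N = "local_norm p (2 * int r) x"
        define B where "B = card (cube (0 :: int ^ 'n) (2 * int r)) * Ynorm \<infinity> x"
        have NB: "?N j \<le> B" for j unfolding B_def by (rule local_norm_bounded[OF p x])
        have N0: "0 \<le> ?N j" for j by (rule local_norm_nonneg[OF p])
        show "(\<lambda>k. norm (l k) * (weight r k * (?N m + ?N (m - k)))) summable_on UNIV"
        proof (rule norm_summable_weight[OF l])
          fix k
          have "weight r k * (?N m + ?N (m - k)) \<le> 1 * (B + B)"
            using weight_bounds NB N0 by (intro mult_mono add_mono) auto
          then show "weight r k * (?N m + ?N (m - k)) \<le> B + B" by simp
        qed (intro mult_nonneg_nonneg add_nonneg_nonneg N0 weight_bounds)
        show "(\<lambda>k. nu * (inverse nu * \<alpha> k * G k b m)) summable_on UNIV"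
          by (intro summable_on_cmult_right Ks binf b0)
        fix k
        have "?N m + ?N (m - k) \<le> G k b m"
          using local_norm_double[OF p, of r x m] local_norm_double[OF p, of r x "m - k"]
          by (simp add: G_def S_def b_def sum.distrib)
        then have "\<alpha> k * (?N m + ?N (m - k)) \<le> \<alpha> k * G k b m" using \<alpha>0 by (rule mult_left_mono)
        then show "norm (l k) * (weight r k * (?N m + ?N (m - k))) \<le> nu * (inverse nu * \<alpha> k * G k b m)"
          using nu by (simp add: \<alpha>_def field_simps)
      qed
      also have "\<dots> = nu * K b m" unfolding K_def by (rule infsum_cmult_right')
      finally show ?thesis using nu by (simp flip: distrib_left)
    qed
    have "in_lp q b \<and> lp_norm q b \<le> 2 * lp_norm q g"
      by (rule iterate_domination[where K = K, OF q g(1) g0 binf b0 key])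
        (use Kpos Ksub Klp in auto)
    moreover have "norm (x m) \<le> b m" for m
      unfolding b_def by (rule norm_le_local_norm[OF p]) simp
    ultimately show "x \<in> Yspace q \<and> Ynorm q x \<le> 2 * inverse nu * D * Ynorm q (?W x)"
      using lp_mono[OF q, of b "\<lambda>m. norm (x m)"] g(2) by (auto simp: Yspace_iff Ynorm_eq)
  qed
qed

section \<open>Compactness\<close>

lemma tendsto_from_bound:
  fixes f :: "nat \<Rightarrow> 'a::real_normed_vector"
  assumes "\<And>n. norm (f n - a) \<le> e n" "e \<longlonglongrightarrow> 0" shows "f \<longlonglongrightarrow> a"
  by (rule LIM_zero_cancel, rule Lim_null_comparison[OF always_eventually assms(2)]) (simp add: assms(1))

lemma uniformly_tendsto_at:
  fixes f :: "nat \<Rightarrow> 'i \<Rightarrow> 'a::real_normed_vector"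
  assumes "\<And>e. 0 < e \<Longrightarrow> \<forall>\<^sub>F n in sequentially. \<forall>m. norm (f n m - d m) \<le> e"
  shows "(\<lambda>n. f n m) \<longlonglongrightarrow> d m"
proof (rule tendstoI)
  fix e :: real assume e: "0 < e"
  then have "\<forall>\<^sub>F n in sequentially. \<forall>m. norm (f n m - d m) \<le> e / 2" by (intro assms) simp
  then show "\<forall>\<^sub>F n in sequentially. dist (f n m) (d m) < e"
  proof eventually_elim
    case (elim n)
    then have "norm (f n m - d m) \<le> e / 2" by blast
    then show ?case using e by (simp add: dist_norm)
  qed
qed

lemma no_positive_bound_sequence:
  assumes "\<not> (\<exists>d>0. \<forall>x\<in>S. P d x)"
  obtains x where "\<And>n. x n \<in> S" "\<And>n. \<not> P (inverse (real (Suc n))) (x n)"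
proof -
  have "\<exists>x. x \<in> S \<and> \<not> P (inverse (real (Suc n))) x" for n
  proof -
    have "0 < inverse (real (Suc n))" by simp
    then show ?thesis using assms by blast
  qed
  then obtain x where "\<forall>n. x n \<in> S \<and> \<not> P (inverse (real (Suc n))) (x n)"
    using choice[of "\<lambda>n x. x \<in> S \<and> \<not> P (inverse (real (Suc n))) x"] by blast
  then show ?thesis using that by blast
qed

text \<open>The theorem of Bolzano and Weierstrass, by induction on a spanning set. A new vector \<open>e\<close> has positive
  distance from the span of the old ones, so that the coefficients of \<open>e\<close> in a bounded sequence are
  bounded.\<close>
lemma span_bounded_subseq:
  fixes B :: "'u::complex_normed_vector set"
  assumes "finite B"
  shows "\<forall>u :: nat \<Rightarrow> 'u. (\<forall>n. u n \<in> sc.span B) \<and> bounded (range u) \<longrightarrow>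
    (\<exists>r v. strict_mono r \<and> v \<in> sc.span B \<and> (u \<circ> r) \<longlonglongrightarrow> v)"
  using assms
proof (induction rule: finite_induct)
  case empty
  show ?case unfolding sc.span_empty
  proof (intro allI impI)
    fix u :: "nat \<Rightarrow> 'u" assume "(\<forall>n. u n \<in> {0}) \<and> bounded (range u)"
    then have "u \<circ> id = (\<lambda>_. 0)" by auto
    then show "\<exists>r v. strict_mono r \<and> v \<in> {0} \<and> (u \<circ> r) \<longlonglongrightarrow> v"
      by (intro exI[of _ id] exI[of _ 0]) (simp add: strict_mono_id)
  qed
next
  case (insert e B)
  show ?case
  proof (cases "e \<in> sc.span B")
    case True
    then have "sc.span (insert e B) = sc.span B" by (rule sc.span_redundant)
    then show ?thesis using insert.IH by simp
  next
    case False
    \<comment> \<open>the span of \<open>B\<close> is closed, so \<open>e\<close> has positive distance from it\<close>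
    have "\<exists>d>0. \<forall>v\<in>sc.span B. d \<le> norm (e - v)"
    proof (rule ccontr)
      assume "\<not> (\<exists>d>0. \<forall>v\<in>sc.span B. d \<le> norm (e - v))"
      from no_positive_bound_sequence[OF this] obtain v
        where v: "\<And>n. v n \<in> sc.span B" "\<And>n. \<not> inverse (real (Suc n)) \<le> norm (e - v n)" by blast
      have "v \<longlonglongrightarrow> e"
        by (rule tendsto_from_bound[OF _ LIMSEQ_inverse_real_of_nat], subst norm_minus_commute)
          (use v(2) in \<open>simp add: not_le less_imp_le del: of_nat_Suc\<close>)
      then have "bounded (range v)" by (rule convergent_imp_bounded)
      then have "(\<forall>n. v n \<in> sc.span B) \<and> bounded (range v)" using v(1) by simp
      from mp[OF spec[OF insert.IH] this] obtain r w
        where w: "strict_mono r" "w \<in> sc.span B" "(v \<circ> r) \<longlonglongrightarrow> w" by blast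
      have "(v \<circ> r) \<longlonglongrightarrow> e" by (rule LIMSEQ_subseq_LIMSEQ[OF \<open>v \<longlonglongrightarrow> e\<close> w(1)])
      then have "w = e" by (rule LIMSEQ_unique[OF w(3)])
      then show False using w(2) False by simp
    qed
    then obtain d where d: "0 < d" "\<And>v. v \<in> sc.span B \<Longrightarrow> d \<le> norm (e - v)" by blast
    show ?thesis
    proof (intro allI impI)
      fix u :: "nat \<Rightarrow> 'u"
      assume u: "(\<forall>n. u n \<in> sc.span (insert e B)) \<and> bounded (range u)"
      then obtain K where K: "\<And>n. norm (u n) \<le> K" by (auto simp: bounded_iff)
      have "\<exists>k. u n - k *\<^sub>C e \<in> sc.span B" for n
        using u sc.span_breakdown_eq by blast
      then obtain a where a: "\<And>n. u n - a n *\<^sub>C e \<in> sc.span B" by metis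
      have abound: "cmod (a n) * d \<le> K" for n
      proof (cases "a n = 0")
        case True
        then show ?thesis using order_trans[OF norm_ge_zero K] by simp
      next
        case False
        define v where "v = (- inverse (a n)) *\<^sub>C (u n - a n *\<^sub>C e)"
        have "v \<in> sc.span B" unfolding v_def by (intro sc.span_scale a)
        then have "cmod (a n) * d \<le> cmod (a n) * norm (e - v)"
          using d by (intro mult_left_mono) auto
        also have "\<dots> = norm (a n *\<^sub>C (e - v))" by (simp add: norm_scaleC)
        also have "a n *\<^sub>C (e - v) = u n"
          using False by (simp add: v_def sc.scale_right_diff_distrib)
        finally show ?thesis using K[of n] by simp
      qed
      then have "bounded (range a)"
        using d(1) by (auto simp: bounded_iff field_simps intro!: exI[of _ "K / d"])
      then obtain \<alpha> r where r: "strict_mono r" "(a \<circ> r) \<longlonglongrightarrow> \<alpha>"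
        using bounded_imp_convergent_subsequence by blast
      define w where "w = (\<lambda>n. u (r n) - a (r n) *\<^sub>C e)"
      have "norm (w n) \<le> K + K / d * norm e" for n
      proof -
        have "norm (w n) \<le> norm (u (r n)) + cmod (a (r n)) * norm e"
          unfolding w_def using norm_triangle_ineq4[of "u (r n)"] by (metis norm_scaleC)
        also have "\<dots> \<le> K + K / d * norm e"
          using abound[of "r n"] d(1) K by (intro add_mono mult_right_mono) (auto simp: field_simps)
        finally show ?thesis .
      qed
      then have "bounded (range w)" by (auto simp: bounded_iff)
      then have "(\<forall>n. w n \<in> sc.span B) \<and> bounded (range w)" using a by (simp add: w_def)
      from mp[OF spec[OF insert.IH] this] obtain s v
        where s: "strict_mono s" "v \<in> sc.span B" "(w \<circ> s) \<longlonglongrightarrow> v" by blast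
      have "(\<lambda>n. (w \<circ> s) n + ((a \<circ> r) \<circ> s) n *\<^sub>C e) \<longlonglongrightarrow> v + \<alpha> *\<^sub>C e"
        by (intro tendsto_add s bounded_bilinear.tendsto[OF bounded_bilinear_scaleC] LIMSEQ_subseq_LIMSEQ[OF r(2)] tendsto_const)
      then have "(u \<circ> (r \<circ> s)) \<longlonglongrightarrow> v + \<alpha> *\<^sub>C e"
        by (simp add: w_def o_def)
      moreover have "v + \<alpha> *\<^sub>C e \<in> sc.span (insert e B)"
      proof (intro sc.span_add sc.span_scale)
        show "v \<in> sc.span (insert e B)"
          using s(2) sc.span_mono[OF subset_insertI[of B e]] by blast
      qed (simp add: sc.span_base)
      ultimately show "\<exists>r v. strict_mono r \<and> v \<in> sc.span (insert e B) \<and> (u \<circ> r) \<longlonglongrightarrow> v"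
        using strict_mono_o[OF r(1) s(1)] by blast
    qed
  qed
qed

lemma compact_cball_finite_dimensional:
  assumes "finite_dimensional scaleC (UNIV :: 'u::complex_normed_vector set)"
  shows "compact (cball (0 :: 'u) K)"
proof -
  obtain B :: "'u set" where B: "finite B" "UNIV = sc.span B"
    using assms by (auto simp: finite_dimensional_def)
  show ?thesis
    unfolding compact_eq_seq_compact_metric seq_compact_def
  proof (intro allI impI)
    fix u :: "nat \<Rightarrow> 'u" assume u: "\<forall>n. u n \<in> cball 0 K"
    then have "(\<forall>n. u n \<in> sc.span B) \<and> bounded (range u)"
      using B(2) by (auto simp: bounded_iff)
    from mp[OF spec[OF span_bounded_subseq[OF B(1)]] this]
    obtain r v where "strict_mono r" "(u \<circ> r) \<longlonglongrightarrow> v" by blast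
    moreover have "v \<in> cball 0 K"
      using u by (intro closed_sequentially[OF closed_cball _ \<open>(u \<circ> r) \<longlonglongrightarrow> v\<close>]) auto
    ultimately show "\<exists>l\<in>cball 0 K. \<exists>r. strict_mono r \<and> (u \<circ> r) \<longlonglongrightarrow> l" by blast
  qed
qed

lemma pointwise_subseq:
  fixes x :: "nat \<Rightarrow> int ^ 'n \<Rightarrow> 'u::complex_normed_vector"
  assumes fd: "finite_dimensional scaleC (UNIV :: 'u set)" and x: "\<And>n m. norm (x n m) \<le> K"
  obtains r y where "strict_mono r" "\<And>m. (\<lambda>n. x (r n) m) \<longlonglongrightarrow> y m" "\<And>m. norm (y m) \<le> K"
proof -
  define P where "P = (PiE UNIV (\<lambda>_. cball 0 K) :: (int ^ 'n \<Rightarrow> 'u) set)"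
  have "compactin (product_topology (\<lambda>_. euclidean) UNIV) P"
    unfolding P_def using compact_cball_finite_dimensional[OF fd]
    by (subst compactin_PiE) auto
  then have "compact P" by (simp add: euclidean_product_topology)
  then have "seq_compact P" by (rule compact_imp_seq_compact)
  moreover have "\<forall>n. x n \<in> P" using x by (auto simp: P_def)
  ultimately obtain y r where ry: "y \<in> P" "strict_mono r" "(x \<circ> r) \<longlonglongrightarrow> y"
    unfolding seq_compact_def by blast
  have "(\<lambda>n. x (r n) m) \<longlonglongrightarrow> y m" for m
  proof -
    have "isCont (\<lambda>z :: int ^ 'n \<Rightarrow> 'u. z m) y"
      by (rule bspec[OF iffD1[OF continuous_on_eq_continuous_at[OF open_UNIV]
            continuous_on_product_coordinates] UNIV_I])
    then show ?thesis using ry(3) isCont_tendsto_compose by (fastforce simp: o_def)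
  qed
  then show ?thesis using that ry by (auto simp: P_def PiE_iff)
qed

text \<open>Bounded pointwise convergence is enough, by dominated convergence along the diagonals. In this
  weak sense bounded sets are sequentially compact if the coefficient space is finite-dimensional
  (\<open>pointwise_subseq\<close>), which replaces norm compactness below.\<close>
lemma wiener_op_pointwise_limit:
  fixes l d :: "int ^ 'n \<Rightarrow> 'u::{complex_normed_vector, banach} \<Rightarrow>\<^sub>L 'u"
  assumes l: "wiener_symbol l" and x: "\<And>n m. norm (x n m) \<le> K"
    and lim: "\<And>m. (\<lambda>n. x n m) \<longlonglongrightarrow> y m" and c: "(\<lambda>n. c n i) \<longlonglongrightarrow> d i"
  shows "(\<lambda>n. wiener_op l (c n) (x n) i) \<longlonglongrightarrow> wiener_op l d y i"
proof -
  have y: "norm (y m) \<le> K" for m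
    by (rule Lim_bounded[OF tendsto_norm[OF lim[of m]]]) (use x in auto)
  have xY: "x n \<in> Yspace \<infinity>" and yY: "y \<in> Yspace \<infinity>" for n
    using Yspace_infinityI(1) x y by blast+
  have "(\<lambda>n. \<Sum>\<^sub>\<infinity>k. norm (l k) * norm (x n (i - k) - y (i - k))) \<longlonglongrightarrow> 0"
  proof (rule infsum_dominated_null)
    show "norm (x n (i - k) - y (i - k)) \<le> K + K" for n k
      using norm_triangle_ineq4[of "x n (i - k)" "y (i - k)"] x[of n "i - k"] y[of "i - k"] by linarith
    show "(\<lambda>n. norm (x n (i - k) - y (i - k))) \<longlonglongrightarrow> 0" for k
      using lim[of "i - k"] by (simp add: LIM_zero tendsto_norm_zero)
  qed (use l in \<open>auto simp: wiener_symbol_def\<close>)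
  moreover have "norm (laurent_op l (x n) i - laurent_op l y i)
      \<le> (\<Sum>\<^sub>\<infinity>k. norm (l k) * norm (x n (i - k) - y (i - k)))" for n
  proof -
    have d: "x n - y \<in> Yspace \<infinity>" by (intro Yspace_diff xY yY) simp
    have "laurent_op l (x n - y + y) = laurent_op l (x n - y) + laurent_op l y"
      by (intro laurent_add[OF l] d yY)
    then have "laurent_op l (x n) i - laurent_op l y i = laurent_op l (x n - y) i" by simp
    then show ?thesis using norm_laurent_le[OF l d, of i] by simp
  qed
  ultimately have "(\<lambda>n. laurent_op l (x n) i) \<longlonglongrightarrow> laurent_op l y i"
    by (rule tendsto_from_bound[rotated])
  moreover have "(\<lambda>n. mult_op (c n) (x n) i) \<longlonglongrightarrow> mult_op d y i"
    unfolding mult_op_def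
    by (rule bounded_bilinear.tendsto[OF bounded_bilinear_blinfun_apply c lim])
  ultimately show ?thesis by (simp add: tendsto_add)
qed

text \<open>The truncations of \<open>y\<close> to growing cubes have preimages that are bounded, by the lower bound. A
  pointwise limit of these is a preimage of \<open>y\<close>.\<close>
lemma surj_from_finite_support:
  fixes l c :: "int ^ 'n \<Rightarrow> 'u::{complex_normed_vector, banach} \<Rightarrow>\<^sub>L 'u"
  assumes fd: "finite_dimensional scaleC (UNIV :: 'u set)" and l: "wiener_symbol l"
    and C: "\<And>x. x \<in> Yspace \<infinity> \<Longrightarrow> Ynorm \<infinity> x \<le> C * Ynorm \<infinity> (wiener_op l c x)" and C0: "0 \<le> C"
    and fin: "\<And>u. finite {m. u m \<noteq> 0} \<Longrightarrow> \<exists>x\<in>Yspace \<infinity>. wiener_op l c x = u"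
    and y: "y \<in> Yspace \<infinity>"
  shows "\<exists>x\<in>Yspace \<infinity>. wiener_op l c x = y"
proof -
  let ?y = "\<lambda>n :: nat. restrict_to (cube 0 (int n)) y"
  have "\<exists>x\<in>Yspace \<infinity>. wiener_op l c x = ?y n" for n
    by (rule fin, rule finite_subset[OF _ finite_cube[of 0 "int n"]]) (auto simp: restrict_to_def)
  then obtain x where x: "\<And>n. x n \<in> Yspace \<infinity>" "\<And>n. wiener_op l c (x n) = ?y n" by metis
  have xb: "norm (x n m) \<le> C * Ynorm \<infinity> y" for n m
  proof -
    have "Ynorm \<infinity> (?y n) \<le> Ynorm \<infinity> y"
      by (rule Yspace_solid(2)[OF _ y]) (auto simp: restrict_to_def)
    then have "C * Ynorm \<infinity> (?y n) \<le> C * Ynorm \<infinity> y" using C0 by (rule mult_left_mono)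
    then show ?thesis using C[OF x(1)[of n]] norm_le_Ynorm[OF _ x(1), of n m] x(2)[of n] by simp
  qed
  obtain r z where r: "strict_mono r" "\<And>m. (\<lambda>n. x (r n) m) \<longlonglongrightarrow> z m" "\<And>m. norm (z m) \<le> C * Ynorm \<infinity> y"
    using pointwise_subseq[OF fd, of x, OF xb] by blast
  have "wiener_op l c z i = y i" for i
  proof -
    have "(\<lambda>n. wiener_op l c (x (r n)) i) \<longlonglongrightarrow> wiener_op l c z i"
      by (rule wiener_op_pointwise_limit[OF l xb r(2) tendsto_const])
    moreover have "(\<lambda>n. wiener_op l c (x (r n)) i) \<longlonglongrightarrow> y i"
    proof (rule tendsto_eventually)
      have "wiener_op l c (x (r n)) i = y i" if "nat (zabs i) \<le> n" for n
      proof -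
        have "zabs i \<le> int (r n)" using that seq_suble[OF r(1), of n] by linarith
        then show ?thesis using x(2)[of "r n"] by (simp only: restrict_to_def cube_def) simp
      qed
      then show "\<forall>\<^sub>F n in sequentially. wiener_op l c (x (r n)) i = y i"
        unfolding eventually_sequentially by blast
    qed
    ultimately show ?thesis by (rule LIMSEQ_unique)
  qed
  then show ?thesis using Yspace_infinityI(1)[of z, OF r(3)] by (intro bexI[of _ z]) auto
qed

text \<open>If images of \<open>x n\<close> approached \<open>u\<close>, then the \<open>x n\<close> would be bounded, and a pointwise limit of them
  would be a preimage of \<open>u\<close>.\<close>
lemma distance_from_range:
  fixes l c :: "int ^ 'n \<Rightarrow> 'u::{complex_normed_vector, banach} \<Rightarrow>\<^sub>L 'u"
  assumes fd: "finite_dimensional scaleC (UNIV :: 'u set)" and l: "wiener_symbol l" and c: "c \<in> linf_LU"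
    and C: "\<And>x. x \<in> Yspace \<infinity> \<Longrightarrow> Ynorm \<infinity> x \<le> C * Ynorm \<infinity> (wiener_op l c x)" and C0: "0 \<le> C"
    and u: "u \<in> Yspace \<infinity>" and nr: "\<not> (\<exists>x\<in>Yspace \<infinity>. wiener_op l c x = u)"
  shows "\<exists>d>0. \<forall>x\<in>Yspace \<infinity>. d \<le> Ynorm \<infinity> (u - wiener_op l c x)"
proof (rule ccontr)
  let ?W = "wiener_op l c"
  assume "\<not> (\<exists>d>0. \<forall>x\<in>Yspace \<infinity>. d \<le> Ynorm \<infinity> (u - ?W x))"
  from no_positive_bound_sequence[OF this] obtain x where x: "\<And>n. x n \<in> Yspace \<infinity>"
    and "\<And>n. \<not> inverse (real (Suc n)) \<le> Ynorm \<infinity> (u - ?W (x n))" by blast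
  then have xu: "Ynorm \<infinity> (u - ?W (x n)) < inverse (real (Suc n))" for n by (simp only: not_le)
  have Wx: "?W (x n) \<in> Yspace \<infinity>" for n by (rule wiener_op_Yspace[OF l c _ x]) simp
  have xb: "norm (x n m) \<le> C * (Ynorm \<infinity> u + 1)" for n m
  proof -
    have "Ynorm \<infinity> (u - (u - ?W (x n))) \<le> Ynorm \<infinity> u + Ynorm \<infinity> (u - ?W (x n))"
      by (intro Yspace_diff(2) Yspace_diff(1) u Wx) auto
    then have "Ynorm \<infinity> (?W (x n)) \<le> Ynorm \<infinity> u + inverse (real (Suc n))"
      using xu[of n] by (simp only: diff_diff_eq2 add_diff_cancel_left')
    also have "inverse (real (Suc n)) \<le> 1" by (simp add: inverse_le_1_iff)
    finally have "C * Ynorm \<infinity> (?W (x n)) \<le> C * (Ynorm \<infinity> u + 1)"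
      using C0 by (intro mult_left_mono) auto
    then show ?thesis using C[OF x, of n] norm_le_Ynorm[OF _ x, of n m] by simp
  qed
  obtain r z where r: "strict_mono r" "\<And>m. (\<lambda>n. x (r n) m) \<longlonglongrightarrow> z m" "\<And>m. norm (z m) \<le> C * (Ynorm \<infinity> u + 1)"
    using pointwise_subseq[OF fd, of x, OF xb] by blast
  have "?W z i = u i" for i
  proof -
    have "(\<lambda>n. ?W (x (r n)) i) \<longlonglongrightarrow> ?W z i"
      by (rule wiener_op_pointwise_limit[OF l xb r(2) tendsto_const])
    moreover have "(\<lambda>n. ?W (x (r n)) i) \<longlonglongrightarrow> u i"
    proof -
      have le: "norm (u i - ?W (x n) i) \<le> inverse (real (Suc n))" for n
        using norm_le_Ynorm[OF _ Yspace_diff(1)[OF _ u Wx], of n i] xu[of n] by simp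
      have "(\<lambda>n. ?W (x n) i) \<longlonglongrightarrow> u i"
        by (rule tendsto_from_bound[OF _ LIMSEQ_inverse_real_of_nat], subst norm_minus_commute, rule le)
      then show ?thesis by (rule LIMSEQ_subseq_LIMSEQ[OF _ r(1), unfolded o_def])
    qed
    ultimately show ?thesis by (rule LIMSEQ_unique)
  qed
  then show False using nr Yspace_infinityI(1)[of z, OF r(3)] by (auto simp: fun_eq_iff)
qed

section \<open>Almost periodicity\<close>

text \<open>The function \<open>c\<close> is a uniform limit of translates of \<open>b\<close>. Only a single approximation for each \<open>e\<close>
  is recorded, which makes the symmetry of the relation evident.\<close>
definition in_hull :: "(int ^ 'n \<Rightarrow> 'a::real_normed_vector) \<Rightarrow> (int ^ 'n \<Rightarrow> 'a) \<Rightarrow> bool"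
  where "in_hull b c \<longleftrightarrow> (\<forall>e>0. \<exists>k. \<forall>m. norm (b (m + k) - c m) \<le> e)"

text \<open>The next two notions are the sequential and the quantitative form of almost periodicity: every
  sequence of translates has a uniformly convergent subsequence, and every cube of a certain size
  contains an almost period.\<close>
definition bochner_normal :: "(int ^ 'n \<Rightarrow> 'u::complex_normed_vector \<Rightarrow>\<^sub>L 'u) \<Rightarrow> bool"
  where "bochner_normal b \<longleftrightarrow> (\<forall>k :: nat \<Rightarrow> int ^ 'n. \<exists>r. \<exists>d\<in>linf_LU. strict_mono r \<and>
    (\<forall>e>0. \<forall>\<^sub>F n in sequentially. \<forall>m. norm (b (m + k (r n)) - d m) \<le> e))"

definition relatively_dense_periods :: "(int ^ 'n \<Rightarrow> 'a::real_normed_vector) \<Rightarrow> bool"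
  where "relatively_dense_periods b \<longleftrightarrow>
    (\<forall>e>0. \<exists>D. \<forall>a. \<exists>k. zabs (k - a) \<le> D \<and> (\<forall>m. norm (b (m + k) - b m) \<le> e))"

definition ap_function :: "(int ^ 'n \<Rightarrow> 'u::complex_normed_vector \<Rightarrow>\<^sub>L 'u) \<Rightarrow> bool"
  where "ap_function b \<longleftrightarrow> b \<in> linf_LU \<and> bochner_normal b \<and> relatively_dense_periods b"

lemma in_hull_refl: "in_hull b b"
  unfolding in_hull_def by (auto intro!: exI[of _ 0])

lemma in_hull_limit:
  assumes "\<And>e. 0 < e \<Longrightarrow> \<forall>\<^sub>F n in sequentially. \<forall>m. norm (b (m + k n) - d m) \<le> e"
  shows "in_hull b d"
  unfolding in_hull_def
proof (intro allI impI)
  fix e :: real assume "0 < e"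
  then have "\<forall>\<^sub>F n in sequentially. \<forall>m. norm (b (m + k n) - d m) \<le> e" by (rule assms)
  then have "\<exists>n. \<forall>m. norm (b (m + k n) - d m) \<le> e" by (rule eventually_happens'[OF sequentially_bot])
  then show "\<exists>k. \<forall>m. norm (b (m + k) - d m) \<le> e" by blast
qed

lemma in_hull_sym: assumes "in_hull b c" shows "in_hull c b"
  unfolding in_hull_def
proof (intro allI impI)
  fix e :: real assume "0 < e"
  then obtain k where k: "\<And>m. norm (b (m + k) - c m) \<le> e" using assms by (auto simp: in_hull_def)
  have "norm (c (m + - k) - b m) \<le> e" for m
    using k[of "m - k"] by (simp add: norm_minus_commute)
  then show "\<exists>k. \<forall>m. norm (c (m + k) - b m) \<le> e" by blast
qed

lemma in_hull_trans: assumes "in_hull b c" "in_hull c d" shows "in_hull b d"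
  unfolding in_hull_def
proof (intro allI impI)
  fix e :: real assume "0 < e"
  then obtain k j where k: "\<And>m. norm (b (m + k) - c m) \<le> e / 2"
    and j: "\<And>m. norm (c (m + j) - d m) \<le> e / 2"
    using assms unfolding in_hull_def by (meson half_gt_zero)
  have "norm (b (m + (j + k)) - d m) \<le> e" for m
    using norm_triangle_le[of "b (m + (j + k)) - c (m + j)" "c (m + j) - d m" e]
      k[of "m + j"] j[of m] by (simp add: add.assoc)
  then show "\<exists>k. \<forall>m. norm (b (m + k) - d m) \<le> e" by blast
qed

text \<open>For a sequence of translates of \<open>c\<close>, replace each by a translate of \<open>b\<close> with an error that tends to
  0. An almost period of \<open>b\<close> is one of \<open>c\<close>, with three times the error.\<close>
lemma ap_function_in_hull:
  assumes b: "ap_function b" and c: "c \<in> linf_LU" and hull: "in_hull b c"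
  shows "ap_function c"
  unfolding ap_function_def
proof (intro conjI c)
  show "bochner_normal c" unfolding bochner_normal_def
  proof
    fix k :: "nat \<Rightarrow> int ^ 'a"
    have "\<exists>h. \<forall>m. norm (c (m + h) - b m) \<le> inverse (real (Suc n))" for n
      using in_hull_sym[OF hull] by (simp add: in_hull_def)
    then obtain h where h: "\<And>n m. norm (c (m + h n) - b m) \<le> inverse (real (Suc n))" by metis
    obtain r d where r: "d \<in> linf_LU" "strict_mono r"
      and d: "\<And>e. 0 < e \<Longrightarrow> \<forall>\<^sub>F n in sequentially. \<forall>m. norm (b (m + (k (r n) - h (r n))) - d m) \<le> e"
      using b unfolding ap_function_def bochner_normal_def by (elim conjE allE[of _ "\<lambda>n. k n - h n"]) auto
    have "\<forall>\<^sub>F n in sequentially. \<forall>m. norm (c (m + k (r n)) - d m) \<le> e" if e: "0 < e" for e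
    proof -
      have "\<forall>\<^sub>F n in sequentially. inverse (real (Suc n)) < e / 2"
        using LIMSEQ_inverse_real_of_nat e by (intro order_tendstoD(2)) auto
      moreover have "\<forall>\<^sub>F n in sequentially. \<forall>m. norm (b (m + (k (r n) - h (r n))) - d m) \<le> e / 2"
        by (rule d) (use e in simp)
      ultimately show ?thesis
      proof eventually_elim
        case (elim n)
        show ?case
        proof
          fix m
          have "inverse (real (Suc (r n))) \<le> inverse (real (Suc n))"
            using seq_suble[OF r(2), of n] by (simp add: le_imp_inverse_le)
          then have "norm (c (m + (k (r n) - h (r n)) + h (r n)) - b (m + (k (r n) - h (r n)))) \<le> e / 2"
            using h[of "m + (k (r n) - h (r n))" "r n"] elim(1) by linarith
          moreover have "norm (b (m + (k (r n) - h (r n))) - d m) \<le> e / 2" using elim(2) by blast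
          ultimately show "norm (c (m + k (r n)) - d m) \<le> e"
            using norm_triangle_le[of "c (m + k (r n)) - b (m + (k (r n) - h (r n)))"
                "b (m + (k (r n) - h (r n))) - d m" e] by simp
        qed
      qed
    qed
    then show "\<exists>r. \<exists>d\<in>linf_LU. strict_mono r \<and>
        (\<forall>e>0. \<forall>\<^sub>F n in sequentially. \<forall>m. norm (c (m + k (r n)) - d m) \<le> e)"
      using r by blast
  qed
  show "relatively_dense_periods c" unfolding relatively_dense_periods_def
  proof (intro allI impI)
    fix e :: real assume e: "0 < e"
    obtain h where h: "\<And>m. norm (b (m + h) - c m) \<le> e / 3"
      using hull e unfolding in_hull_def by (meson divide_pos_pos zero_less_numeral)
    obtain D where D: "\<And>a. \<exists>k. zabs (k - a) \<le> D \<and> (\<forall>m. norm (b (m + k) - b m) \<le> e / 3)"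
      using b e unfolding ap_function_def relatively_dense_periods_def by (meson divide_pos_pos zero_less_numeral)
    have "norm (c (m + k) - c m) \<le> e" if k: "\<forall>m. norm (b (m + k) - b m) \<le> e / 3" for k m
    proof -
      have "norm (c (m + k) - b (m + k + h)) \<le> e / 3"
        using h[of "m + k"] by (simp add: norm_minus_commute)
      moreover have "norm (b (m + h + k) - b (m + h)) \<le> e / 3" using k by blast
      moreover have "norm (b (m + h) - c m) \<le> e / 3" by (rule h)
      ultimately have "norm ((c (m + k) - b (m + k + h)) + (b (m + h + k) - b (m + h)) + (b (m + h) - c m)) \<le> e"
        using norm_triangle_ineq[of "(c (m + k) - b (m + k + h)) + (b (m + h + k) - b (m + h))" "b (m + h) - c m"]
          norm_triangle_ineq[of "c (m + k) - b (m + k + h)" "b (m + h + k) - b (m + h)"] by linarith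
      then show ?thesis by (simp add: ac_simps)
    qed
    then show "\<exists>D. \<forall>a. \<exists>k. zabs (k - a) \<le> D \<and> (\<forall>m. norm (c (m + k) - c m) \<le> e)"
      by (intro exI[of _ D] allI) (use D in blast)
  qed
qed

lemma norm_le_linf_dist:
  fixes b c :: "int ^ 'n \<Rightarrow> 'u::complex_normed_vector \<Rightarrow>\<^sub>L 'u"
  assumes "b \<in> linf_LU" "c \<in> linf_LU" shows "norm (b m - c m) \<le> linf_dist b c"
proof -
  obtain B C where BC: "\<And>m. norm (b m) \<le> B" "\<And>m. norm (c m) \<le> C"
    using assms linf_LU_bound by metis
  have "norm (b m - c m) \<le> B + C" for m
    using norm_triangle_ineq4[of "b m" "c m"] BC(1)[of m] BC(2)[of m] by linarith
  then have "bdd_above (range (\<lambda>m. norm (b m - c m)))" by (auto simp: bdd_above_def)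
  from cSUP_upper[OF _ this, of m] assms show ?thesis by (simp add: linf_dist_def)
qed

lemma shift_linf: "b \<in> linf_LU \<Longrightarrow> (\<lambda>m. b (m + k)) \<in> linf_LU"
  unfolding linf_LU_def by (auto simp: bounded_iff)

text \<open>Sequential compactness of the closure of the translates gives convergent subsequences. Total
  boundedness gives finitely many translates such that every translate by \<open>a\<close> is close to one of them;
  the difference of the two translations is an almost period near \<open>a\<close>.\<close>
lemma almost_periodic_imp_ap_function:
  fixes b :: "int ^ 'n \<Rightarrow> 'u::complex_normed_vector \<Rightarrow>\<^sub>L 'u"
  assumes b: "b \<in> linf_LU" and alm: "almost_periodic b"
  shows "ap_function b"
proof -
  interpret M: Metric_space "linf_LU :: (int ^ 'n \<Rightarrow> 'u \<Rightarrow>\<^sub>L 'u) set" linf_dist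
    by (rule Metric_space_linf)
  define T where "T = {\<lambda>m. b (m - k) | k. True}"
  have TL: "T \<subseteq> linf_LU" using shift_linf[OF b, of "- k" for k] by (auto simp: T_def)
  have comp: "compactin M.mtopology (M.mtopology closure_of T)"
    using alm by (simp add: almost_periodic_def T_def)
  have sub: "T \<subseteq> M.mtopology closure_of T" using TL by (intro closure_of_subset) simp
  have T: "(\<lambda>m. b (m + k)) \<in> T" for k
    unfolding T_def using minus_minus[of k] by (intro CollectI exI[of _ "- k"]) auto
  have "bochner_normal b" unfolding bochner_normal_def
  proof
    fix k :: "nat \<Rightarrow> int ^ 'n"
    let ?s = "\<lambda>n m. b (m + k n)"
    have "range ?s \<subseteq> M.mtopology closure_of T" using T sub by blast
    then obtain d r where d: "d \<in> M.mtopology closure_of T" "strict_mono r"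
      and lim: "limitin M.mtopology (?s \<circ> r) d sequentially"
      using comp unfolding M.compactin_sequentially by meson
    have dL: "d \<in> linf_LU" using d closure_of_subset_topspace[of M.mtopology T] by auto
    have "\<forall>\<^sub>F n in sequentially. \<forall>m. norm (b (m + k (r n)) - d m) \<le> e" if e: "0 < e" for e
    proof -
      have "\<forall>\<^sub>F n in sequentially. (?s \<circ> r) n \<in> linf_LU \<and> linf_dist ((?s \<circ> r) n) d < e"
        using lim e by (auto simp: M.limitin_metric)
      then show ?thesis
      proof eventually_elim
        case (elim n)
        then show ?case using norm_le_linf_dist[of "(?s \<circ> r) n" d] dL by (auto intro: order_trans less_imp_le)
      qed
    qed
    then show "\<exists>r. \<exists>d\<in>linf_LU. strict_mono r \<and>
        (\<forall>e>0. \<forall>\<^sub>F n in sequentially. \<forall>m. norm (b (m + k (r n)) - d m) \<le> e)"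
      using d dL by blast
  qed
  moreover have "relatively_dense_periods b" unfolding relatively_dense_periods_def
  proof (intro allI impI)
    fix e :: real assume e: "0 < e"
    have "M.mtotally_bounded (M.mtopology closure_of T)"
      using comp by (rule M.compactin_imp_mtotally_bounded)
    then have "M.mtotally_bounded T" using M.mtotally_bounded_subset sub by blast
    from this[unfolded M.mtotally_bounded_def, rule_format, OF e]
    obtain F where F: "finite F" "F \<subseteq> T" "T \<subseteq> (\<Union>x\<in>F. M.mball x e)" by auto
    have "\<exists>k. f = (\<lambda>m. b (m - k))" if "f \<in> F" for f
      using subsetD[OF F(2) that] by (simp add: T_def)
    then obtain \<kappa> where \<kappa>: "\<And>f. f \<in> F \<Longrightarrow> f = (\<lambda>m. b (m - \<kappa> f))" by metis
    define D where "D = (\<Sum>f\<in>F. zabs (\<kappa> f))"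
    have "\<exists>k. zabs (k - a) \<le> D \<and> (\<forall>m. norm (b (m + k) - b m) \<le> e)" for a
    proof -
      obtain f where f: "f \<in> F" "(\<lambda>m. b (m + a)) \<in> M.mball f e" using T F(3) by blast
      then have fa: "norm (f m - b (m + a)) \<le> e" for m
        using norm_le_linf_dist[of f "\<lambda>m. b (m + a)" m] by auto
      have "norm (b (m + (a + \<kappa> f)) - b m) \<le> e" for m
      proof -
        have "f (m + \<kappa> f) = b m" by (subst \<kappa>[OF f(1)]) simp
        moreover have "m + (a + \<kappa> f) = m + \<kappa> f + a" by (simp add: ac_simps)
        ultimately show ?thesis
          using fa[of "m + \<kappa> f"] by (simp only: norm_minus_commute)
      qed
      moreover have "zabs (\<kappa> f) \<le> D" unfolding D_def
        by (rule member_le_sum) (use F(1) f(1) in auto)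
      ultimately show ?thesis by (intro exI[of _ "a + \<kappa> f"]) simp
    qed
    then show "\<exists>D. \<forall>a. \<exists>k. zabs (k - a) \<le> D \<and> (\<forall>m. norm (b (m + k) - b m) \<le> e)" by blast
  qed
  ultimately show ?thesis using b by (simp add: ap_function_def)
qed

text \<open>A pointwise limit of translates is the uniform limit of a subsequence. Conversely, an almost period
  of large modulus can be added to each translation without leaving the neighbourhood of \<open>c\<close>, and so the
  translations can be made to tend to infinity.\<close>
lemma Lim_set_eq_hull:
  fixes b :: "int ^ 'n \<Rightarrow> 'u::complex_normed_vector \<Rightarrow>\<^sub>L 'u"
  assumes b: "ap_function b"
  shows "Lim_set b = {c \<in> linf_LU. in_hull b c}"
proof (intro equalityI subsetI)
  fix c assume "c \<in> Lim_set b"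
  then obtain h :: "nat \<Rightarrow> int ^ 'n" where c: "c \<in> linf_LU" and h: "\<And>m. (\<lambda>n. b (m + h n)) \<longlonglongrightarrow> c m"
    by (auto simp: Lim_set_def)
  obtain r d where r: "strict_mono r"
    and d: "\<And>e. 0 < e \<Longrightarrow> \<forall>\<^sub>F n in sequentially. \<forall>m. norm (b (m + h (r n)) - d m) \<le> e"
    using b unfolding ap_function_def bochner_normal_def by blast
  have "d = c"
  proof (rule ext, rule LIMSEQ_unique)
    fix m
    show "(\<lambda>n. b (m + h (r n))) \<longlonglongrightarrow> c m"
      using LIMSEQ_subseq_LIMSEQ[OF h r] by (simp add: o_def)
    show "(\<lambda>n. b (m + h (r n))) \<longlonglongrightarrow> d m"
      by (rule uniformly_tendsto_at[of "\<lambda>n m. b (m + h (r n))", OF d])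
  qed
  moreover have "in_hull b d" by (rule in_hull_limit[of b "\<lambda>n. h (r n)", OF d])
  ultimately have "in_hull b c" by simp
  then show "c \<in> {c \<in> linf_LU. in_hull b c}" using c by simp
next
  fix c assume "c \<in> {c \<in> linf_LU. in_hull b c}"
  then have c: "c \<in> linf_LU" "in_hull b c" by auto
  have "\<exists>k. int n \<le> zabs k \<and> (\<forall>m. norm (b (m + k) - c m) \<le> inverse (real (Suc n)))" for n
  proof -
    let ?e = "inverse (real (Suc n)) / 2"
    have e: "0 < ?e" by simp
    obtain k where k: "\<And>m. norm (b (m + k) - c m) \<le> ?e" using c(2) e unfolding in_hull_def by blast
    obtain D where D: "\<And>a. \<exists>g. zabs (g - a) \<le> D \<and> (\<forall>m. norm (b (m + g) - b m) \<le> ?e)"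
      using b e unfolding ap_function_def relatively_dense_periods_def by blast
    \<comment> \<open>far enough out that \<open>k + g\<close> has modulus at least \<open>n\<close> for every \<open>g\<close> within distance \<open>D\<close> of \<open>a\<close>\<close>
    define a :: "int ^ 'n" where "a = (\<chi> i. int n + \<bar>D\<bar> + zabs k)"
    obtain g where g: "zabs (g - a) \<le> D" "\<And>m. norm (b (m + g) - b m) \<le> ?e" using D by blast
    have "norm (b (m + (k + g)) - c m) \<le> inverse (real (Suc n))" for m
      using norm_triangle_le[of "b (m + k + g) - b (m + k)" "b (m + k) - c m" "inverse (real (Suc n))"]
        k[of m] g(2)[of "m + k"] by (simp add: add.assoc)
    moreover have "int n \<le> zabs (k + g)"
    proof -
      have "zabs a \<le> zabs (a - g) + zabs (g + k) + zabs k"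
        using zabs_triangle[of "a - g" "g"] zabs_triangle[of "g + k" "- k"] by simp
      moreover have "int n + \<bar>D\<bar> + zabs k \<le> zabs a"
        using abs_component_le_zabs[of a undefined] by (simp add: a_def)
      ultimately show ?thesis using g(1) zabs_minus_commute[of a g] by (simp add: add.commute)
    qed
    ultimately show ?thesis by blast
  qed
  then obtain h where h: "\<And>n. int n \<le> zabs (h n)" "\<And>n m. norm (b (m + h n) - c m) \<le> inverse (real (Suc n))"
    by metis
  have "filterlim (\<lambda>n. zabs (h n)) at_top sequentially"
    unfolding filterlim_at_top eventually_sequentially
  proof (intro allI exI impI)
    fix Z n assume "nat Z \<le> n"
    then show "Z \<le> zabs (h n)" using h(1)[of n] by linarith
  qed
  moreover have "(\<lambda>n. b (m + h n)) \<longlonglongrightarrow> c m" for m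
    by (rule tendsto_from_bound[OF _ LIMSEQ_inverse_real_of_nat], rule h(2))
  ultimately show "c \<in> Lim_set b" using c(1) by (auto simp: Lim_set_def)
qed

text \<open>Otherwise there are almost null vectors, which can be normalised and translated to be large at the
  origin. Along a subsequence the translated coefficients converge uniformly to a member \<open>d\<close> of the hull
  and the vectors pointwise to a nonzero vector in the kernel of \<open>wiener_op l d\<close>.\<close>
lemma injective_imp_bounded_below:
  fixes l b :: "int ^ 'n \<Rightarrow> 'u::{complex_normed_vector, banach} \<Rightarrow>\<^sub>L 'u"
  assumes fd: "finite_dimensional scaleC (UNIV :: 'u set)" and l: "wiener_symbol l" and b: "ap_function b"
    and inj: "\<And>c x. c \<in> linf_LU \<Longrightarrow> in_hull b c \<Longrightarrow> x \<in> Yspace \<infinity> \<Longrightarrow> wiener_op l c x = 0 \<Longrightarrow> x = 0"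
  shows "\<exists>nu>0. \<forall>x\<in>Yspace \<infinity>. nu * Ynorm \<infinity> x \<le> Ynorm \<infinity> (wiener_op l b x)"
proof (rule ccontr)
  assume neg: "\<not> (\<exists>nu>0. \<forall>x\<in>Yspace \<infinity>. nu * Ynorm \<infinity> x \<le> Ynorm \<infinity> (wiener_op l b x))"
  from no_positive_bound_sequence[OF neg] obtain x0 where x0: "\<And>n. x0 n \<in> Yspace \<infinity>"
    and x0W: "\<And>n. \<not> inverse (real (Suc n)) * Ynorm \<infinity> (x0 n) \<le> Ynorm \<infinity> (wiener_op l b (x0 n))"
    by blast
  have bL: "b \<in> linf_LU" using b by (simp add: ap_function_def)
  \<comment> \<open>an almost null vector, normalised and translated so that it is large at the origin\<close>
  have "\<exists>x k. x \<in> Yspace \<infinity> \<and> (\<forall>m. norm (x m) \<le> 2) \<and> 1 \<le> norm (x 0) \<and>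
      (\<forall>m. norm (wiener_op l (shift k b) x m) \<le> 2 * inverse (real (Suc n)))" for n
  proof -
    let ?e = "inverse (real (Suc n))"
    define x where "x = x0 n"
    have x: "x \<in> Yspace \<infinity>" and less: "Ynorm \<infinity> (wiener_op l b x) < ?e * Ynorm \<infinity> x"
      using x0[of n] x0W[of n] by (simp_all only: x_def not_le)
    have Wx: "wiener_op l b x \<in> Yspace \<infinity>" by (rule wiener_op_Yspace[OF l bL _ x]) simp
    have pos: "0 < Ynorm \<infinity> x"
    proof (rule ccontr)
      assume "\<not> 0 < Ynorm \<infinity> x"
      then have "?e * Ynorm \<infinity> x \<le> 0" by (intro mult_nonneg_nonpos) auto
      then show False using less Ynorm_nonneg[OF _ Wx] by simp
    qed
    obtain k where k: "Ynorm \<infinity> x / 2 < norm (x k)"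
    proof (rule ccontr)
      assume "\<not> thesis"
      then have "norm (x k) \<le> Ynorm \<infinity> x / 2" for k using that[of k] by (meson not_less)
      then have "Ynorm \<infinity> x \<le> Ynorm \<infinity> x / 2" by (rule Yspace_infinityI(2))
      then show False using pos by simp
    qed
    define a where "a = complex_of_real (2 / Ynorm \<infinity> x)"
    define y where "y = cscale a (shift k x)"
    have sx: "shift k x \<in> Yspace \<infinity>" using Yspace_shift[OF _ x] by simp
    have y: "y \<in> Yspace \<infinity>" unfolding y_def by (rule Yspace_cscale(1)[OF _ sx]) simp
    have na: "cmod a = 2 / Ynorm \<infinity> x" unfolding a_def norm_of_real using pos by simp
    have "norm (y m) \<le> 2" for m
      using norm_le_Ynorm[OF _ x, of "m + k"] pos
      by (simp add: y_def cscale_def shift_def norm_scaleC na field_simps)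
    moreover have "1 \<le> norm (y 0)"
      using k pos by (simp add: y_def cscale_def shift_def norm_scaleC na field_simps)
    moreover have "norm (wiener_op l (shift k b) y m) \<le> 2 * ?e" for m
    proof -
      have sb: "shift k b \<in> linf_LU" using shift_linf[OF bL] by (simp add: shift_def)
      have "wiener_op l (shift k b) y = cscale a (shift k (wiener_op l b x))"
        unfolding y_def wiener_op_cscale[OF l sb sx] wiener_op_shift ..
      then have "norm (wiener_op l (shift k b) y m) = cmod a * norm (wiener_op l b x (m + k))"
        by (simp only: cscale_def shift_def norm_scaleC)
      also have "\<dots> \<le> cmod a * (?e * Ynorm \<infinity> x)"
        using norm_le_Ynorm[OF _ Wx, of "m + k"] less by (intro mult_left_mono) auto
      also have "\<dots> = 2 * ?e" using pos by (simp add: na)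
      finally show ?thesis .
    qed
    ultimately show ?thesis using y by blast
  qed
  then obtain x k where x: "\<And>n. x n \<in> Yspace \<infinity>" "\<And>n m. norm (x n m) \<le> 2" "\<And>n. 1 \<le> norm (x n 0)"
    and Wx: "\<And>n m. norm (wiener_op l (shift (k n) b) (x n) m) \<le> 2 * inverse (real (Suc n))"
    by metis
  obtain r d where r: "strict_mono r" "d \<in> linf_LU"
    and d: "\<And>e. 0 < e \<Longrightarrow> \<forall>\<^sub>F n in sequentially. \<forall>m. norm (b (m + k (r n)) - d m) \<le> e"
    using b unfolding ap_function_def bochner_normal_def by blast
  have nd: "in_hull b d" by (rule in_hull_limit[of b "\<lambda>n. k (r n)", OF d])
  obtain s y where s: "strict_mono s" "\<And>m. (\<lambda>n. x (r (s n)) m) \<longlonglongrightarrow> y m" "\<And>m. norm (y m) \<le> 2"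
    using pointwise_subseq[OF fd, of "\<lambda>n. x (r n)" 2] x(2) by blast
  have lim_b: "(\<lambda>n. shift (k (r (s n))) b m) \<longlonglongrightarrow> d m" for m
  proof -
    have "(\<lambda>n. b (m + k (r n))) \<longlonglongrightarrow> d m"
      by (rule uniformly_tendsto_at[of "\<lambda>n m. b (m + k (r n))", OF d])
    then show ?thesis
      unfolding shift_def by (rule LIMSEQ_subseq_LIMSEQ[OF _ s(1), unfolded o_def])
  qed
  have "wiener_op l d y i = 0" for i
  proof (rule LIMSEQ_unique)
    show "(\<lambda>n. wiener_op l (shift (k (r (s n))) b) (x (r (s n))) i) \<longlonglongrightarrow> wiener_op l d y i"
      by (rule wiener_op_pointwise_limit[OF l x(2) s(2) lim_b])
    have "(\<lambda>n. wiener_op l (shift (k n) b) (x n) i) \<longlonglongrightarrow> 0"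
      by (rule tendsto_from_bound[OF _ tendsto_mult_right_zero[OF LIMSEQ_inverse_real_of_nat]],
          subst diff_zero, rule Wx)
    then show "(\<lambda>n. wiener_op l (shift (k (r (s n))) b) (x (r (s n))) i) \<longlonglongrightarrow> 0"
      by (rule LIMSEQ_subseq_LIMSEQ[OF _ strict_mono_o[OF r(1) s(1)], unfolded o_def])
  qed
  then have "wiener_op l d y = 0" by (simp add: fun_eq_iff)
  moreover have "y \<in> Yspace \<infinity>" by (rule Yspace_infinityI(1)[OF s(3)])
  ultimately have "y = 0" using inj[OF r(2) nd, of y] by blast
  moreover have "1 \<le> norm (y 0)"
    by (rule LIMSEQ_le_const[OF tendsto_norm[OF s(2)[of 0]]]) (simp add: x(3))
  ultimately show False by simp
qed

lemma support_radius:
  fixes u :: "int ^ 'n \<Rightarrow> 'a::zero"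
  assumes "finite {m. u m \<noteq> 0}"
  obtains \<rho> :: nat where "\<And>m. u m \<noteq> 0 \<Longrightarrow> zabs m \<le> int \<rho>"
proof (rule that)
  fix m assume "u m \<noteq> 0"
  then show "zabs m \<le> int (\<Sum>m\<in>{m. u m \<noteq> 0}. nat (zabs m))"
    using member_le_sum[of m "{m. u m \<noteq> 0}" "\<lambda>m. nat (zabs m)"] assms by (simp add: nat_le_iff)
qed

text \<open>An almost period is chosen near each point of the family \<open>g\<close>. The constant \<open>D\<close> is fixed before the
  family, so that the spacing of \<open>g\<close> can be adapted to it.\<close>
lemma separated_periods:
  fixes b :: "int ^ 'n \<Rightarrow> 'a::real_normed_vector"
  assumes b: "relatively_dense_periods b" and e: "0 < e"
  obtains D :: nat where "\<And>(g :: 'j \<Rightarrow> int ^ 'n) R.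
    \<forall>i j. i \<noteq> j \<longrightarrow> int (2 * D + R + 1) \<le> zabs (g i - g j) \<Longrightarrow>
    \<exists>\<kappa>. (\<forall>j. zabs (\<kappa> j - g j) \<le> int D) \<and> (\<forall>j m. norm (b (m + \<kappa> j) - b m) \<le> e) \<and>
      (\<forall>i j. i \<noteq> j \<longrightarrow> int R < zabs (\<kappa> i - \<kappa> j))"
proof -
  obtain D0 where D0: "\<And>a. \<exists>k. zabs (k - a) \<le> D0 \<and> (\<forall>m. norm (b (m + k) - b m) \<le> e)"
    using b e unfolding relatively_dense_periods_def by blast
  show ?thesis
  proof (rule that)
    fix g :: "'j \<Rightarrow> int ^ 'n" and R
    assume g: "\<forall>i j. i \<noteq> j \<longrightarrow> int (2 * nat D0 + R + 1) \<le> zabs (g i - g j)"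
    have "\<exists>k. zabs (k - g j) \<le> int (nat D0) \<and> (\<forall>m. norm (b (m + k) - b m) \<le> e)" for j
    proof -
      obtain k where k: "zabs (k - g j) \<le> D0" "\<forall>m. norm (b (m + k) - b m) \<le> e"
        using D0 by blast
      then have "0 \<le> D0" using zabs_nonneg order_trans by blast
      then show ?thesis using k by auto
    qed
    then obtain \<kappa> where \<kappa>: "\<And>j. zabs (\<kappa> j - g j) \<le> int (nat D0)" "\<And>j m. norm (b (m + \<kappa> j) - b m) \<le> e"
      by metis
    have "int R < zabs (\<kappa> i - \<kappa> j)" if "i \<noteq> j" for i j
      using g[rule_format, OF that] \<kappa>(1)[of i] \<kappa>(1)[of j] zabs_minus_commute[of "g i" "\<kappa> i"]
        zabs_diff_triangle[of "g i" "g j" "\<kappa> i"] zabs_diff_triangle[of "\<kappa> i" "g j" "\<kappa> j"] by simp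
    then show "\<exists>\<kappa>. (\<forall>j. zabs (\<kappa> j - g j) \<le> int (nat D0)) \<and> (\<forall>j m. norm (b (m + \<kappa> j) - b m) \<le> e) \<and>
        (\<forall>i j. i \<noteq> j \<longrightarrow> int R < zabs (\<kappa> i - \<kappa> j))"
      by (intro exI[of _ \<kappa>] conjI allI impI \<kappa>) simp
  qed
qed

section \<open>Surjectivity by counting dimensions\<close>

lemma exists_max_cmod:
  assumes "finite F" "F \<noteq> {}"
  obtains j where "j \<in> F" "\<And>i. i \<in> F \<Longrightarrow> cmod (a i) \<le> cmod (a j)"
proof -
  have "Max ((\<lambda>j. cmod (a j)) ` F) \<in> (\<lambda>j. cmod (a j)) ` F"
    using assms by (intro Max_in) auto
  then obtain j where "j \<in> F" "Max ((\<lambda>j. cmod (a j)) ` F) = cmod (a j)" by auto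
  then show ?thesis using that[of j] assms(1) Max_ge[of "(\<lambda>j. cmod (a j)) ` F"] by auto
qed

context vector_space
begin

text \<open>The relation is indexed by \<open>X\<close> instead of the set of vectors, since the family may have repetitions.\<close>
lemma exists_nontrivial_relation:
  assumes X: "finite X" and t: "finite t" "card t < card X" and v: "v ` X \<subseteq> span t"
  obtains a where "\<exists>i\<in>X. a i \<noteq> 0" "(\<Sum>i\<in>X. scale (a i) (v i)) = 0"
proof (cases "inj_on v X")
  case True
  have "dependent (v ` X)"
    using independent_span_bound[OF t(1) _ v] t(2) card_image[OF True] by auto
  then obtain u where u: "\<exists>w\<in>v ` X. u w \<noteq> 0" "(\<Sum>w\<in>v ` X. scale (u w) w) = 0"
    using dependent_finite[of "v ` X"] X by auto
  have "(\<Sum>i\<in>X. scale (u (v i)) (v i)) = 0"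
    using u(2) by (simp add: sum.reindex[OF True])
  then show ?thesis using that[of "\<lambda>i. u (v i)"] u(1) by blast
next
  case False
  then obtain i j where ij: "i \<in> X" "j \<in> X" "i \<noteq> j" "v i = v j" by (auto simp: inj_on_def)
  define a where "a = (\<lambda>k. if k = i then 1 else if k = j then -1 else 0 :: 'a)"
  have "(\<Sum>k\<in>X. scale (a k) (v k)) = (\<Sum>k\<in>{i, j}. scale (a k) (v k))"
    using X ij by (intro sum.mono_neutral_right) (auto simp: a_def)
  also have "\<dots> = 0" using ij by (simp add: a_def)
  finally have "(\<Sum>k\<in>X. scale (a k) (v k)) = 0" .
  moreover have "a i \<noteq> 0" by (simp add: a_def)
  ultimately show ?thesis using that[of a] ij(1) by blast
qed

end

definition single :: "'i \<Rightarrow> 'u \<Rightarrow> 'i \<Rightarrow> 'u::zero"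
  where "single m e = (\<lambda>i. if i = m then e else 0)"

lemma sum_fun_apply: "(\<Sum>k\<in>F. f k) i = (\<Sum>k\<in>F. f k i)"
  for f :: "'k \<Rightarrow> 'i \<Rightarrow> 'u::comm_monoid_add"
  by (induction F rule: infinite_finite_induct) auto

lemma finite_support_in_span:
  fixes y :: "'i \<Rightarrow> 'u::complex_normed_vector"
  assumes B: "finite B" "sc.span B = UNIV" and M: "finite M" and y: "\<And>i. i \<notin> M \<Longrightarrow> y i = 0"
  shows "y \<in> cs.span ((\<lambda>(m, e). single m e) ` (M \<times> B))"
proof -
  have "\<exists>a. y m = (\<Sum>e\<in>B. a e *\<^sub>C e)" for m
  proof -
    have "y m \<in> range (\<lambda>a. \<Sum>e\<in>B. a e *\<^sub>C e)" using B(2) sc.span_finite[OF B(1)] by simp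
    then show ?thesis by blast
  qed
  then obtain a where a: "\<And>m. y m = (\<Sum>e\<in>B. a m e *\<^sub>C e)" by metis
  have "y = (\<Sum>m\<in>M. \<Sum>e\<in>B. cscale (a m e) (single m e))"
  proof
    fix i
    have "(\<Sum>m\<in>M. \<Sum>e\<in>B. cscale (a m e) (single m e)) i
        = (\<Sum>m\<in>M. if i = m then (\<Sum>e\<in>B. a m e *\<^sub>C e) else 0)"
      unfolding sum_fun_apply by (intro sum.cong) (auto simp: cscale_def single_def)
    also have "\<dots> = y i" using M y[of i] by (simp add: sum.delta' a)
    finally show "y i = (\<Sum>m\<in>M. \<Sum>e\<in>B. cscale (a m e) (single m e)) i" by simp
  qed
  also have "\<dots> \<in> cs.span ((\<lambda>(m, e). single m e) ` (M \<times> B))"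
    by (intro cs.span_sum cs.span_scale cs.span_base) auto
  finally show ?thesis .
qed

definition truncate_symbol :: "nat \<Rightarrow> (int ^ 'n \<Rightarrow> 'u::complex_normed_vector \<Rightarrow>\<^sub>L 'u) \<Rightarrow> int ^ 'n \<Rightarrow> 'u \<Rightarrow>\<^sub>L 'u"
  where "truncate_symbol w l = (\<lambda>k. if zabs k \<le> int w then l k else 0)"

lemma wiener_symbol_truncate:
  assumes l: "wiener_symbol l" shows "wiener_symbol (truncate_symbol w l)"
proof -
  have "(0 :: 'b \<Rightarrow>\<^sub>L 'b) \<in> LU" by (simp add: LU_def)
  moreover have "(\<lambda>k. norm (truncate_symbol w l k)) summable_on UNIV"
    by (rule summable_on_comparison_test[of "\<lambda>k. norm (l k)"])
      (use l in \<open>auto simp: wiener_symbol_def truncate_symbol_def\<close>)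
  ultimately show ?thesis using l by (auto simp: wiener_symbol_def truncate_symbol_def)
qed

lemma wnorm_truncate_tendsto_0:
  assumes l: "wiener_symbol l"
  shows "(\<lambda>w. wnorm (\<lambda>k. l k - truncate_symbol w l k)) \<longlonglongrightarrow> 0"
proof -
  have "(\<lambda>w. \<Sum>\<^sub>\<infinity>k. norm (l k) * (if zabs k \<le> int w then 0 else 1)) \<longlonglongrightarrow> 0"
  proof (rule infsum_dominated_null[where C = 1])
    fix k
    have "\<forall>w\<ge>nat (zabs k). (if zabs k \<le> int w then 0 else 1 :: real) = 0" by auto
    then have "\<forall>\<^sub>F w in sequentially. (if zabs k \<le> int w then 0 else 1 :: real) = 0"
      unfolding eventually_sequentially by blast
    then show "(\<lambda>w. if zabs k \<le> int w then 0 else 1 :: real) \<longlonglongrightarrow> 0" by (rule tendsto_eventually)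
  qed (use l in \<open>auto simp: wiener_symbol_def\<close>)
  moreover have "norm (l k - truncate_symbol w l k) = norm (l k) * (if zabs k \<le> int w then 0 else 1)" for k w
    by (simp add: truncate_symbol_def)
  ultimately show ?thesis by (simp add: wnorm_def)
qed

lemma wiener_symbol_diff:
  assumes "wiener_symbol l" "wiener_symbol l'" shows "wiener_symbol (\<lambda>k. l k - l' k)"
proof -
  have "(\<lambda>k. norm (l k - l' k)) summable_on UNIV"
  proof (rule summable_on_comparison_test)
    show "(\<lambda>k. norm (l k) + norm (l' k)) summable_on UNIV"
      using assms by (intro summable_on_add) (auto simp: wiener_symbol_def)
  qed (auto simp: norm_triangle_ineq4)
  moreover have "l k - l' k \<in> LU" for k
  proof -
    have "l k \<in> LU" "l' k \<in> LU" using assms by (auto simp: wiener_symbol_def)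
    then show ?thesis by (simp add: LU_def blinfun.diff_left sc.scale_right_diff_distrib)
  qed
  ultimately show ?thesis by (auto simp: wiener_symbol_def)
qed

lemma truncated_op_support:
  assumes "x i = 0" "\<And>j. j \<notin> M \<Longrightarrow> x j = 0" "\<And>j. j \<in> M \<Longrightarrow> i \<notin> cube j (int w)"
  shows "wiener_op (truncate_symbol w l) c x i = 0"
proof -
  have "blinfun_apply (truncate_symbol w l k) (x (i - k)) = 0" for k
    using assms(2)[of "i - k"] assms(3)[of "i - k"] by (cases "i - k \<in> M") (auto simp: truncate_symbol_def cube_def)
  then have "laurent_op (truncate_symbol w l) x i = 0" unfolding laurent_op_reindex by simp
  then show ?thesis using assms(1) by (simp add: mult_op_def)
qed

text \<open>Division by \<open>J ^ N\<close> leaves the coefficients of \<open>J ^ N\<close> in the limit. These do not depend on \<open>w\<close>, and they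
  differ by \<open>2 ^ N\<close>.\<close>
lemma cube_count_contradiction:
  fixes d N P c w :: nat
  assumes le: "\<And>J. d * (2 * (P * J + c) + 1) ^ N + (2 * J + 1) ^ N \<le> d * (2 * (P * J + c + w) + 1) ^ N"
  shows False
proof -
  have lim: "(\<lambda>J. ((real a * real J + real e) / real J) ^ N) \<longlonglongrightarrow> real a ^ N" for a e
  proof (rule tendsto_power)
    have "(\<lambda>J. real a + real e / real J) \<longlonglongrightarrow> real a + 0"
      by (intro tendsto_intros lim_const_over_n)
    moreover have "\<forall>\<^sub>F J in sequentially. real a + real e / real J = (real a * real J + real e) / real J"
      using eventually_gt_at_top[of 0] by eventually_elim (simp add: field_simps)
    ultimately show "(\<lambda>J. (real a * real J + real e) / real J) \<longlonglongrightarrow> real a"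
      using Lim_transform_eventually by fastforce
  qed
  define f where "f = (\<lambda>J. real d * ((real (2 * P) * real J + real (2 * c + 1)) / real J) ^ N
      + ((real 2 * real J + real 1) / real J) ^ N)"
  define g where "g = (\<lambda>J. real d * ((real (2 * P) * real J + real (2 * (c + w) + 1)) / real J) ^ N)"
  have "f \<longlonglongrightarrow> real d * real (2 * P) ^ N + real 2 ^ N"
    unfolding f_def by (intro tendsto_add tendsto_mult_left lim)
  moreover have "g \<longlonglongrightarrow> real d * real (2 * P) ^ N"
    unfolding g_def by (intro tendsto_mult_left lim)
  moreover have "f J \<le> g J" if "0 < J" for J
  proof -
    have "real (d * (2 * (P * J + c) + 1) ^ N + (2 * J + 1) ^ N) \<le> real (d * (2 * (P * J + c + w) + 1) ^ N)"
      using le by (rule of_nat_mono)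
    then have "(real d * (real (2 * P) * real J + real (2 * c + 1)) ^ N + (real 2 * real J + real 1) ^ N) / real J ^ N
        \<le> (real d * (real (2 * P) * real J + real (2 * (c + w) + 1)) ^ N) / real J ^ N"
      by (intro divide_right_mono) (simp_all add: algebra_simps)
    then show ?thesis
      by (simp only: f_def g_def power_divide times_divide_eq_right
          add_divide_distrib[of _ "(real 2 * real J + real 1) ^ N"])
  qed
  ultimately have "real d * real (2 * P) ^ N + real 2 ^ N \<le> real d * real (2 * P) ^ N"
    by (intro LIMSEQ_le[of f _ g]) (auto intro!: exI[of _ 1])
  moreover have "0 < real 2 ^ N" by simp
  ultimately show False by linarith
qed

text \<open>Here dimensions are counted. Suppose that \<open>u\<close> has at least the distance \<open>d > 0\<close> from the range. The operator is replaced by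
  a band operator of width \<open>w\<close>, close to it in norm. Almost periods near the points of a grid provide
  translates of \<open>u\<close> that are far apart and have distance at least \<open>d / 2\<close> from its range. A linear
  combination of them in the range, localised by a cutoff to the translate with the largest coefficient,
  would bring this translate close to the range; hence the translates are independent modulo the range.
  With \<open>B\<close> a basis of the coefficient space, the images of the sequences supported in the cube of radius
  \<open>P J + c\<close> and the \<open>(2 J + 1) ^ N\<close> translates with grid index of modulus at most \<open>J\<close> are linearly
  independent sequences supported in the cube of radius \<open>P J + c + w\<close>, for every \<open>J\<close>.\<close>
lemma finite_support_in_range:
  fixes l b :: "int ^ 'n \<Rightarrow> 'u::{complex_normed_vector, banach} \<Rightarrow>\<^sub>L 'u"
  assumes fd: "finite_dimensional scaleC (UNIV :: 'u set)" and l: "wiener_symbol l" and b: "ap_function b"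
    and C0: "0 < C" and C: "\<And>x. x \<in> Yspace \<infinity> \<Longrightarrow> Ynorm \<infinity> x \<le> C * Ynorm \<infinity> (wiener_op l b x)"
    and u: "finite {m. u m \<noteq> 0}"
  shows "\<exists>x\<in>Yspace \<infinity>. wiener_op l b x = u"
proof (rule ccontr)
  assume nr: "\<not> (\<exists>x\<in>Yspace \<infinity>. wiener_op l b x = u)"
  have bL: "b \<in> linf_LU" using b by (simp add: ap_function_def)
  have uY: "u \<in> Yspace \<infinity>" by (rule Yspace_finite_support(1)[OF _ u]) auto
  define U where "U = Ynorm \<infinity> u"
  have U0: "0 \<le> U" unfolding U_def by (rule Ynorm_nonneg[OF _ uY]) simp
  obtain d where d: "0 < d" "\<And>x. x \<in> Yspace \<infinity> \<Longrightarrow> d \<le> Ynorm \<infinity> (u - wiener_op l b x)"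
    using distance_from_range[OF fd l bL C _ uY nr] C0 by auto
  \<comment> \<open>\<open>M\<close> bounds every \<open>x\<close> whose image under the band operator is within \<open>d\<close> of a translate of \<open>u\<close>; \<open>\<eta>\<close> is the tolerance for both the truncation and the almost periods\<close>
  define M where "M = 2 * C * (U + d)"
  have M0: "0 < M" using C0 U0 d(1) by (simp add: M_def)
  define \<eta> where "\<eta> = min (inverse (2 * C)) (d / (4 * M))"
  have \<eta>: "0 < \<eta>" "C * \<eta> \<le> 1 / 2" "\<eta> * M \<le> d / 4"
  proof -
    show "0 < \<eta>" using C0 d(1) M0 by (simp add: \<eta>_def)
    have "C * \<eta> \<le> C * inverse (2 * C)" using C0 by (intro mult_left_mono) (auto simp: \<eta>_def)
    then show "C * \<eta> \<le> 1 / 2" using C0 by simp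
    have "\<eta> * M \<le> d / (4 * M) * M" using M0 by (intro mult_right_mono) (auto simp: \<eta>_def)
    then show "\<eta> * M \<le> d / 4" using M0 by simp
  qed
  obtain w where w: "wnorm (\<lambda>k. l k - truncate_symbol w l k) < \<eta>"
    using order_tendstoD(2)[OF wnorm_truncate_tendsto_0[OF l] \<eta>(1)] eventually_happens'[OF sequentially_bot]
    by blast
  define l' where "l' = truncate_symbol w l"
  have l': "wiener_symbol l'" unfolding l'_def by (rule wiener_symbol_truncate[OF l])
  let ?T = "wiener_op l' b"
  have TY: "?T x \<in> Yspace \<infinity>" if "x \<in> Yspace \<infinity>" for x
    by (rule wiener_op_Yspace[OF l' bL _ that]) simp
  have WT: "Ynorm \<infinity> (wiener_op l b x - ?T x) \<le> \<eta> * Ynorm \<infinity> x" if x: "x \<in> Yspace \<infinity>" for x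
  proof -
    have "Ynorm \<infinity> (wiener_op l b x - ?T x) \<le> wnorm (\<lambda>k. l k - l' k) * Ynorm \<infinity> x"
      unfolding wiener_op_laurent_diff[OF l l' x] by (rule laurent_Yspace(2)[OF wiener_symbol_diff[OF l l'] _ x]) simp
    also have "\<dots> \<le> \<eta> * Ynorm \<infinity> x"
      using w Ynorm_nonneg[OF _ x] by (intro mult_right_mono) (auto simp: l'_def)
    finally show ?thesis .
  qed
  have CT: "Ynorm \<infinity> x \<le> 2 * C * Ynorm \<infinity> (?T x)" if x: "x \<in> Yspace \<infinity>" for x
  proof -
    have Wx: "wiener_op l b x \<in> Yspace \<infinity>" by (rule wiener_op_Yspace[OF l bL _ x]) simp
    have "Ynorm \<infinity> (wiener_op l b x - ?T x + ?T x)
        \<le> Ynorm \<infinity> (wiener_op l b x - ?T x) + Ynorm \<infinity> (?T x)"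
      by (intro Yspace_add(2) Yspace_diff(1) Wx TY x) auto
    then have "Ynorm \<infinity> (wiener_op l b x) \<le> \<eta> * Ynorm \<infinity> x + Ynorm \<infinity> (?T x)"
      using WT[OF x] by (simp only: diff_add_cancel)
    then have "C * Ynorm \<infinity> (wiener_op l b x) \<le> C * (\<eta> * Ynorm \<infinity> x + Ynorm \<infinity> (?T x))"
      using C0 by (intro mult_left_mono) auto
    then have "Ynorm \<infinity> x \<le> (C * \<eta>) * Ynorm \<infinity> x + C * Ynorm \<infinity> (?T x)"
      using C[OF x] by (simp add: algebra_simps)
    moreover have "(C * \<eta>) * Ynorm \<infinity> x \<le> 1 / 2 * Ynorm \<infinity> x"
      using \<eta>(2) Ynorm_nonneg[OF _ x] by (intro mult_right_mono) auto
    ultimately show ?thesis by simp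
  qed
  \<comment> \<open>translates of \<open>u\<close> by almost periods keep half of the distance: translate back, and replace first the coefficient by \<open>b\<close>, then the band operator by the original one\<close>
  have far: "d / 2 \<le> Ynorm \<infinity> (shift (- k) u - ?T x)"
    if k: "\<And>m. norm (b (m + k) - b m) \<le> \<eta>" and x: "x \<in> Yspace \<infinity>" for k x
  proof (rule ccontr)
    assume "\<not> d / 2 \<le> Ynorm \<infinity> (shift (- k) u - ?T x)"
    then have less: "Ynorm \<infinity> (shift (- k) u - ?T x) < d / 2" by simp
    have su: "shift (- k) u \<in> Yspace \<infinity>" "Ynorm \<infinity> (shift (- k) u) = U"
      using Yspace_shift[OF _ uY] by (auto simp: U_def)
    have "Ynorm \<infinity> (shift (- k) u - (shift (- k) u - ?T x))
        \<le> Ynorm \<infinity> (shift (- k) u) + Ynorm \<infinity> (shift (- k) u - ?T x)"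
      by (intro Yspace_diff su TY x) auto
    then have "Ynorm \<infinity> (?T x) \<le> U + d"
      using less su(2) d(1) by (simp only: diff_diff_eq2 add_diff_cancel_left')
    then have "2 * C * Ynorm \<infinity> (?T x) \<le> M" unfolding M_def using C0 by (intro mult_left_mono) auto
    then have xM: "Ynorm \<infinity> x \<le> M" using CT[OF x] by simp
    define y where "y = shift k x"
    have y: "y \<in> Yspace \<infinity>" "Ynorm \<infinity> y \<le> M"
      using Yspace_shift[OF _ x] xM by (auto simp: y_def)
    have sbL: "shift k b \<in> linf_LU" using shift_linf[OF bL] by (simp add: shift_def)
    have Wb: "wiener_op l b y \<in> Yspace \<infinity>" and Sb: "wiener_op l' (shift k b) y \<in> Yspace \<infinity>"
      using wiener_op_Yspace[OF l bL _ y(1)] wiener_op_Yspace[OF l' sbL _ y(1)] by auto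
    have e1: "Ynorm \<infinity> (u - wiener_op l' (shift k b) y) < d / 2"
    proof -
      have "u - wiener_op l' (shift k b) y = shift k (shift (- k) u - ?T x)"
        unfolding y_def wiener_op_shift by (simp add: shift_def fun_eq_iff)
      then show ?thesis
        using less Yspace_shift(2)[OF _ Yspace_diff(1)[OF _ su(1) TY[OF x]], of k] by simp
    qed
    have e2: "Ynorm \<infinity> (wiener_op l' (shift k b) y - ?T y) \<le> \<eta> * M"
    proof -
      have "Ynorm \<infinity> (wiener_op l' (shift k b) y - ?T y) \<le> \<eta> * Ynorm \<infinity> y"
        by (rule wiener_op_perturb[OF l' sbL _ y(1)]) (auto simp: shift_def k)
      also have "\<dots> \<le> \<eta> * M" using \<eta>(1) y(2) by (intro mult_left_mono) auto
      finally show ?thesis .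
    qed
    have e3: "Ynorm \<infinity> (?T y - wiener_op l b y) \<le> \<eta> * M"
    proof -
      have "Ynorm \<infinity> (wiener_op l b y - ?T y) \<le> \<eta> * Ynorm \<infinity> y" by (rule WT[OF y(1)])
      also have "\<dots> \<le> \<eta> * M" using \<eta>(1) y(2) by (intro mult_left_mono) auto
      finally show ?thesis by (simp only: Ynorm_minus_commute[of \<infinity> "?T y"])
    qed
    have eq: "u - wiener_op l b y = (u - wiener_op l' (shift k b) y)
        + ((wiener_op l' (shift k b) y - ?T y) + (?T y - wiener_op l b y))"
      by (simp only: diff_add_cancel add_diff_eq)
    have "Ynorm \<infinity> (u - wiener_op l b y) \<le> Ynorm \<infinity> (u - wiener_op l' (shift k b) y)
          + Ynorm \<infinity> ((wiener_op l' (shift k b) y - ?T y) + (?T y - wiener_op l b y))"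
      unfolding eq by (intro Yspace_add Yspace_diff uY Wb Sb TY y(1)) auto
    moreover have "Ynorm \<infinity> ((wiener_op l' (shift k b) y - ?T y) + (?T y - wiener_op l b y))
        \<le> Ynorm \<infinity> (wiener_op l' (shift k b) y - ?T y) + Ynorm \<infinity> (?T y - wiener_op l b y)"
      by (intro Yspace_add Yspace_diff Wb Sb TY y(1)) auto
    ultimately have "Ynorm \<infinity> (u - wiener_op l b y) < d / 2 + \<eta> * M + \<eta> * M"
      using e1 e2 e3 by linarith
    then show False using d(2)[OF y(1)] \<eta>(3) by linarith
  qed
  obtain \<rho> where u_supp: "\<And>m. u m \<noteq> 0 \<Longrightarrow> zabs m \<le> int \<rho>"
    by (rule support_radius[OF u]) (rule that)
  obtain r where r: "0 < r" "\<rho> \<le> r" and cb: "commutator_bound l' r < d / (4 * C * (U + 1))"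
    using commutator_bound_small[OF l', of "d / (4 * C * (U + 1))" \<rho>] d(1) C0 U0 by auto
  have cb': "commutator_bound l' r * (2 * C * U) < d / 2"
  proof -
    have "commutator_bound l' r * (4 * C * (U + 1)) < d"
      using cb C0 U0 by (simp add: pos_less_divide_eq)
    moreover have "commutator_bound l' r * (4 * C * U) \<le> commutator_bound l' r * (4 * C * (U + 1))"
      using C0 U0 commutator_bound_nonneg[of l' r] by (intro mult_left_mono) auto
    ultimately have "commutator_bound l' r * (4 * C * U) < d" by linarith
    then show ?thesis by (simp add: algebra_simps)
  qed
  obtain D :: nat where D: "\<And>(g :: int ^ 'n \<Rightarrow> int ^ 'n) R.
      \<forall>i j. i \<noteq> j \<longrightarrow> int (2 * D + R + 1) \<le> zabs (g i - g j) \<Longrightarrow>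
      \<exists>\<kappa>. (\<forall>j. zabs (\<kappa> j - g j) \<le> int D) \<and> (\<forall>j m. norm (b (m + \<kappa> j) - b m) \<le> \<eta>) \<and>
        (\<forall>i j. i \<noteq> j \<longrightarrow> int R < zabs (\<kappa> i - \<kappa> j))"
    by (rule separated_periods[OF _ \<eta>(1), of b]) (use b in \<open>auto simp: ap_function_def\<close>)
  \<comment> \<open>the spacing exceeds \<open>3 r\<close> after the displacement by \<open>D\<close> at both ends: a cutoff of scale \<open>r\<close> about one translate then vanishes on the supports of the others\<close>
  define P where "P = 2 * D + 3 * r + 1"
  define grid :: "int ^ 'n \<Rightarrow> int ^ 'n" where "grid = (\<lambda>j. \<chi> i. int P * j $ i)"
  have gap: "\<forall>i j. i \<noteq> j \<longrightarrow> int (2 * D + 3 * r + 1) \<le> zabs (grid i - grid j)"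
  proof (intro allI impI)
    fix i j :: "int ^ 'n" assume ne: "i \<noteq> j"
    obtain a where a: "i $ a \<noteq> j $ a" using ne unfolding vec_eq_iff by blast
    have "int P * 1 \<le> int P * \<bar>i $ a - j $ a\<bar>" using a by (intro mult_left_mono) auto
    also have "\<dots> = \<bar>(grid i - grid j) $ a\<bar>" by (simp add: grid_def abs_mult flip: right_diff_distrib)
    also have "\<dots> \<le> zabs (grid i - grid j)" by (rule abs_component_le_zabs)
    finally show "int (2 * D + 3 * r + 1) \<le> zabs (grid i - grid j)" by (simp add: P_def)
  qed
  from D[of "3 * r" grid, OF gap] obtain \<kappa> where k: "(\<forall>j. zabs (\<kappa> j - grid j) \<le> int D) \<and>
      (\<forall>j m. norm (b (m + \<kappa> j) - b m) \<le> \<eta>) \<and> (\<forall>i j. i \<noteq> j \<longrightarrow> int (3 * r) < zabs (\<kappa> i - \<kappa> j))"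
    by (elim exE)
  have \<kappa>: "\<And>j. zabs (\<kappa> j - grid j) \<le> int D" "\<And>j m. norm (b (m + \<kappa> j) - b m) \<le> \<eta>"
    and apart: "\<And>i j. i \<noteq> j \<Longrightarrow> 3 * int r < zabs (\<kappa> i - \<kappa> j)"
    using k by simp_all
  define V where "V = (\<lambda>j. shift (- \<kappa> j) u)"
  have V_supp: "m \<in> cube (\<kappa> j) (int r)" if "V j m \<noteq> 0" for j m
    using u_supp[of "m - \<kappa> j"] that r(2) by (simp add: V_def shift_def cube_def)
  have V_le: "norm (V j m) \<le> U" for j m
    using norm_le_Ynorm[OF _ uY] by (simp add: V_def shift_def U_def)
  \<comment> \<open>the translates \<open>V j\<close> are independent modulo the range of \<open>?T\<close>\<close>
  have indep: "(\<forall>j\<in>F. a j = 0) \<and> x = 0"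
    if F: "finite F" and x: "x \<in> Yspace \<infinity>" and eq: "?T x = (\<Sum>j\<in>F. cscale (a j) (V j))" for F a x
  proof (cases "\<forall>j\<in>F. a j = 0")
    case True
    then have "?T x = 0" unfolding eq by (intro sum.neutral) (auto simp: cs.scale_zero_left)
    then have "Ynorm \<infinity> x \<le> 0" using CT[OF x] by (simp add: Ynorm_0)
    then show ?thesis using True Ynorm_eq_0[OF _ x] by simp
  next
    case False
    then have "F \<noteq> {}" by auto
    obtain j0 where j0: "j0 \<in> F" "\<And>j. j \<in> F \<Longrightarrow> cmod (a j) \<le> cmod (a j0)"
      by (rule exists_max_cmod[OF F \<open>F \<noteq> {}\<close>, of a]) (rule that)
    have a0: "0 < cmod (a j0)" using False j0 by force
    define z where "z = (\<Sum>j\<in>F. cscale (a j) (V j))"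
    have z_apply: "z m = (\<Sum>j\<in>F. a j *\<^sub>C V j m)" for m
      by (simp add: z_def sum_fun_apply cscale_def)
    \<comment> \<open>inside the cube of radius \<open>2 r\<close> about one translate only this translate contributes\<close>
    have z_at: "z m = a j *\<^sub>C V j m" if "j \<in> F" "m \<in> cube (\<kappa> j) (2 * int r)" for j m
    proof -
      have "V i m = 0" if "i \<noteq> j" for i
      proof (rule ccontr)
        assume "V i m \<noteq> 0"
        then have "zabs (m - \<kappa> i) \<le> int r" using V_supp by (simp add: cube_def)
        moreover have "zabs (m - \<kappa> j) \<le> 2 * int r" using \<open>m \<in> cube (\<kappa> j) (2 * int r)\<close> by (simp add: cube_def)
        ultimately show False
          using apart[OF that] zabs_diff_triangle[of "\<kappa> i" "\<kappa> j" m] zabs_minus_commute[of "\<kappa> i" m] by linarith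
      qed
      then have "(\<Sum>i\<in>F. a i *\<^sub>C V i m) = (\<Sum>i\<in>F. if i = j then a j *\<^sub>C V j m else 0)"
        by (intro sum.cong) auto
      then show ?thesis using F \<open>j \<in> F\<close> by (simp add: z_apply)
    qed
    have z_le: "norm (z m) \<le> cmod (a j0) * U" for m
    proof (cases "\<exists>j\<in>F. V j m \<noteq> 0")
      case True
      then obtain j where j: "j \<in> F" "V j m \<noteq> 0" by blast
      have "m \<in> cube (\<kappa> j) (2 * int r)" using V_supp[OF j(2)] by (simp add: cube_def)
      then have "norm (z m) = cmod (a j) * norm (V j m)" using z_at[OF j(1)] by (simp add: norm_scaleC)
      also have "\<dots> \<le> cmod (a j0) * U" using j0(2)[OF j(1)] V_le by (intro mult_mono) auto
      finally show ?thesis .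
    next
      case False
      then have "z m = 0" unfolding z_apply by (intro sum.neutral) auto
      then show ?thesis using U0 by simp
    qed
    have zY: "z \<in> Yspace \<infinity>" "Ynorm \<infinity> z \<le> cmod (a j0) * U"
      using Yspace_infinityI[of z, OF z_le] by auto
    define v where "v = cut r (\<kappa> j0) x"
    have vY: "v \<in> Yspace \<infinity>" unfolding v_def by (rule cut_in_Yspace(1)[OF _ x]) simp
    have cutz: "cut r (\<kappa> j0) z = cscale (a j0) (V j0)"
    proof
      fix m
      show "cut r (\<kappa> j0) z m = cscale (a j0) (V j0) m"
      proof (cases "m \<in> cube (\<kappa> j0) (2 * int r)")
        case True
        show ?thesis
        proof (cases "V j0 m = 0")
          case True
          then show ?thesis using z_at[OF j0(1) \<open>m \<in> cube (\<kappa> j0) (2 * int r)\<close>] by (simp add: cut_def cscale_def)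
        next
          case False
          then have "cutoff r (\<kappa> j0) m = 1" using cutoff_eq_1[OF r(1)] V_supp by blast
          then show ?thesis using z_at[OF j0(1) \<open>m \<in> cube (\<kappa> j0) (2 * int r)\<close>]
            by (simp add: cut_def cscale_def)
        qed
      next
        case False
        then have "V j0 m = 0" using V_supp[of j0 m] by (auto simp: cube_def)
        then show ?thesis using False by (simp add: cut_def cscale_def cutoff_eq_0[OF r(1)])
      qed
    qed
    have "norm ((?T v - cscale (a j0) (V j0)) i) \<le> commutator_bound l' r * Ynorm \<infinity> x" for i
      using commutator_sup_le[OF l' bL x r(1), of "\<kappa> j0" i] unfolding eq z_def[symmetric] cutz v_def[symmetric] .
    then have "Ynorm \<infinity> (?T v - cscale (a j0) (V j0)) \<le> commutator_bound l' r * Ynorm \<infinity> x"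
      by (rule Yspace_infinityI(2))
    also have "\<dots> \<le> commutator_bound l' r * (2 * C * (cmod (a j0) * U))"
    proof (rule mult_left_mono[OF _ commutator_bound_nonneg])
      have "Ynorm \<infinity> x \<le> 2 * C * Ynorm \<infinity> z" using CT[OF x] unfolding eq z_def .
      also have "\<dots> \<le> 2 * C * (cmod (a j0) * U)" using C0 zY(2) by (intro mult_left_mono) auto
      finally show "Ynorm \<infinity> x \<le> 2 * C * (cmod (a j0) * U)" .
    qed
    also have "\<dots> = cmod (a j0) * (commutator_bound l' r * (2 * C * U))" by (simp add: ac_simps)
    also have "\<dots> < cmod (a j0) * (d / 2)" using cb' a0 by (rule mult_strict_left_mono)
    \<comment> \<open>compare with the lower bound \<open>far\<close>, after division by the largest coefficient\<close>
    finally have small: "Ynorm \<infinity> (?T v - cscale (a j0) (V j0)) < cmod (a j0) * (d / 2)" .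
    define v' where "v' = cscale (inverse (a j0)) v"
    have v'Y: "v' \<in> Yspace \<infinity>" unfolding v'_def by (rule Yspace_cscale(1)[OF _ vY]) simp
    have VY: "V j0 \<in> Yspace \<infinity>" unfolding V_def by (rule Yspace_shift(1)[OF _ uY]) simp
    have "?T v - cscale (a j0) (V j0) = cscale (- a j0) (V j0 - ?T v')"
    proof -
      have "?T v' = cscale (inverse (a j0)) (?T v)" unfolding v'_def by (rule wiener_op_cscale[OF l' bL vY])
      then have "cscale (a j0) (?T v') = ?T v" using a0 by (simp add: cscale_def sc.scale_scale fun_eq_iff)
      then show ?thesis by (simp only: cs.scale_right_diff_distrib cs.scale_minus_left) simp
    qed
    then have "Ynorm \<infinity> (?T v - cscale (a j0) (V j0)) = cmod (a j0) * Ynorm \<infinity> (V j0 - ?T v')"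
      using Yspace_cscale(2)[OF _ Yspace_diff(1)[OF _ VY TY[OF v'Y]], of "- a j0"] by simp
    moreover have "d / 2 \<le> Ynorm \<infinity> (V j0 - ?T v')" unfolding V_def by (rule far[OF \<kappa>(2) v'Y])
    then have "cmod (a j0) * (d / 2) \<le> cmod (a j0) * Ynorm \<infinity> (V j0 - ?T v')"
      by (rule mult_left_mono) simp
    ultimately show ?thesis using small by linarith
  qed
  obtain B :: "'u set" where B: "finite B" "sc.independent B" "sc.span B = UNIV"
  proof -
    obtain B0 :: "'u set" where B0: "finite B0" "UNIV = sc.span B0"
      using fd by (auto simp: finite_dimensional_def)
    obtain B where B: "B \<subseteq> B0" "sc.independent B" "B0 \<subseteq> sc.span B"
      using sc.maximal_independent_subset[of B0] by blast
    have "sc.span B0 \<subseteq> sc.span B" using B(3) by (rule sc.span_minimal[OF _ sc.subspace_span])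
    then have "sc.span B = UNIV" using B0(2) by blast
    moreover have "finite B" using B(1) B0(1) by (rule finite_subset)
    ultimately show ?thesis using that[of B] B(2) by blast
  qed
  define c where "c = D + r"
  have count: "card B * (2 * (P * J + c) + 1) ^ CARD('n) + (2 * J + 1) ^ CARD('n)
      \<le> card B * (2 * (P * J + c + w) + 1) ^ CARD('n)" for J :: nat
  proof (rule ccontr)
    assume neg: "\<not> ?thesis"
    define n where "n = P * J + c"
    define E where "E = cube (0 :: int ^ 'n) (int n)"
    define E' where "E' = cube (0 :: int ^ 'n) (int (n + w))"
    define G where "G = cube (0 :: int ^ 'n) (int J)"
    define X where "X = (E \<times> B) <+> G"
    define t where "t = (\<lambda>(m, e). single m e) ` (E' \<times> B)"
    \<comment> \<open>the family whose linear dependence is to be refuted, and the set \<open>t\<close> of coordinate sequences that spans it\<close>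
    define h where "h = case_sum (\<lambda>(m, e). ?T (single m e)) V"
    have cardc: "card (cube (0 :: int ^ 'n) (int k)) = (2 * k + 1) ^ CARD('n)" for k
      by (subst card_cube_0) (auto simp: nat_add_distrib nat_mult_distrib)
    have X: "finite X" unfolding X_def E_def G_def using B(1) by auto
    have "card X = card B * (2 * n + 1) ^ CARD('n) + (2 * J + 1) ^ CARD('n)"
      unfolding X_def E_def G_def using B(1) by (subst card_Plus) (simp_all add: card_cartesian_product cardc)
    moreover have "card t \<le> card B * (2 * (n + w) + 1) ^ CARD('n)"
    proof -
      have "card t \<le> card (E' \<times> B)" unfolding t_def E'_def using B(1) by (intro card_image_le) auto
      also have "\<dots> = card B * (2 * (n + w) + 1) ^ CARD('n)"
        unfolding E'_def card_cartesian_product cardc by simp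
      finally show ?thesis .
    qed
    ultimately have less: "card t < card X" using neg by (simp add: n_def)
    have t: "finite t" unfolding t_def E'_def using B(1) by auto
    have singleY: "single m e \<in> Yspace \<infinity>" for m :: "int ^ 'n" and e :: 'u
      by (rule Yspace_finite_support(1)[of _ "{m}"]) (auto simp: single_def)
    have "h i \<in> cs.span t" if "i \<in> X" for i
      unfolding t_def
    proof (rule finite_support_in_span[OF B(1,3)])
      show "finite E'" by (simp add: E'_def)
      fix q assume q: "q \<notin> E'"
      from that show "h i q = 0" unfolding X_def
      proof (elim PlusE)
        fix me assume "me \<in> E \<times> B" "i = Inl me"
        then obtain m e where me: "m \<in> E" "i = Inl (m, e)" by auto
        have "q \<notin> cube m (int w)"
          using q me(1) zabs_diff_triangle[of q 0 m] by (auto simp: cube_def E_def E'_def)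
        moreover have "q \<noteq> m" using q me(1) by (auto simp: cube_def E_def E'_def)
        ultimately have "?T (single m e) q = 0" unfolding l'_def
          by (intro truncated_op_support[where M = "{m}"]) (auto simp: single_def)
        then show ?thesis by (simp only: h_def me(2) sum.case case_prod_conv)
      next
        fix j assume j: "j \<in> G" "i = Inr j"
        have "V j q = 0"
        proof (rule ccontr)
          assume "V j q \<noteq> 0"
          then have "zabs (q - \<kappa> j) \<le> int r" using V_supp by (simp add: cube_def)
          moreover have "zabs (grid j) \<le> int P * int J"
          proof -
            have "\<forall>i. \<bar>j $ i\<bar> \<le> int J" using j(1) by (simp add: G_def cube_def zabs_le_iff)
            then show ?thesis unfolding zabs_le_iff by (simp add: grid_def abs_mult mult_left_mono)
          qed
          ultimately have "zabs q \<le> int (n + w)"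
            using zabs_triangle[of "q - \<kappa> j" "\<kappa> j"] zabs_triangle[of "\<kappa> j - grid j" "grid j"] \<kappa>(1)[of j]
            by (simp add: n_def c_def)
          then show False using q by (simp add: E'_def cube_def)
        qed
        then show ?thesis by (simp add: h_def j(2))
      qed
    qed
    then have "h ` X \<subseteq> cs.span t" by blast
    from cs.exists_nontrivial_relation[OF X t less this]
    obtain a where a: "\<exists>i\<in>X. a i \<noteq> 0" "(\<Sum>i\<in>X. cscale (a i) (h i)) = 0" by blast
    define x where "x = (\<Sum>p\<in>E \<times> B. cscale (- a (Inl p)) (single (fst p) (snd p)))"
    have EB: "finite (E \<times> B)" using B(1) by (simp add: E_def)
    have sY: "cscale \<alpha> (single m e) \<in> Yspace \<infinity>" for \<alpha> and m :: "int ^ 'n" and e :: 'u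
      by (rule Yspace_cscale(1)[OF _ singleY]) simp
    have xY: "x \<in> Yspace \<infinity>"
      unfolding x_def by (intro conjunct1[OF Yspace_sum[OF _ EB]] sY) simp
    have "?T x = (\<Sum>p\<in>E \<times> B. ?T (cscale (- a (Inl p)) (single (fst p) (snd p))))"
      unfolding x_def by (rule wiener_op_sum[OF l' bL EB sY])
    also have "\<dots> = (\<Sum>p\<in>E \<times> B. cscale (- a (Inl p)) (h (Inl p)))"
    proof (rule sum.cong)
      fix p assume "p \<in> E \<times> B"
      show "?T (cscale (- a (Inl p)) (single (fst p) (snd p))) = cscale (- a (Inl p)) (h (Inl p))"
        unfolding wiener_op_cscale[OF l' bL singleY] by (simp only: h_def sum.case case_prod_beta)
    qed simp
    also have "\<dots> = (\<Sum>j\<in>G. cscale (a (Inr j)) (V j))"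
    proof -
      have "(\<Sum>i\<in>X. cscale (a i) (h i))
          = (\<Sum>p\<in>E \<times> B. cscale (a (Inl p)) (h (Inl p))) + (\<Sum>j\<in>G. cscale (a (Inr j)) (h (Inr j)))"
        unfolding X_def using B(1) by (subst sum.Plus) (auto simp: E_def G_def)
      then have "(\<Sum>j\<in>G. cscale (a (Inr j)) (h (Inr j))) = - (\<Sum>p\<in>E \<times> B. cscale (a (Inl p)) (h (Inl p)))"
        unfolding a(2) by (rule minus_unique[symmetric, OF sym])
      then show ?thesis
        by (simp only: cs.scale_minus_left sum_negf h_def sum.case)
    qed
    finally have Tx: "?T x = (\<Sum>j\<in>G. cscale (a (Inr j)) (V j))" .
    have "finite G" by (simp add: G_def)
    from indep[OF this xY Tx] have aG: "\<And>j. j \<in> G \<Longrightarrow> a (Inr j) = 0" and x0: "x = 0" by auto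
    have aE: "a (Inl (m, e)) = 0" if "m \<in> E" "e \<in> B" for m e
    proof -
      have "x m = (\<Sum>p\<in>E \<times> B. if fst p = m then (- a (Inl (m, snd p))) *\<^sub>C snd p else 0)"
        unfolding x_def sum_fun_apply by (intro sum.cong) (auto simp: cscale_def single_def)
      also have "\<dots> = (\<Sum>m'\<in>E. \<Sum>e\<in>B. if m' = m then (- a (Inl (m, e))) *\<^sub>C e else 0)"
        by (simp add: sum.cartesian_product case_prod_beta)
      also have "\<dots> = (\<Sum>m'\<in>E. if m' = m then \<Sum>e\<in>B. (- a (Inl (m, e))) *\<^sub>C e else 0)"
        by (intro sum.cong) auto
      also have "\<dots> = (\<Sum>e\<in>B. (- a (Inl (m, e))) *\<^sub>C e)"
        using that(1) by (simp add: E_def)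
      finally have "(\<Sum>e\<in>B. (- a (Inl (m, e))) *\<^sub>C e) = 0" using x0 by simp
      then have "- a (Inl (m, e)) = 0"
        by (rule sc.independentD[OF B(2,1) subset_refl, where u = "\<lambda>e. - a (Inl (m, e))"]) (rule that(2))
      then show ?thesis by simp
    qed
    show False using a(1) aG aE by (auto simp: X_def)
  qed
  show False by (rule cube_count_contradiction[OF count])
qed

section \<open>Open mapping and Fredholm operators\<close>

lemma summable_norm_geometric_bound:
  fixes x :: "nat \<Rightarrow> 'a::banach"
  assumes "\<And>n. norm (x n) \<le> K * (1 / 2) ^ n"
  shows "summable (\<lambda>n. norm (x n))"
  by (rule summable_comparison_test'[of "\<lambda>n. K * (1 / 2) ^ n" 0])
    (use assms in \<open>auto intro!: summable_mult summable_geometric\<close>)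

text \<open>Completeness in the form in which it is used, for series dominated by a geometric one. The sum is
  taken pointwise, and its remainders are estimated by Minkowski's inequality.\<close>
lemma Yspace_series:
  fixes x :: "nat \<Rightarrow> int ^ 'n \<Rightarrow> 'u::{complex_normed_vector, banach}"
  assumes p: "admissible p" and x: "\<And>n. x n \<in> Yspace p" "\<And>n. Ynorm p (x n) \<le> K * (1 / 2) ^ n"
  obtains y where "y \<in> Yspace p" "\<And>N. Ynorm p (y - (\<Sum>n<N. x n)) \<le> 2 * K * (1 / 2) ^ N"
proof -
  have le: "norm (x n m) \<le> K * (1 / 2) ^ n" for n m
    using norm_le_Ynorm[OF p x(1), of n m] x(2)[of n] by linarith
  have sn: "summable (\<lambda>n. norm (x n m))" for m
    using le by (rule summable_norm_geometric_bound)
  define y where "y = (\<lambda>m. \<Sum>n. x n m)"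
  have tail: "y - (\<Sum>n<N. x n) \<in> Yspace p \<and> Ynorm p (y - (\<Sum>n<N. x n)) \<le> 2 * K * (1 / 2) ^ N" for N
  proof -
    have geo: "((\<lambda>n. K * (1 / 2) ^ N * (1 / 2) ^ n) has_sum (K * (1 / 2) ^ N * 2)) UNIV"
    proof (rule sums_nonneg_imp_has_sum)
      show "(\<lambda>n. K * (1 / 2) ^ N * (1 / 2) ^ n) sums (K * (1 / 2) ^ N * 2)"
        using geometric_sums[of "1 / 2 :: real"] by (intro sums_mult) simp
      show "0 \<le> K * (1 / 2) ^ N * (1 / 2) ^ n" for n
        using Ynorm_nonneg[OF p x(1), of "N + n"] x(2)[of "N + n"] by (simp add: power_add ac_simps)
    qed
    let ?f = "\<lambda>n m. norm (x (n + N) m)"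
    have f: "in_lp p (?f n)" "lp_norm p (?f n) \<le> K * (1 / 2) ^ N * (1 / 2) ^ n" for n
      using x(1)[of "n + N"] x(2)[of "n + N"] by (simp_all add: Yspace_iff Ynorm_eq power_add ac_simps)
    have ns: "(\<lambda>n. lp_norm p (?f n)) summable_on UNIV"
      using f lp_norm_nonneg[OF p f(1)]
      by (intro summable_on_comparison_test[OF has_sum_imp_summable[OF geo]]) auto
    have "norm ((y - (\<Sum>n<N. x n)) m) \<le> (\<Sum>\<^sub>\<infinity>n. ?f n m)" for m
    proof -
      have "(y - (\<Sum>n<N. x n)) m = (\<Sum>n. x (n + N) m)"
        using suminf_minus_initial_segment[OF summable_norm_cancel[OF sn[of m]], of N]
        by (simp add: y_def sum_fun_apply)
      moreover have sN: "summable (\<lambda>n. ?f n m)" using sn by (subst summable_iff_shift)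
      moreover have "(\<Sum>n. ?f n m) = (\<Sum>\<^sub>\<infinity>n. ?f n m)"
        using infsumI[OF sums_nonneg_imp_has_sum[OF summable_sums[OF sN]]] by simp
      ultimately show ?thesis using summable_norm[OF sN] by simp
    qed
    then have "in_lp p (\<lambda>m. norm ((y - (\<Sum>n<N. x n)) m)) \<and>
        lp_norm p (\<lambda>m. norm ((y - (\<Sum>n<N. x n)) m)) \<le> (\<Sum>\<^sub>\<infinity>n. lp_norm p (?f n))"
      by (intro lp_minkowski[OF p f(1) _ ns]) auto
    moreover have "(\<Sum>\<^sub>\<infinity>n. lp_norm p (?f n)) \<le> K * (1 / 2) ^ N * 2"
      using infsum_mono[OF ns has_sum_imp_summable[OF geo]] f(2) infsumI[OF geo] by simp
    ultimately show ?thesis by (simp add: Yspace_iff Ynorm_eq)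
  qed
  have "y \<in> Yspace p" using tail[of 0] unfolding lessThan_0 sum.empty diff_zero by blast
  then show ?thesis using that tail by blast
qed

definition Ydist :: "ennreal \<Rightarrow> (int ^ 'n \<Rightarrow> 'u::complex_normed_vector) \<Rightarrow> (int ^ 'n \<Rightarrow> 'u) \<Rightarrow> real"
  where "Ydist p x y = (if x \<in> Yspace p \<and> y \<in> Yspace p then Ynorm p (x - y) else 0)"

lemma Metric_space_Y:
  assumes p: "admissible p"
  shows "Metric_space (Yspace p) (Ydist p)"
proof
  show "0 \<le> Ydist p x y" for x y :: "int ^ 'a \<Rightarrow> 'b"
    by (auto simp: Ydist_def intro!: Ynorm_nonneg[OF p] Yspace_diff(1)[OF p])
  show "Ydist p x y = Ydist p y x" for x y :: "int ^ 'a \<Rightarrow> 'b"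
    by (simp only: Ydist_def Ynorm_minus_commute[of p x y] conj_commute)
  show "Ydist p x y = 0 \<longleftrightarrow> x = y" if "x \<in> Yspace p" "y \<in> Yspace p" for x y :: "int ^ 'a \<Rightarrow> 'b"
  proof
    assume "Ydist p x y = 0"
    then have "x - y = 0"
      using that by (intro Ynorm_eq_0[OF p Yspace_diff(1)[OF p]]) (auto simp: Ydist_def)
    then show "x = y" by (simp only: right_minus_eq)
  next
    assume "x = y"
    then show "Ydist p x y = 0" by (simp add: Ydist_def Ynorm_0[OF p])
  qed
  show "Ydist p x z \<le> Ydist p x y + Ydist p y z"
    if "x \<in> Yspace p" "y \<in> Yspace p" "z \<in> Yspace p" for x y z :: "int ^ 'a \<Rightarrow> 'b"
  proof -
    have "Ynorm p ((x - y) + (y - z)) \<le> Ynorm p (x - y) + Ynorm p (y - z)"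
      by (intro Yspace_add Yspace_diff p that)
    then show ?thesis using that by (simp add: Ydist_def)
  qed
qed

lemma mcomplete_Y:
  assumes p: "admissible p"
  shows "Metric_space.mcomplete (Yspace p :: (int ^ 'n \<Rightarrow> 'u::{complex_normed_vector, banach}) set) (Ydist p)"
proof -
  interpret Y: Metric_space "Yspace p :: (int ^ 'n \<Rightarrow> 'u) set" "Ydist p"
    by (rule Metric_space_Y[OF p])
  show ?thesis
    unfolding Y.mcomplete_def
  proof (intro allI impI)
    fix s :: "nat \<Rightarrow> int ^ 'n \<Rightarrow> 'u" assume cauchy: "Y.MCauchy s"
    have sY: "s n \<in> Yspace p" for n using cauchy by (auto simp: Y.MCauchy_def)
    have "\<exists>N. \<forall>i j. N \<le> i \<longrightarrow> N \<le> j \<longrightarrow> Ynorm p (s i - s j) < (1 / 2) ^ k" for k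
    proof -
      have "0 < (1 / 2 :: real) ^ k" by simp
      then show ?thesis using cauchy sY unfolding Y.MCauchy_def Ydist_def by auto
    qed
    then obtain N where N: "\<And>k i j. N k \<le> i \<Longrightarrow> N k \<le> j \<Longrightarrow> Ynorm p (s i - s j) < (1 / 2) ^ k"
      by metis
    \<comment> \<open>a subsequence whose consecutive differences form an absolutely convergent series\<close>
    define r where "r = rec_nat (N 0) (\<lambda>k rk. max (Suc rk) (N (Suc k)))"
    have r_Suc: "r (Suc k) = max (Suc (r k)) (N (Suc k))" for k by (simp add: r_def)
    have r: "strict_mono r" by (rule strict_monoI_Suc) (simp add: r_Suc)
    have rN: "N k \<le> r k" for k by (cases k) (simp_all add: r_def)
    have "Ynorm p (s (r (Suc k)) - s (r k)) \<le> 1 * (1 / 2) ^ k" for k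
    proof -
      have "r k \<le> r (Suc k)" unfolding r_Suc by simp
      then have "Ynorm p (s (r (Suc k)) - s (r k)) < (1 / 2) ^ k"
        using rN[of k] by (intro N) linarith+
      then show ?thesis by simp
    qed
    then obtain y where y: "y \<in> Yspace p"
      "\<And>M. Ynorm p (y - (\<Sum>k<M. s (r (Suc k)) - s (r k))) \<le> 2 * 1 * (1 / 2) ^ M"
      using Yspace_series[OF p Yspace_diff(1)[OF p sY sY], of "\<lambda>k. r (Suc k)" r 1] by blast
    define z where "z = y + s (r 0)"
    have z: "z \<in> Yspace p" unfolding z_def by (intro Yspace_add p y sY)
    have zs: "Ynorm p (s (r M) - z) \<le> 2 * (1 / 2) ^ M" for M
    proof -
      have "y - (\<Sum>k<M. s (r (Suc k)) - s (r k)) = z - s (r M)"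
        unfolding sum_lessThan_telescope[of "\<lambda>k. s (r k)"] z_def by simp
      then show ?thesis using y(2)[of M] Ynorm_minus_commute[of p z "s (r M)"] by simp
    qed
    have "limitin Y.mtopology (s \<circ> r) z sequentially"
      unfolding Y.limitin_metric
    proof (intro conjI allI impI)
      fix e :: real assume "0 < e"
      moreover have "(\<lambda>M. 2 * (1 / 2) ^ M :: real) \<longlonglongrightarrow> 0"
        by (intro tendsto_mult_right_zero LIMSEQ_realpow_zero) auto
      ultimately have "\<forall>\<^sub>F M in sequentially. 2 * (1 / 2) ^ M < e" by (intro order_tendstoD(2))
      then show "\<forall>\<^sub>F M in sequentially. (s \<circ> r) M \<in> Yspace p \<and> Ydist p ((s \<circ> r) M) z < e"
      proof eventually_elim
        case (elim M)
        then show ?case using zs[of M] sY z by (simp add: Ydist_def)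
      qed
    qed (rule z)
    then show "\<exists>z. limitin Y.mtopology s z sequentially"
      using Y.MCauchy_convergent_subsequence[OF cauchy r] by blast
  qed
qed

text \<open>The space is the union of the sets \<open>S n\<close> of sums of the image of a vector of norm at most \<open>n\<close> and a
  combination of \<open>B\<close> with coefficients of modulus at most \<open>n\<close>. By Baire's theorem the closure of some \<open>S n\<close> contains a ball. Differences
  of two elements of \<open>S n\<close> therefore approximate every vector of a ball about the origin, and scaling
  extends this to all vectors.\<close>
lemma open_mapping_step:
  fixes T :: "(int ^ 'n \<Rightarrow> 'u::{complex_normed_vector, banach}) \<Rightarrow> int ^ 'n \<Rightarrow> 'u"
  assumes p: "admissible p" and T: "bounded_op_on p T" and B: "finite B" "B \<subseteq> Yspace p"
    and surj: "\<And>y. y \<in> Yspace p \<Longrightarrow> \<exists>x\<in>Yspace p. y - T x \<in> cs.span B"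
  obtains K where "0 \<le> K"
    "\<And>y t. y \<in> Yspace p \<Longrightarrow> 0 < t \<Longrightarrow> Ynorm p y \<le> t \<Longrightarrow> \<exists>x a. x \<in> Yspace p \<and> Ynorm p x \<le> K * t \<and>
      (\<forall>e\<in>B. cmod (a e) \<le> K * t) \<and> Ynorm p (y - (T x + (\<Sum>e\<in>B. cscale (a e) e))) \<le> t / 2"
proof -
  interpret Y: Metric_space "Yspace p :: (int ^ 'n \<Rightarrow> 'u) set" "Ydist p"
    by (rule Metric_space_Y[OF p])
  define \<Phi> where "\<Phi> = (\<lambda>x a. T x + (\<Sum>e\<in>B. cscale (a e) e))"
  define S where "S = (\<lambda>n :: nat. {\<Phi> x a | x a. x \<in> Yspace p \<and> Ynorm p x \<le> n \<and> (\<forall>e\<in>B. cmod (a e) \<le> n)})"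
  have TY: "T x \<in> Yspace p" if "x \<in> Yspace p" for x using T that by (auto simp: bounded_op_on_def)
  have Tadd: "T (x + y) = T x + T y" if "x \<in> Yspace p" "y \<in> Yspace p" for x y
    using T that by (auto simp: bounded_op_on_def)
  have Tsc: "T (cscale a x) = cscale a (T x)" if "x \<in> Yspace p" for a x
    using T that by (auto simp: bounded_op_on_def)
  have BY: "(\<Sum>e\<in>B. cscale (a e) e) \<in> Yspace p" for a
    using B by (intro conjunct1[OF Yspace_sum[OF p]] Yspace_cscale(1)[OF p]) auto
  have \<Phi>Y: "\<Phi> x a \<in> Yspace p" if "x \<in> Yspace p" for x a
    unfolding \<Phi>_def by (intro Yspace_add(1)[OF p] TY BY that)
  have \<Phi>diff: "\<Phi> (x - y) (\<lambda>e. a e - a' e) = \<Phi> x a - \<Phi> y a'" if "x \<in> Yspace p" "y \<in> Yspace p" for x y a a'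
  proof -
    have "T (x - y + y) = T (x - y) + T y" by (intro Tadd Yspace_diff p that)
    then have "T (x - y) = T x - T y" by (simp only: diff_add_cancel eq_diff_eq)
    then show ?thesis
      unfolding \<Phi>_def by (simp only: cs.scale_left_diff_distrib sum_subtractf) (simp only: add_diff_add)
  qed
  have \<Phi>sc: "\<Phi> (cscale c x) (\<lambda>e. c * a e) = cscale c (\<Phi> x a)" if "x \<in> Yspace p" for c x a
    unfolding \<Phi>_def Tsc[OF that] by (simp only: cs.scale_right_distrib cs.scale_sum_right cs.scale_scale)
  have SY: "S n \<subseteq> Yspace p" for n using \<Phi>Y by (auto simp: S_def)
  have cover: "\<exists>n. y \<in> S n" if y: "y \<in> Yspace p" for y
  proof -
    obtain x where x: "x \<in> Yspace p" "y - T x \<in> cs.span B" using surj[OF y] by blast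
    then obtain a where a: "y - T x = (\<Sum>e\<in>B. cscale (a e) e)"
      unfolding cs.span_finite[OF B(1)] by blast
    have "y = \<Phi> x a" unfolding \<Phi>_def a[symmetric] by simp
    define R where "R = Ynorm p x + (\<Sum>e\<in>B. cmod (a e))"
    have "Ynorm p x \<le> R" "\<And>e. e \<in> B \<Longrightarrow> cmod (a e) \<le> R"
      using Ynorm_nonneg[OF p x(1)] B(1) member_le_sum[of _ B "\<lambda>e. cmod (a e)"]
      by (auto simp: R_def sum_nonneg add_increasing)
    moreover obtain n where "R \<le> real n" using real_arch_simple by blast
    ultimately have "y \<in> S n" unfolding S_def using x(1) \<open>y = \<Phi> x a\<close> by (blast intro: order_trans)
    then show ?thesis ..
  qed
  have "\<exists>n. Y.mtopology interior_of (Y.mtopology closure_of S n) \<noteq> {}"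
  proof (rule ccontr)
    assume neg: "\<not> ?thesis"
    have "Y.mtopology interior_of (\<Union> (range (\<lambda>n. Y.mtopology closure_of S n))) = {}"
      using neg by (intro Y.metric_Baire_category_alt mcomplete_Y[OF p]) auto
    moreover have "\<Union> (range (\<lambda>n. Y.mtopology closure_of S n)) = Yspace p"
    proof
      show "\<Union> (range (\<lambda>n. Y.mtopology closure_of S n)) \<subseteq> Yspace p"
        using closure_of_subset_topspace[of Y.mtopology] by auto
      show "Yspace p \<subseteq> \<Union> (range (\<lambda>n. Y.mtopology closure_of S n))"
      proof
        fix y :: "int ^ 'n \<Rightarrow> 'u" assume "y \<in> Yspace p"
        then obtain n where "y \<in> S n" using cover by blast
        moreover have "S n \<subseteq> Y.mtopology closure_of S n" using SY by (intro closure_of_subset) simp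
        ultimately show "y \<in> \<Union> (range (\<lambda>n. Y.mtopology closure_of S n))" by blast
      qed
    qed
    ultimately have "Y.mtopology interior_of (Yspace p :: (int ^ 'n \<Rightarrow> 'u) set) = {}" by simp
    moreover have "Y.mtopology interior_of (topspace Y.mtopology) = topspace Y.mtopology"
      by (rule interior_of_topspace)
    ultimately show False using Yspace_0[OF p] by auto
  qed
  then obtain n y0 \<epsilon> where y0: "y0 \<in> Yspace p" and \<epsilon>: "0 < \<epsilon>"
    and ball: "Y.mball y0 \<epsilon> \<subseteq> Y.mtopology closure_of S n"
    unfolding Y.in_interior_of_mball ex_in_conv[symmetric] by blast
  have approx: "\<exists>x a. x \<in> Yspace p \<and> Ynorm p x \<le> n \<and> (\<forall>e\<in>B. cmod (a e) \<le> n) \<and> Ynorm p (y - \<Phi> x a) < \<eta>"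
    if y: "y \<in> Yspace p" "Ynorm p (y0 - y) < \<epsilon>" and \<eta>: "0 < \<eta>" for y \<eta>
  proof -
    have "y \<in> Y.mball y0 \<epsilon>" using y y0 by (simp add: Ydist_def)
    then have "y \<in> Y.mtopology closure_of S n" using ball by blast
    then obtain s where "s \<in> S n" "s \<in> Y.mball y \<eta>" using \<eta> unfolding Y.metric_closure_of by blast
    then have "Ynorm p (y - s) < \<eta>" using SY[of n] y(1) by (auto simp: Ydist_def)
    moreover from \<open>s \<in> S n\<close> obtain x a where "s = \<Phi> x a" "x \<in> Yspace p" "Ynorm p x \<le> n"
      "\<forall>e\<in>B. cmod (a e) \<le> n" unfolding S_def by blast
    ultimately show ?thesis by blast
  qed
  define K where "K = 4 * real n / \<epsilon>"
  show ?thesis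
  proof (rule that[of K])
    show "0 \<le> K" using \<epsilon> by (simp add: K_def)
    fix y :: "int ^ 'n \<Rightarrow> 'u" and t :: real assume y: "y \<in> Yspace p" and t: "0 < t" and yt: "Ynorm p y \<le> t"
    \<comment> \<open>the factor that moves \<open>y\<close> into the ball of radius \<open>\<epsilon>\<close> about the origin\<close>
    define c where "c = complex_of_real (\<epsilon> / (2 * t))"
    have c: "cmod c = \<epsilon> / (2 * t)" "c \<noteq> 0" using \<epsilon> t unfolding c_def norm_of_real by auto
    have cy: "cscale c y \<in> Yspace p" by (rule Yspace_cscale(1)[OF p y])
    have "cmod c * Ynorm p y \<le> cmod c * t" using yt by (intro mult_left_mono) auto
    then have "Ynorm p (cscale c y) < \<epsilon>" using Yspace_cscale(2)[OF p y, of c] c t \<epsilon> by simp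
    then have "Ynorm p (y0 - (y0 + cscale c y)) < \<epsilon>"
      using Ynorm_uminus[of p "cscale c y"] by simp
    from approx[OF Yspace_add(1)[OF p y0 cy] this, of "\<epsilon> / 8"] obtain x1 a1
      where 1: "x1 \<in> Yspace p" "Ynorm p x1 \<le> n" "\<And>e. e \<in> B \<Longrightarrow> cmod (a1 e) \<le> n"
        "Ynorm p (y0 + cscale c y - \<Phi> x1 a1) < \<epsilon> / 8" using \<epsilon> by auto
    have "Ynorm p (y0 - y0) < \<epsilon>" using \<epsilon> by (simp add: Ynorm_0[OF p])
    from approx[OF y0 this, of "\<epsilon> / 8"] obtain x2 a2
      where 2: "x2 \<in> Yspace p" "Ynorm p x2 \<le> n" "\<And>e. e \<in> B \<Longrightarrow> cmod (a2 e) \<le> n"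
        "Ynorm p (y0 - \<Phi> x2 a2) < \<epsilon> / 8" using \<epsilon> by auto
    define x where "x = cscale (inverse c) (x1 - x2)"
    define a where "a = (\<lambda>e. inverse c * (a1 e - a2 e))"
    have ic: "cmod (inverse c) = 2 * t / \<epsilon>" using c by (simp add: norm_inverse)
    have x12: "x1 - x2 \<in> Yspace p" "Ynorm p (x1 - x2) \<le> 2 * n"
      using Yspace_diff[OF p 1(1) 2(1)] 1(2) 2(2) by auto
    have "Ynorm p x \<le> K * t"
    proof -
      have "Ynorm p x = 2 * t / \<epsilon> * Ynorm p (x1 - x2)"
        unfolding x_def using Yspace_cscale(2)[OF p x12(1)] ic by simp
      also have "\<dots> \<le> 2 * t / \<epsilon> * (2 * n)" using x12(2) t \<epsilon> by (intro mult_left_mono) auto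
      also have "\<dots> = K * t" by (simp add: K_def)
      finally show ?thesis .
    qed
    moreover have "cmod (a e) \<le> K * t" if e: "e \<in> B" for e
    proof -
      have "cmod (a1 e - a2 e) \<le> 2 * n"
        using norm_triangle_ineq4[of "a1 e" "a2 e"] 1(3)[OF e] 2(3)[OF e] by linarith
      then have "cmod (a e) \<le> 2 * t / \<epsilon> * (2 * n)"
        unfolding a_def norm_mult ic using t \<epsilon> by (intro mult_left_mono) auto
      also have "\<dots> = K * t" by (simp add: K_def)
      finally show ?thesis .
    qed
    moreover have "Ynorm p (y - \<Phi> x a) \<le> t / 2"
    proof -
      have "y - \<Phi> x a = cscale (inverse c) ((y0 + cscale c y - \<Phi> x1 a1) - (y0 - \<Phi> x2 a2))"
      proof -
        have "\<Phi> x a = cscale (inverse c) (\<Phi> x1 a1 - \<Phi> x2 a2)"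
          unfolding x_def a_def \<Phi>sc[OF x12(1)] \<Phi>diff[OF 1(1) 2(1)] ..
        moreover have "y = cscale (inverse c) (cscale c y)"
          using c(2) by (simp add: cs.scale_scale)
        moreover have "(y0 + cscale c y - \<Phi> x1 a1) - (y0 - \<Phi> x2 a2) = cscale c y - (\<Phi> x1 a1 - \<Phi> x2 a2)"
          by (simp add: algebra_simps)
        ultimately show ?thesis by (metis cs.scale_right_diff_distrib)
      qed
      moreover have 3: "y0 + cscale c y - \<Phi> x1 a1 \<in> Yspace p" "y0 - \<Phi> x2 a2 \<in> Yspace p"
        by (intro Yspace_add Yspace_diff p y0 cy \<Phi>Y 1 2)+
      ultimately have "Ynorm p (y - \<Phi> x a)
          = 2 * t / \<epsilon> * Ynorm p ((y0 + cscale c y - \<Phi> x1 a1) - (y0 - \<Phi> x2 a2))"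
        using Yspace_cscale(2)[OF p Yspace_diff(1)[OF p 3], of "inverse c"] ic by simp
      also have "\<dots> \<le> 2 * t / \<epsilon> * (\<epsilon> / 4)"
        using Yspace_diff(2)[OF p 3] 1(4) 2(4) t \<epsilon> by (intro mult_left_mono) auto
      also have "\<dots> = t / 2" using \<epsilon> by simp
      finally show ?thesis .
    qed
    moreover have "x \<in> Yspace p" unfolding x_def by (rule Yspace_cscale(1)[OF p x12(1)])
    ultimately show "\<exists>x a. x \<in> Yspace p \<and> Ynorm p x \<le> K * t \<and>
      (\<forall>e\<in>B. cmod (a e) \<le> K * t) \<and> Ynorm p (y - (T x + (\<Sum>e\<in>B. cscale (a e) e))) \<le> t / 2"
      unfolding \<Phi>_def by blast
  qed
qed

text \<open>The approximation is iterated with the remainder as the new right-hand side, and the corrections are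
  summed. This represents \<open>T x\<close> as the image of a vector of controlled norm plus a combination of \<open>B\<close>,
  and the combination vanishes because \<open>B\<close> is independent modulo the range.\<close>
lemma open_mapping_finite_codim:
  fixes T :: "(int ^ 'n \<Rightarrow> 'u::{complex_normed_vector, banach}) \<Rightarrow> int ^ 'n \<Rightarrow> 'u"
  assumes p: "admissible p" and T: "bounded_op_on p T" and B: "finite B" "B \<subseteq> Yspace p"
    and surj: "\<And>y. y \<in> Yspace p \<Longrightarrow> \<exists>x\<in>Yspace p. y - T x \<in> cs.span B"
    and indep: "\<And>a x. x \<in> Yspace p \<Longrightarrow> (\<Sum>e\<in>B. cscale (a e) e) = T x \<Longrightarrow> \<forall>e\<in>B. a e = 0"
  obtains C where "0 \<le> C"
    "\<And>x. x \<in> Yspace p \<Longrightarrow> \<exists>x'\<in>Yspace p. T x' = T x \<and> Ynorm p x' \<le> C * Ynorm p (T x)"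
proof -
  obtain K where K0: "0 \<le> K"
    and K: "\<And>y t. y \<in> Yspace p \<Longrightarrow> 0 < t \<Longrightarrow> Ynorm p y \<le> t \<Longrightarrow> \<exists>x a. x \<in> Yspace p \<and> Ynorm p x \<le> K * t \<and>
      (\<forall>e\<in>B. cmod (a e) \<le> K * t) \<and> Ynorm p (y - (T x + (\<Sum>e\<in>B. cscale (a e) e))) \<le> t / 2"
    using open_mapping_step[OF p T B surj] by blast
  have TY: "T x \<in> Yspace p" if "x \<in> Yspace p" for x using T that by (auto simp: bounded_op_on_def)
  have Tadd: "T (x + y) = T x + T y" if "x \<in> Yspace p" "y \<in> Yspace p" for x y
    using T that by (auto simp: bounded_op_on_def)
  have Tdiff: "T (x - y) = T x - T y" if "x \<in> Yspace p" "y \<in> Yspace p" for x y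
  proof -
    have "T (x - y + y) = T (x - y) + T y" by (intro Tadd Yspace_diff p that)
    then show ?thesis by (simp only: diff_add_cancel eq_diff_eq)
  qed
  have T0: "T 0 = 0"
    using Tdiff[OF Yspace_0[OF p] Yspace_0[OF p]] by (simp only: diff_self)
  obtain CT where CT: "\<And>x. x \<in> Yspace p \<Longrightarrow> Ynorm p (T x) \<le> CT * Ynorm p x"
    using T unfolding bounded_op_on_def by blast
  have BY: "(\<Sum>e\<in>B. cscale (a e) e) \<in> Yspace p" for a
    using B by (intro conjunct1[OF Yspace_sum[OF p]] Yspace_cscale(1)[OF p]) auto
  show ?thesis
  proof (rule that[of "2 * K"])
    show "0 \<le> 2 * K" using K0 by simp
    fix x0 :: "int ^ 'n \<Rightarrow> 'u" assume x0: "x0 \<in> Yspace p"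
    define t where "t = Ynorm p (T x0)"
    have t0: "0 \<le> t" unfolding t_def by (rule Ynorm_nonneg[OF p TY[OF x0]])
    show "\<exists>x'\<in>Yspace p. T x' = T x0 \<and> Ynorm p x' \<le> 2 * K * Ynorm p (T x0)"
    proof (cases "t = 0")
      case True
      then have "T x0 = 0" using Ynorm_eq_0[OF p TY[OF x0]] by (simp add: t_def)
      then show ?thesis using Yspace_0[OF p] T0 by (intro bexI[of _ 0]) (simp_all add: Ynorm_0[OF p])
    next
      case False
      then have t: "0 < t" using t0 by simp
      define good where "good = (\<lambda>n y x a. x \<in> Yspace p \<and> Ynorm p x \<le> K * (t * (1 / 2) ^ n) \<and>
        (\<forall>e\<in>B. cmod (a e) \<le> K * (t * (1 / 2) ^ n)) \<and>
        Ynorm p (y - (T x + (\<Sum>e\<in>B. cscale (a e) e))) \<le> t * (1 / 2) ^ n / 2)"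
      have ex: "\<exists>xa. good n y (fst xa) (snd xa)" if yy: "y \<in> Yspace p" "Ynorm p y \<le> t * (1 / 2) ^ n" for n y
      proof -
        have "0 < t * (1 / 2) ^ n" using t by simp
        then obtain x a where "good n y x a" using K[OF yy(1) _ yy(2)] unfolding good_def by blast
        then show ?thesis by (intro exI[of _ "(x, a)"]) simp
      qed
      define F where "F = (\<lambda>n y. SOME xa. good n y (fst xa) (snd xa))"
      have F: "good n y (fst (F n y)) (snd (F n y))"
        if "y \<in> Yspace p" "Ynorm p y \<le> t * (1 / 2) ^ n" for n y
        unfolding F_def using ex[OF that] by (rule someI_ex)
      define step where "step = (\<lambda>n y. y - (T (fst (F n y)) + (\<Sum>e\<in>B. cscale (snd (F n y) e) e)))"
      define Y where "Y = rec_nat (T x0) step"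
      have Y_Suc: "Y (Suc n) = step n (Y n)" for n by (simp add: Y_def)
      define x where "x = (\<lambda>n. fst (F n (Y n)))"
      define a where "a = (\<lambda>n. snd (F n (Y n)))"
      have Y: "Y n \<in> Yspace p \<and> Ynorm p (Y n) \<le> t * (1 / 2) ^ n" for n
      proof (induction n)
        case 0
        then show ?case using TY[OF x0] by (simp add: Y_def t_def)
      next
        case (Suc n)
        then have "good n (Y n) (fst (F n (Y n))) (snd (F n (Y n)))" by (intro F) auto
        then have *: "fst (F n (Y n)) \<in> Yspace p" "Ynorm p (step n (Y n)) \<le> t * (1 / 2) ^ n / 2"
          unfolding good_def step_def by auto
        have "step n (Y n) \<in> Yspace p"
          unfolding step_def by (intro Yspace_diff Yspace_add p TY BY *(1) conjunct1[OF Suc])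
        then show ?case using *(2) unfolding Y_Suc by simp
      qed
      have good: "good n (Y n) (x n) (a n)" for n
        unfolding x_def a_def by (intro F conjunct1[OF Y] conjunct2[OF Y])
      have xY: "x n \<in> Yspace p" and xn: "Ynorm p (x n) \<le> K * t * (1 / 2) ^ n"
        and an: "e \<in> B \<Longrightarrow> cmod (a n e) \<le> K * t * (1 / 2) ^ n" for n e
        using good[of n] unfolding good_def by (simp_all only: mult.assoc)
      obtain X where X: "X \<in> Yspace p" "\<And>N. Ynorm p (X - (\<Sum>n<N. x n)) \<le> 2 * (K * t) * (1 / 2) ^ N"
        by (rule Yspace_series[OF p xY xn]) (rule that)
      define A where "A = (\<lambda>e. \<Sum>n. a n e)"
      have A: "(\<lambda>N. \<Sum>n<N. a n e) \<longlonglongrightarrow> A e" if "e \<in> B" for e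
        unfolding A_def
        by (rule summable_LIMSEQ[OF summable_norm_cancel[OF summable_norm_geometric_bound[OF an[OF that]]]])
      have sumY: "(\<Sum>n<N. x n) \<in> Yspace p" for N
        by (intro conjunct1[OF Yspace_sum[OF p]] xY) simp
      have partial: "T x0 = Y N + (T (\<Sum>n<N. x n) + (\<Sum>e\<in>B. cscale (\<Sum>n<N. a n e) e))" for N
      proof (induction N)
        case 0
        have "(\<Sum>e\<in>B. cscale 0 e) = 0" by (intro sum.neutral) (auto simp: cs.scale_zero_left)
        then show ?case unfolding lessThan_0 sum.empty T0 by (simp only: Y_def add_0 add_0_right) simp
      next
        case (Suc N)
        have "T (\<Sum>n<Suc N. x n) = T (\<Sum>n<N. x n) + T (x N)"
          unfolding sum.lessThan_Suc by (intro Tadd sumY xY)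
        moreover have "(\<Sum>e\<in>B. cscale (\<Sum>n<Suc N. a n e) e)
            = (\<Sum>e\<in>B. cscale (\<Sum>n<N. a n e) e) + (\<Sum>e\<in>B. cscale (a N e) e)"
          by (simp only: sum.lessThan_Suc cs.scale_left_distrib sum.distrib)
        moreover have "Y N = Y (Suc N) + (T (x N) + (\<Sum>e\<in>B. cscale (a N e) e))"
          unfolding Y_Suc step_def x_def a_def by simp
        ultimately show ?case using Suc by (simp only: ac_simps)
      qed
      have "T x0 = T X + (\<Sum>e\<in>B. cscale (A e) e)"
      proof -
        define R where "R = T x0 - (T X + (\<Sum>e\<in>B. cscale (A e) e))"
        have RY: "R \<in> Yspace p" unfolding R_def by (intro Yspace_diff Yspace_add p TY x0 X(1) BY)
        have Rle: "Ynorm p R \<le> t * (1 / 2) ^ N + \<bar>CT\<bar> * (2 * (K * t) * (1 / 2) ^ N)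
            + (\<Sum>e\<in>B. cmod ((\<Sum>n<N. a n e) - A e) * Ynorm p e)" for N
        proof -
          let ?r = "X - (\<Sum>n<N. x n)"
          let ?s = "\<Sum>e\<in>B. cscale ((\<Sum>n<N. a n e) - A e) e"
          have r: "?r \<in> Yspace p" by (intro Yspace_diff p X(1) sumY)
          have eq: "R = Y N - T ?r + ?s"
            unfolding R_def partial[of N] Tdiff[OF X(1) sumY] cs.scale_left_diff_distrib sum_subtractf
            by (simp add: algebra_simps)
          have "Ynorm p R \<le> Ynorm p (Y N - T ?r) + Ynorm p ?s"
            unfolding eq by (intro Yspace_add(2) Yspace_diff(1) p BY TY r conjunct1[OF Y])
          moreover have "Ynorm p (Y N - T ?r) \<le> Ynorm p (Y N) + Ynorm p (T ?r)"
            by (intro Yspace_diff(2) p TY r conjunct1[OF Y])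
          moreover have "Ynorm p (Y N) \<le> t * (1 / 2) ^ N" using Y by blast
          moreover have "Ynorm p (T ?r) \<le> \<bar>CT\<bar> * (2 * (K * t) * (1 / 2) ^ N)"
          proof -
            have "Ynorm p (T ?r) \<le> CT * Ynorm p ?r" by (rule CT[OF r])
            also have "\<dots> \<le> \<bar>CT\<bar> * Ynorm p ?r" using Ynorm_nonneg[OF p r] by (intro mult_right_mono) auto
            also have "\<dots> \<le> \<bar>CT\<bar> * (2 * (K * t) * (1 / 2) ^ N)" using X(2) by (intro mult_left_mono) auto
            finally show ?thesis .
          qed
          moreover have "Ynorm p ?s \<le> (\<Sum>e\<in>B. cmod ((\<Sum>n<N. a n e) - A e) * Ynorm p e)"
          proof -
            have "Ynorm p ?s \<le> (\<Sum>e\<in>B. Ynorm p (cscale ((\<Sum>n<N. a n e) - A e) e))"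
              using B by (intro conjunct2[OF Yspace_sum[OF p]] Yspace_cscale(1)[OF p]) auto
            also have "\<dots> = (\<Sum>e\<in>B. cmod ((\<Sum>n<N. a n e) - A e) * Ynorm p e)"
              using B by (intro sum.cong Yspace_cscale(2)[OF p]) auto
            finally show ?thesis .
          qed
          ultimately show ?thesis by linarith
        qed
        have "(\<lambda>N. t * (1 / 2) ^ N + \<bar>CT\<bar> * (2 * (K * t) * (1 / 2) ^ N)
            + (\<Sum>e\<in>B. cmod ((\<Sum>n<N. a n e) - A e) * Ynorm p e)) \<longlonglongrightarrow> 0 + 0 + 0"
          by (intro tendsto_add tendsto_mult_right_zero LIMSEQ_realpow_zero tendsto_null_sum
              tendsto_mult_left_zero tendsto_norm_zero LIM_zero A) auto
        then have "Ynorm p R \<le> 0"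
          using LIMSEQ_le_const[of _ "0 + 0 + 0" "Ynorm p R"] Rle by auto
        then have "R = 0" by (rule Ynorm_eq_0[OF p RY])
        then show ?thesis unfolding R_def by (simp only: right_minus_eq)
      qed
      then have eq: "(\<Sum>e\<in>B. cscale (A e) e) = T (x0 - X)"
        unfolding Tdiff[OF x0 X(1)] by simp
      have "\<forall>e\<in>B. A e = 0" by (rule indep[OF Yspace_diff(1)[OF p x0 X(1)] eq])
      then have "(\<Sum>e\<in>B. cscale (A e) e) = 0" by (intro sum.neutral) (auto simp: cs.scale_zero_left)
      then have "T X = T x0" using eq unfolding Tdiff[OF x0 X(1)] by (simp only: right_minus_eq)
      moreover have "Ynorm p X \<le> 2 * K * Ynorm p (T x0)"
        using X(2)[of 0] unfolding lessThan_0 sum.empty diff_zero by (simp add: t_def mult.assoc)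
      ultimately show ?thesis using X(1) by blast
    qed
  qed
qed

text \<open>Among the finite sets that span the space modulo the range, one of minimal cardinality is
  independent modulo the range.\<close>
lemma fredholm_open_mapping:
  fixes T :: "(int ^ 'n \<Rightarrow> 'u::{complex_normed_vector, banach}) \<Rightarrow> int ^ 'n \<Rightarrow> 'u"
  assumes p: "admissible p" and fr: "fredholm_on p T"
  obtains C where "0 \<le> C"
    "\<And>x. x \<in> Yspace p \<Longrightarrow> \<exists>x'\<in>Yspace p. T x' = T x \<and> Ynorm p x' \<le> C * Ynorm p (T x)"
proof -
  have T: "bounded_op_on p T" using fr by (simp add: fredholm_on_def)
  define Q where "Q = (\<lambda>B. finite B \<and> B \<subseteq> Yspace p \<and> (\<forall>y\<in>Yspace p. \<exists>x\<in>Yspace p. y - T x \<in> cs.span B))"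
  have "\<exists>B. Q B" using fr unfolding fredholm_on_def Q_def by blast
  then obtain B where B: "Q B" and min: "\<And>B'. Q B' \<Longrightarrow> card B \<le> card B'"
    using ex_has_least_nat[of Q _ card] by blast
  have fB: "finite B" and BY: "B \<subseteq> Yspace p"
    and surj: "\<And>y. y \<in> Yspace p \<Longrightarrow> \<exists>x\<in>Yspace p. y - T x \<in> cs.span B"
    using B by (auto simp: Q_def)
  have indep: "\<forall>e\<in>B. a e = 0" if x0: "x0 \<in> Yspace p" and eq: "(\<Sum>e\<in>B. cscale (a e) e) = T x0" for a x0
  proof (rule ccontr)
    assume "\<not> (\<forall>e\<in>B. a e = 0)"
    then obtain e0 where e0: "e0 \<in> B" "a e0 \<noteq> 0" by blast
    have "\<exists>x\<in>Yspace p. y - T x \<in> cs.span (B - {e0})" if y: "y \<in> Yspace p" for y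
    proof -
      obtain x where x: "x \<in> Yspace p" "y - T x \<in> cs.span B" using surj[OF y] by blast
      then obtain c where c: "y - T x = (\<Sum>e\<in>B. cscale (c e) e)"
        unfolding cs.span_finite[OF fB] by blast
      define q where "q = c e0 / a e0"
      have qx: "cscale q x0 \<in> Yspace p" by (rule Yspace_cscale(1)[OF p x0])
      have "T (x + cscale q x0) = T x + cscale q (\<Sum>e\<in>B. cscale (a e) e)"
        using T x(1) qx x0 unfolding bounded_op_on_def eq by auto
      then have "y - T (x + cscale q x0) = (\<Sum>e\<in>B. cscale (c e) e) - cscale q (\<Sum>e\<in>B. cscale (a e) e)"
        unfolding c[symmetric] by (simp only: diff_diff_add)
      also have "\<dots> = (\<Sum>e\<in>B. cscale (c e - q * a e) e)"
        by (simp only: cs.scale_sum_right cs.scale_scale cs.scale_left_diff_distrib sum_subtractf)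
      also have "\<dots> = (\<Sum>e\<in>B - {e0}. cscale (c e - q * a e) e)"
        using fB e0 by (intro sum.mono_neutral_right) (auto simp: q_def cs.scale_zero_left)
      also have "\<dots> \<in> cs.span (B - {e0})"
        by (intro cs.span_sum cs.span_scale cs.span_base) auto
      finally show ?thesis using Yspace_add(1)[OF p x(1) qx] by blast
    qed
    then have "Q (B - {e0})" using fB BY by (auto simp: Q_def)
    then have "card B \<le> card (B - {e0})" by (rule min)
    then show False using card_Diff1_less[OF fB e0(1)] by simp
  qed
  show ?thesis
  proof (rule open_mapping_finite_codim[OF p T fB BY])
    show "\<exists>x\<in>Yspace p. y - T x \<in> cs.span B" if "y \<in> Yspace p" for y by (rule surj[OF that])
    show "\<forall>e\<in>B. a e = 0" if "x \<in> Yspace p" "(\<Sum>e\<in>B. cscale (a e) e) = T x" for a x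
      by (rule indep[OF that])
  qed (rule that)
qed

text \<open>Suppose that \<open>x\<close> has finite support and violates the bound. With \<open>q\<close> one more than the size of a finite
  spanning set of the kernel, take \<open>q\<close> translates of \<open>x\<close> by almost periods, with disjoint supports. Each differs from a kernel
  vector by a vector of small norm. A nontrivial relation between these kernel vectors, scaled so that its
  largest coefficient is 1, makes a combination of the translates small; but by disjointness the norm of
  this combination is at least that of a single translate.\<close>
lemma fredholm_imp_bounded_below:
  fixes l b :: "int ^ 'n \<Rightarrow> 'u::{complex_normed_vector, banach} \<Rightarrow>\<^sub>L 'u"
  assumes l: "wiener_symbol l" and b: "ap_function b" and p: "admissible p"
    and fr: "fredholm_on p (wiener_op l b)"
  obtains nu where "0 < nu"
    "\<And>x. finite {m. x m \<noteq> 0} \<Longrightarrow> nu * Ynorm p x \<le> Ynorm p (wiener_op l b x)"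
proof -
  let ?W = "wiener_op l b"
  have bL: "b \<in> linf_LU" using b by (simp add: ap_function_def)
  obtain C where C0: "0 \<le> C"
    and C: "\<And>x. x \<in> Yspace p \<Longrightarrow> \<exists>x'\<in>Yspace p. ?W x' = ?W x \<and> Ynorm p x' \<le> C * Ynorm p (?W x)"
    by (rule fredholm_open_mapping[OF p fr]) (rule that)
  obtain K where K: "finite K" "{x \<in> Yspace p. ?W x = 0} = cs.span K"
    using fr by (auto simp: fredholm_on_def finite_dimensional_def)
  define q where "q = card K + 1"
  \<comment> \<open>the \<open>q\<close> corrections, each of norm at most \<open>2 C \<eta>\<close> times that of \<open>x\<close>, add up to at most half of the norm of \<open>x\<close>\<close>
  define \<eta> where "\<eta> = 1 / (4 * real q * (C + 1))"
  have \<eta>: "0 < \<eta>" using C0 by (simp add: \<eta>_def q_def)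
  obtain D :: nat where D: "\<And>(g :: nat \<Rightarrow> int ^ 'n) R.
      \<forall>i j. i \<noteq> j \<longrightarrow> int (2 * D + R + 1) \<le> zabs (g i - g j) \<Longrightarrow>
      \<exists>\<kappa>. (\<forall>j. zabs (\<kappa> j - g j) \<le> int D) \<and> (\<forall>j m. norm (b (m + \<kappa> j) - b m) \<le> \<eta>) \<and>
        (\<forall>i j. i \<noteq> j \<longrightarrow> int R < zabs (\<kappa> i - \<kappa> j))"
    by (rule separated_periods[OF _ \<eta>, of b]) (use b in \<open>auto simp: ap_function_def\<close>)
  show ?thesis
  proof (rule that[OF \<eta>])
    fix x :: "int ^ 'n \<Rightarrow> 'u" assume fx: "finite {m. x m \<noteq> 0}"
    have xY: "x \<in> Yspace p" by (rule Yspace_finite_support(1)[OF p fx]) auto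
    show "\<eta> * Ynorm p x \<le> Ynorm p (?W x)"
    proof (rule ccontr)
      assume "\<not> \<eta> * Ynorm p x \<le> Ynorm p (?W x)"
      then have small: "Ynorm p (?W x) < \<eta> * Ynorm p x" by simp
      define X where "X = Ynorm p x"
      have "0 \<le> Ynorm p (?W x)" by (rule Ynorm_nonneg[OF p wiener_op_Yspace[OF l bL p xY]])
      then have "0 < \<eta> * X" using small by (simp add: X_def)
      then have X0: "0 < X" using \<eta> by (simp add: zero_less_mult_iff)
      obtain \<rho> where x_supp: "\<And>m. x m \<noteq> 0 \<Longrightarrow> zabs m \<le> int \<rho>"
        by (rule support_radius[OF fx]) (rule that)
      define P where "P = 2 * D + 2 * \<rho> + 1"
      define g :: "nat \<Rightarrow> int ^ 'n" where "g = (\<lambda>i. \<chi> _. int P * int i)"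
      have gap: "\<forall>i j. i \<noteq> j \<longrightarrow> int (2 * D + 2 * \<rho> + 1) \<le> zabs (g i - g j)"
      proof (intro allI impI)
        fix i j :: nat assume ne: "i \<noteq> j"
        have "int P * 1 \<le> int P * \<bar>int i - int j\<bar>" using ne by (intro mult_left_mono) auto
        also have "\<dots> = \<bar>(g i - g j) $ undefined\<bar>" by (simp add: g_def abs_mult flip: right_diff_distrib)
        also have "\<dots> \<le> zabs (g i - g j)" by (rule abs_component_le_zabs)
        finally show "int (2 * D + 2 * \<rho> + 1) \<le> zabs (g i - g j)" by (simp add: P_def)
      qed
      from D[of "2 * \<rho>" g, OF gap] obtain \<kappa> where k: "(\<forall>j. zabs (\<kappa> j - g j) \<le> int D) \<and>
          (\<forall>j m. norm (b (m + \<kappa> j) - b m) \<le> \<eta>) \<and> (\<forall>i j. i \<noteq> j \<longrightarrow> int (2 * \<rho>) < zabs (\<kappa> i - \<kappa> j))"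
        by (elim exE)
      have \<kappa>: "\<And>i m. norm (b (m + \<kappa> i) - b m) \<le> \<eta>"
        and apart: "\<And>i j. i \<noteq> j \<Longrightarrow> 2 * int \<rho> < zabs (\<kappa> i - \<kappa> j)"
        using k by simp_all
      define V where "V = (\<lambda>i. shift (- \<kappa> i) x)"
      have VY: "V i \<in> Yspace p" and Vn: "Ynorm p (V i) = X" for i
        using Yspace_shift[OF p xY] by (auto simp: V_def X_def)
      have V_supp: "zabs (m - \<kappa> i) \<le> int \<rho>" if "V i m \<noteq> 0" for i m
        using x_supp[of "m - \<kappa> i"] that by (simp add: V_def shift_def)
      have V_disj: "V j m = 0" if "V i m \<noteq> 0" "j \<noteq> i" for i j m
      proof (rule ccontr)
        assume "V j m \<noteq> 0"
        then show False
          using V_supp[of j m] V_supp[OF that(1)] apart[OF that(2)] zabs_diff_triangle[of "\<kappa> j" "\<kappa> i" m]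
            zabs_minus_commute[of "\<kappa> j" m] by simp
      qed
      have WV: "Ynorm p (?W (V i)) \<le> 2 * \<eta> * X" for i
      proof -
        have sbL: "shift (\<kappa> i) b \<in> linf_LU" using shift_linf[OF bL] by (simp add: shift_def)
        have sV: "shift (\<kappa> i) (V i) = x" by (simp add: V_def shift_def)
        have "shift (\<kappa> i) (?W (V i)) = wiener_op l (shift (\<kappa> i) b) x"
          unfolding wiener_op_shift[symmetric] sV ..
        then have "Ynorm p (?W (V i)) = Ynorm p (wiener_op l (shift (\<kappa> i) b) x)"
          using Yspace_shift(2)[OF p wiener_op_Yspace[OF l bL p VY], of "\<kappa> i" i] by simp
        also have "\<dots> = Ynorm p ((wiener_op l (shift (\<kappa> i) b) x - ?W x) + ?W x)"
          by (simp only: diff_add_cancel)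
        also have "\<dots> \<le> Ynorm p (wiener_op l (shift (\<kappa> i) b) x - ?W x) + Ynorm p (?W x)"
          by (intro Yspace_add(2) Yspace_diff(1) p wiener_op_Yspace[OF l bL p xY] wiener_op_Yspace[OF l sbL p xY])
        also have "Ynorm p (wiener_op l (shift (\<kappa> i) b) x - ?W x) \<le> \<eta> * Ynorm p x"
          by (rule wiener_op_perturb[OF l sbL p xY]) (auto simp: shift_def \<kappa>)
        finally show ?thesis using small unfolding X_def by linarith
      qed
      have "\<exists>v. v \<in> Yspace p \<and> ?W v = ?W (V i) \<and> Ynorm p v \<le> C * (2 * \<eta> * X)" for i
      proof -
        obtain v where v: "v \<in> Yspace p" "?W v = ?W (V i)" "Ynorm p v \<le> C * Ynorm p (?W (V i))"
          using C[OF VY] by blast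
        have "C * Ynorm p (?W (V i)) \<le> C * (2 * \<eta> * X)" using WV C0 by (rule mult_left_mono)
        then show ?thesis using v by (intro exI[of _ v]) auto
      qed
      then obtain v where vY: "\<And>i. v i \<in> Yspace p" and Wv: "\<And>i. ?W (v i) = ?W (V i)"
        and vn: "\<And>i. Ynorm p (v i) \<le> C * (2 * \<eta> * X)" by metis
      have ker: "V i - v i \<in> cs.span K" for i
      proof -
        have "?W (V i - v i) = ?W (V i) - ?W (v i)"
          by (intro wiener_op_diff[OF l bL] Yspace_subset_infinity[OF p] VY vY)
        then have "?W (V i - v i) = 0" unfolding Wv by (simp only: diff_self)
        then show ?thesis using K(2) Yspace_diff(1)[OF p VY vY] by blast
      qed
      then have sub: "(\<lambda>i. V i - v i) ` {..<q} \<subseteq> cs.span K" by blast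
      have "card K < card {..<q}" by (simp add: q_def)
      from cs.exists_nontrivial_relation[OF finite_lessThan K(1) this sub]
      obtain a where a: "\<exists>i\<in>{..<q}. a i \<noteq> 0" "(\<Sum>i<q. cscale (a i) (V i - v i)) = 0" by blast
      obtain i0 where i0: "i0 < q" "\<And>i. i < q \<Longrightarrow> cmod (a i) \<le> cmod (a i0)"
      proof (rule exists_max_cmod[of "{..<q}" a])
        show "{..<q} \<noteq> {}" by (auto simp: q_def)
        fix j assume "j \<in> {..<q}" "\<And>i. i \<in> {..<q} \<Longrightarrow> cmod (a i) \<le> cmod (a j)"
        then show thesis by (intro that[of j]) auto
      qed simp
      have a0: "0 < cmod (a i0)" using a(1) i0(2) by force
      have eq: "(\<Sum>i<q. cscale (a i) (V i)) = (\<Sum>i<q. cscale (a i) (v i))"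
        using a(2) unfolding cs.scale_right_diff_distrib sum_subtractf by (simp only: right_minus_eq)
      have sY: "(\<Sum>i<q. cscale (a i) (V i)) \<in> Yspace p"
        by (intro conjunct1[OF Yspace_sum[OF p]] Yspace_cscale(1)[OF p VY]) simp
      have "cmod (a i0) * X = Ynorm p (cscale (a i0) (V i0))"
        using Yspace_cscale(2)[OF p VY] Vn by simp
      also have "\<dots> \<le> Ynorm p (\<Sum>i<q. cscale (a i) (V i))"
      proof (rule Yspace_solid(2)[OF p sY])
        fix m
        show "norm (cscale (a i0) (V i0) m) \<le> norm ((\<Sum>i<q. cscale (a i) (V i)) m)"
        proof (cases "V i0 m = 0")
          case False
          have "(\<Sum>i<q. cscale (a i) (V i)) m = (\<Sum>i<q. if i = i0 then a i0 *\<^sub>C V i0 m else 0)"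
            unfolding sum_fun_apply using V_disj[OF False] by (intro sum.cong) (auto simp: cscale_def)
          then show ?thesis using i0(1) by (simp add: cscale_def)
        qed (simp add: cscale_def)
      qed
      also have "\<dots> = Ynorm p (\<Sum>i<q. cscale (a i) (v i))" unfolding eq ..
      also have "\<dots> \<le> (\<Sum>i<q. Ynorm p (cscale (a i) (v i)))"
        by (intro conjunct2[OF Yspace_sum[OF p]] Yspace_cscale(1)[OF p vY]) simp
      also have "\<dots> \<le> (\<Sum>i<q. cmod (a i0) * (C * (2 * \<eta> * X)))"
      proof (rule sum_mono)
        fix i assume "i \<in> {..<q}"
        then show "Ynorm p (cscale (a i) (v i)) \<le> cmod (a i0) * (C * (2 * \<eta> * X))"
          unfolding Yspace_cscale(2)[OF p vY]
          using i0(2) vn Ynorm_nonneg[OF p vY] by (intro mult_mono) auto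
      qed
      also have "\<dots> = cmod (a i0) * X * (real q * C * 2 * \<eta>)" by simp
      also have "\<dots> < cmod (a i0) * X * 1"
      proof (rule mult_strict_left_mono)
        have "real q * C * 2 * \<eta> \<le> real q * (C + 1) * 2 * \<eta>"
          using \<eta> by (intro mult_right_mono mult_left_mono) auto
        also have "4 * real q * (C + 1) * \<eta> = 1" using C0 by (simp add: \<eta>_def q_def)
        then have "real q * (C + 1) * 2 * \<eta> = 1 / 2" by (simp add: algebra_simps)
        finally show "real q * C * 2 * \<eta> < 1" by simp
        show "0 < cmod (a i0) * X" using a0 X0 by simp
      qed
      finally show False by simp
    qed
  qed
qed

text \<open>By stability the lower bound may be transferred to the exponent \<open>\<infinity>\<close>. There it passes to the hull,
  since \<open>wiener_op l c\<close> is a norm limit of operators that are conjugate to \<open>wiener_op l b\<close> by translations, which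
  are isometries.\<close>
lemma bounded_below_imp_injective:
  fixes l b c :: "int ^ 'n \<Rightarrow> 'u::{complex_normed_vector, banach} \<Rightarrow>\<^sub>L 'u"
  assumes l: "wiener_symbol l" and b: "b \<in> linf_LU" and p: "admissible p"
    and nu: "0 < nu"
    and below: "\<And>x. finite {m. x m \<noteq> 0} \<Longrightarrow> nu * Ynorm p x \<le> Ynorm p (wiener_op l b x)"
    and c: "c \<in> linf_LU" and hull: "in_hull b c" and x: "x \<in> Yspace \<infinity>" and Wx: "wiener_op l c x = 0"
  shows "x = 0"
proof -
  obtain C where C0: "0 \<le> C" and C: "\<And>x. x \<in> Yspace \<infinity> \<Longrightarrow> wiener_op l b x \<in> Yspace \<infinity> \<Longrightarrow>
      x \<in> Yspace \<infinity> \<and> Ynorm \<infinity> x \<le> C * Ynorm \<infinity> (wiener_op l b x)"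
    by (rule wiener_stability[OF l b p admissible_infinity nu below]) (auto intro: that)
  define e where "e = 1 / (2 * (C + 1))"
  have e: "0 < e" using C0 by (simp add: e_def)
  obtain k where k: "\<And>m. norm (b (m + k) - c m) \<le> e" using hull e unfolding in_hull_def by blast
  define y where "y = shift (- k) x"
  have y: "y \<in> Yspace \<infinity>" "Ynorm \<infinity> y = Ynorm \<infinity> x" using Yspace_shift[OF _ x] by (auto simp: y_def)
  have Wy: "wiener_op l b y \<in> Yspace \<infinity>" by (rule wiener_op_Yspace[OF l b _ y(1)]) simp
  have sb: "shift k b \<in> linf_LU" using shift_linf[OF b] by (simp add: shift_def)
  have sy: "shift k y = x" by (simp add: y_def shift_def)
  have "Ynorm \<infinity> (wiener_op l b y) = Ynorm \<infinity> (shift k (wiener_op l b y))"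
    using Yspace_shift(2)[OF _ Wy] by simp
  also have "shift k (wiener_op l b y) = wiener_op l (shift k b) x - wiener_op l c x"
    unfolding wiener_op_shift[symmetric] sy Wx by simp
  also have "Ynorm \<infinity> \<dots> \<le> e * Ynorm \<infinity> x"
    by (rule wiener_op_perturb[OF l sb _ x]) (auto simp: shift_def k)
  finally have "C * Ynorm \<infinity> (wiener_op l b y) \<le> C * (e * Ynorm \<infinity> x)"
    using C0 by (rule mult_left_mono)
  then have "Ynorm \<infinity> x \<le> C * e * Ynorm \<infinity> x" using C[OF y(1) Wy] y(2) by (simp add: mult.assoc)
  moreover have "C * e \<le> 1 / 2" using C0 by (simp add: e_def field_simps)
  then have "C * e * Ynorm \<infinity> x \<le> 1 / 2 * Ynorm \<infinity> x"
    using Ynorm_nonneg[OF _ x] by (intro mult_right_mono) auto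
  ultimately have "Ynorm \<infinity> x \<le> 0" by simp
  then show ?thesis using Ynorm_eq_0[OF _ x] by simp
qed

text \<open>Bijectivity is established on \<open>\<ell>\<^sup>\<infinity>\<close>. Stability then shows that the inverse maps \<open>Y\<^sup>p\<close> to itself and is
  bounded there.\<close>
lemma injective_imp_invertible:
  fixes l b :: "int ^ 'n \<Rightarrow> 'u::{complex_normed_vector, banach} \<Rightarrow>\<^sub>L 'u"
  assumes fd: "finite_dimensional scaleC (UNIV :: 'u set)" and l: "wiener_symbol l" and b: "ap_function b"
    and inj: "\<And>c x. c \<in> linf_LU \<Longrightarrow> in_hull b c \<Longrightarrow> x \<in> Yspace \<infinity> \<Longrightarrow> wiener_op l c x = 0 \<Longrightarrow> x = 0"
    and p: "admissible p"
  shows "invertible_on p (wiener_op l b)"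
proof -
  let ?W = "wiener_op l b"
  have bL: "b \<in> linf_LU" using b by (simp add: ap_function_def)
  have "\<exists>nu>0. \<forall>x\<in>Yspace \<infinity>. nu * Ynorm \<infinity> x \<le> Ynorm \<infinity> (?W x)"
    by (rule injective_imp_bounded_below[OF fd l b]) (rule inj)
  then obtain nu where nu: "0 < nu" "\<And>x. x \<in> Yspace \<infinity> \<Longrightarrow> nu * Ynorm \<infinity> x \<le> Ynorm \<infinity> (?W x)"
    by blast
  have below: "Ynorm \<infinity> x \<le> inverse nu * Ynorm \<infinity> (?W x)" if "x \<in> Yspace \<infinity>" for x
    using nu(1) nu(2)[OF that] by (simp add: field_simps)
  have inu: "0 < inverse nu" using nu(1) by simp
  have ex: "\<exists>x\<in>Yspace \<infinity>. ?W x = y" if "y \<in> Yspace \<infinity>" for y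
    by (rule surj_from_finite_support[OF fd l below less_imp_le[OF inu]
          finite_support_in_range[OF fd l b inu below] that])
  have uniq: "x = x'" if "x \<in> Yspace \<infinity>" "x' \<in> Yspace \<infinity>" "?W x = ?W x'" for x x'
  proof -
    have d: "x - x' \<in> Yspace \<infinity>" by (intro Yspace_diff that) simp
    have "?W (x - x') = 0" unfolding wiener_op_diff[OF l bL that(1,2)] that(3) by (rule diff_self)
    then have "x - x' = 0" using inj[OF bL in_hull_refl d] by simp
    then show ?thesis by (simp only: right_minus_eq)
  qed
  have fin: "nu * Ynorm \<infinity> x \<le> Ynorm \<infinity> (?W x)" if "finite {m. x m \<noteq> 0}" for x
    by (rule nu(2), rule Yspace_finite_support(1)[OF _ that]) auto
  obtain C where C: "\<And>x. x \<in> Yspace \<infinity> \<Longrightarrow> ?W x \<in> Yspace p \<Longrightarrow> x \<in> Yspace p \<and> Ynorm p x \<le> C * Ynorm p (?W x)"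
    by (rule wiener_stability[OF l bL admissible_infinity p nu(1) fin]) (auto intro: that)
  define S where "S = (\<lambda>y. SOME x. x \<in> Yspace \<infinity> \<and> ?W x = y)"
  have S: "S y \<in> Yspace \<infinity> \<and> ?W (S y) = y" if "y \<in> Yspace \<infinity>" for y
    using someI_ex[of "\<lambda>x. x \<in> Yspace \<infinity> \<and> ?W x = y"] ex[OF that] unfolding S_def by blast
  have SY: "S y \<in> Yspace p" "Ynorm p (S y) \<le> C * Ynorm p y" "?W (S y) = y" "S y \<in> Yspace \<infinity>"
    if "y \<in> Yspace p" for y
    using C[of "S y"] S[OF Yspace_subset_infinity[OF p that]] that by auto
  have "bounded_op_on p S"
    unfolding bounded_op_on_def
  proof (intro conjI ballI allI exI[of _ C])
    show "S ` Yspace p \<subseteq> Yspace p" using SY(1) by blast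
    show "Ynorm p (S y) \<le> C * Ynorm p y" if "y \<in> Yspace p" for y using SY(2)[OF that] .
    show "S (x + y) = S x + S y" if "x \<in> Yspace p" "y \<in> Yspace p" for x y
    proof (rule uniq)
      have xy: "x + y \<in> Yspace p" by (intro Yspace_add p that)
      show "S (x + y) \<in> Yspace \<infinity>" by (rule SY(4)[OF xy])
      show "S x + S y \<in> Yspace \<infinity>" by (intro Yspace_add SY(4) that) simp
      show "?W (S (x + y)) = ?W (S x + S y)"
        unfolding wiener_op_add[OF l bL SY(4)[OF that(1)] SY(4)[OF that(2)]]
          SY(3)[OF xy] SY(3)[OF that(1)] SY(3)[OF that(2)] ..
    qed
    show "S (cscale a x) = cscale a (S x)" if "x \<in> Yspace p" for a x
    proof (rule uniq)
      have ax: "cscale a x \<in> Yspace p" by (rule Yspace_cscale(1)[OF p that])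
      show "S (cscale a x) \<in> Yspace \<infinity>" by (rule SY(4)[OF ax])
      show "cscale a (S x) \<in> Yspace \<infinity>" by (rule Yspace_cscale(1)[OF _ SY(4)[OF that]]) simp
      show "?W (S (cscale a x)) = ?W (cscale a (S x))"
        unfolding wiener_op_cscale[OF l bL SY(4)[OF that]] SY(3)[OF ax] SY(3)[OF that] ..
    qed
  qed
  moreover have "S (?W x) = x \<and> ?W (S x) = x" if x: "x \<in> Yspace p" for x
  proof
    have WY: "?W x \<in> Yspace p" by (rule wiener_op_Yspace[OF l bL p x])
    show "S (?W x) = x" by (rule uniq[OF SY(4)[OF WY] Yspace_subset_infinity[OF p x] SY(3)[OF WY]])
    show "?W (S x) = x" by (rule SY(3)[OF x])
  qed
  ultimately show ?thesis
    unfolding invertible_on_def using bounded_op_on_wiener_op[OF l bL p] by blast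
qed

lemma invertible_imp_fredholm:
  assumes p: "admissible p" and inv: "invertible_on p T"
  shows "fredholm_on p T"
proof -
  obtain S where T: "bounded_op_on p T" and S: "bounded_op_on p S"
    and ST: "\<And>x. x \<in> Yspace p \<Longrightarrow> S (T x) = x" "\<And>x. x \<in> Yspace p \<Longrightarrow> T (S x) = x"
    using inv unfolding invertible_on_def by blast
  have lin0: "R 0 = 0" if "bounded_op_on p R" for R :: "(int ^ 'a \<Rightarrow> 'b) \<Rightarrow> int ^ 'a \<Rightarrow> 'b"
  proof -
    have "R (cscale 0 0) = cscale 0 (R 0)" using that Yspace_0[OF p] unfolding bounded_op_on_def by blast
    then show ?thesis by (simp only: cs.scale_zero_left)
  qed
  have "{x \<in> Yspace p. T x = 0} = {0}"
  proof
    show "{x \<in> Yspace p. T x = 0} \<subseteq> {0}" using ST(1) lin0[OF S] by force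
    show "{0} \<subseteq> {x \<in> Yspace p. T x = 0}" using Yspace_0[OF p] lin0[OF T] by simp
  qed
  then have "finite_dimensional cscale {x \<in> Yspace p. T x = 0}"
    unfolding finite_dimensional_def by (intro exI[of _ "{}"]) (simp add: cs.span_empty)
  moreover have "\<exists>x\<in>Yspace p. y - T x \<in> cs.span {}" if "y \<in> Yspace p" for y
  proof (rule bexI)
    show "S y \<in> Yspace p" using S that by (auto simp: bounded_op_on_def)
    show "y - T (S y) \<in> cs.span {}" unfolding ST(2)[OF that] by (simp add: cs.span_empty)
  qed
  ultimately show ?thesis
    unfolding fredholm_on_def using T by (intro conjI exI[of _ "{}"]) auto
qed

lemma almost_periodic_fredholm_iff:
  fixes l b :: "int ^ 'n \<Rightarrow> 'u::{complex_normed_vector, banach} \<Rightarrow>\<^sub>L 'u"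
  assumes fd: "finite_dimensional scaleC (UNIV :: 'u set)" and l: "wiener_symbol l" and b: "ap_function b"
    and p: "admissible p"
  defines "all_injective \<equiv> \<forall>c\<in>linf_LU. in_hull b c \<longrightarrow> (\<forall>x\<in>Yspace \<infinity>. wiener_op l c x = 0 \<longrightarrow> x = 0)"
  shows "fredholm_on p (wiener_op l b) \<longleftrightarrow> all_injective"
    and "invertible_on p (wiener_op l b) \<longleftrightarrow> all_injective"
proof -
  have bL: "b \<in> linf_LU" using b by (simp add: ap_function_def)
  have 1: "all_injective" if fr: "fredholm_on p (wiener_op l b)"
  proof -
    obtain nu where nu: "0 < nu"
      and below: "\<And>x. finite {m. x m \<noteq> 0} \<Longrightarrow> nu * Ynorm p x \<le> Ynorm p (wiener_op l b x)"
      by (rule fredholm_imp_bounded_below[OF l b p fr]) (rule that)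
    show ?thesis unfolding all_injective_def
      using bounded_below_imp_injective[OF l bL p nu below] by blast
  qed
  have 2: "invertible_on p (wiener_op l b)" if inj: "all_injective"
    by (rule injective_imp_invertible[OF fd l b _ p]) (use inj in \<open>auto simp: all_injective_def\<close>)
  show "fredholm_on p (wiener_op l b) \<longleftrightarrow> all_injective" "invertible_on p (wiener_op l b) \<longleftrightarrow> all_injective"
    using 1 2 invertible_imp_fredholm[OF p] by blast+
qed

section \<open>Spectra\<close>

text \<open>The coefficient of \<open>z I - (L + M\<^sub>c)\<close>.\<close>
definition scalar_minus :: "complex \<Rightarrow> (int ^ 'n \<Rightarrow> 'u::complex_normed_vector \<Rightarrow>\<^sub>L 'u) \<Rightarrow> int ^ 'n \<Rightarrow> 'u \<Rightarrow>\<^sub>L 'u"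
  where "scalar_minus z c = (\<lambda>m. Blinfun (\<lambda>v. z *\<^sub>C v) - c m)"

lemma blinfun_apply_scalar: "blinfun_apply (Blinfun (\<lambda>v. z *\<^sub>C v)) v = z *\<^sub>C (v :: 'u::complex_normed_vector)"
  by (simp add: bounded_linear_Blinfun_apply
      bounded_bilinear.bounded_linear_right[OF bounded_bilinear_scaleC])

lemma scalar_minus_linf:
  assumes "c \<in> linf_LU" shows "scalar_minus z c \<in> linf_LU"
proof -
  obtain K where K: "\<And>m. norm (c m) \<le> K" using linf_LU_bound[OF assms] by blast
  have "norm (scalar_minus z c m) \<le> norm (Blinfun (\<lambda>v :: 'b. z *\<^sub>C v)) + K" for m
    unfolding scalar_minus_def by (rule order_trans[OF norm_triangle_ineq4 add_left_mono[OF K]])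
  moreover have "scalar_minus z c m \<in> LU" for m
  proof -
    have "c m \<in> LU" using assms by (auto simp: linf_LU_def)
    then show ?thesis
      by (simp add: LU_def scalar_minus_def blinfun.diff_left blinfun_apply_scalar scaleC_scaleC
          sc.scale_right_diff_distrib mult.commute)
  qed
  ultimately show ?thesis by (auto simp: linf_LU_def bounded_iff)
qed

lemma scalar_minus_diff: "norm (scalar_minus z b m - scalar_minus z c k) = norm (b m - c k)"
  by (simp add: scalar_minus_def norm_minus_commute)

lemma in_hull_scalar_minus: "in_hull (scalar_minus z b) (scalar_minus z c) \<longleftrightarrow> in_hull b c"
  by (simp add: in_hull_def scalar_minus_diff)

lemma scalar_minus_invol: "scalar_minus z (scalar_minus z c) = c"
  by (simp add: scalar_minus_def)

lemma ap_function_scalar_minus: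
  assumes b: "ap_function b" shows "ap_function (scalar_minus z b)"
  unfolding ap_function_def
proof (intro conjI)
  show "scalar_minus z b \<in> linf_LU" using b scalar_minus_linf by (auto simp: ap_function_def)
  show "relatively_dense_periods (scalar_minus z b)"
    using b by (simp add: ap_function_def relatively_dense_periods_def scalar_minus_diff)
  show "bochner_normal (scalar_minus z b)" unfolding bochner_normal_def
  proof
    fix k :: "nat \<Rightarrow> int ^ 'a"
    obtain r d where r: "d \<in> linf_LU" "strict_mono r"
      "\<forall>e>0. \<forall>\<^sub>F n in sequentially. \<forall>m. norm (b (m + k (r n)) - d m) \<le> e"
      using b unfolding ap_function_def bochner_normal_def by blast
    then show "\<exists>r. \<exists>d\<in>linf_LU. strict_mono r \<and>
        (\<forall>e>0. \<forall>\<^sub>F n in sequentially. \<forall>m. norm (scalar_minus z b (m + k (r n)) - d m) \<le> e)"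
      by (intro exI[of _ r] bexI[of _ "scalar_minus z d"] conjI) (simp_all add: scalar_minus_diff scalar_minus_linf)
  qed
qed

lemma wiener_symbol_uminus: "wiener_symbol l \<Longrightarrow> wiener_symbol (\<lambda>k. - l k)"
  by (auto simp: wiener_symbol_def LU_def blinfun.minus_left sc.scale_minus_right image_subset_iff)

lemma spectral_operator: "(\<lambda>x. cscale z x - wiener_op l c x) = wiener_op (\<lambda>k. - l k) (scalar_minus z c)"
  by (simp add: fun_eq_iff cscale_def mult_op_def scalar_minus_def blinfun.diff_left blinfun.minus_left
      blinfun_apply_scalar laurent_op_def infsum_uminus)

theorem theorem7p3:
  fixes l b :: "int ^ 'n \<Rightarrow> 'u::{complex_normed_vector, banach} \<Rightarrow>\<^sub>L 'u"
    and L A :: "(int ^ 'n \<Rightarrow> 'u) \<Rightarrow> int ^ 'n \<Rightarrow> 'u"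
  assumes "finite_dimensional scaleC (UNIV :: 'u set)"
    and "wiener_symbol l"
    and "L = laurent_op l"
    and "b \<in> linf_LU"
    and "A = L + mult_op b"
    and "almost_periodic b"
  shows "\<forall>p. p = 0 \<or> 1 \<le> p \<longrightarrow> (\<forall>b' \<in> Lim_set b.
    spec_ess p A = spec p A \<and>
    spec p A = spec p (L + mult_op b') \<and>
    spec p (L + mult_op b') = (\<Union>c\<in>Lim_set b. spec_point \<infinity> (L + mult_op c)))"
proof -
  define E where "E = (\<Union>c\<in>Lim_set b. spec_point \<infinity> (L + mult_op c))"
  have b: "ap_function b" using almost_periodic_imp_ap_function assms(4,6) .
  have plus: "(L + mult_op c) x = wiener_op l c x" for c x
    unfolding assms(3) by simp
  have op: "(\<lambda>x. cscale z x - (L + mult_op c) x) = wiener_op (\<lambda>k. - l k) (scalar_minus z c)" for z c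
    unfolding plus by (rule spectral_operator)
  have nl: "wiener_symbol (\<lambda>k. - l k)" by (rule wiener_symbol_uminus[OF assms(2)])
  have E: "z \<notin> E \<longleftrightarrow> (\<forall>c\<in>linf_LU. in_hull (scalar_minus z d) c \<longrightarrow>
      (\<forall>x\<in>Yspace \<infinity>. wiener_op (\<lambda>k. - l k) c x = 0 \<longrightarrow> x = 0))" if d: "in_hull b d" for z d
  proof -
    have eig: "(L + mult_op c) x = cscale z x \<longleftrightarrow> wiener_op (\<lambda>k. - l k) (scalar_minus z c) x = 0" for c x
    proof -
      have W: "wiener_op (\<lambda>k. - l k) (scalar_minus z c) x = cscale z x - (L + mult_op c) x"
        using fun_cong[OF op[of z c], of x] by (rule sym)
      show ?thesis unfolding W right_minus_eq by (rule eq_commute)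
    qed
    have "z \<notin> E \<longleftrightarrow> (\<forall>c\<in>linf_LU. in_hull d c \<longrightarrow>
        (\<forall>x\<in>Yspace \<infinity>. wiener_op (\<lambda>k. - l k) (scalar_minus z c) x = 0 \<longrightarrow> x = 0))"
      unfolding E_def Lim_set_eq_hull[OF b] spec_point_def UN_iff mem_Collect_eq eig
      using in_hull_trans[OF d] in_hull_trans[OF in_hull_sym[OF d]] by blast
    also have "\<dots> \<longleftrightarrow> (\<forall>c\<in>linf_LU. in_hull (scalar_minus z d) c \<longrightarrow>
      (\<forall>x\<in>Yspace \<infinity>. wiener_op (\<lambda>k. - l k) c x = 0 \<longrightarrow> x = 0))"
      using scalar_minus_invol scalar_minus_linf in_hull_scalar_minus by metis
    finally show ?thesis .
  qed
  have sp: "spec_ess p (L + mult_op d) = E" "spec p (L + mult_op d) = E"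
    if p: "admissible p" and d: "d \<in> linf_LU" "in_hull b d" for p d
  proof -
    have apd: "ap_function (scalar_minus z d)" for z by (rule ap_function_scalar_minus[OF ap_function_in_hull[OF b d]])
    show "spec_ess p (L + mult_op d) = E" "spec p (L + mult_op d) = E"
      unfolding spec_ess_def spec_def op
        almost_periodic_fredholm_iff[OF assms(1) nl apd p] E[OF d(2), symmetric] by simp_all
  qed
  show ?thesis
  proof (intro allI impI ballI)
    fix p :: ennreal and b' assume "p = 0 \<or> 1 \<le> p" and "b' \<in> Lim_set b"
    then have p: "admissible p" and b': "b' \<in> linf_LU" "in_hull b b'"
      using Lim_set_eq_hull[OF b] by (auto simp: admissible_def)
    show "spec_ess p A = spec p A \<and> spec p A = spec p (L + mult_op b') \<and>
      spec p (L + mult_op b') = (\<Union>c\<in>Lim_set b. spec_point \<infinity> (L + mult_op c))"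
      unfolding assms(5) E_def[symmetric] sp[OF p b'] sp[OF p assms(4) in_hull_refl] by simp
  qed
qed

end
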